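(* For every integer $n>2$, there is a long exact sequence $$\cdots\to \left(H^{k-1}(M_{n-2,3}(\mathbb{R}),\mathbb{Z})\right)^{n-1}\to H^k(Q_n,\mathbb{Z})\xrightarrow{\ i^*\ } H^k(M_{n-1,3}(\mathbb{R}),\mathbb{Z})\xrightarrow{\ d\ }\left(H^k(M_{n-2,3}(\mathbb{R}),\mathbb{Z})\right)^{n-1}\to\cdots,$$ where the map $i^*$ is induced by the inclusion $i$ of $M_{n-1,3}(\mathbb{R})$ into $Q_n$.
   Context: Let $S^1$ be the circle with a fixed point $\infty\in S^1$, let $T^{n-1}=\{(x_1,\ldots,x_{n-1})\mid x_i\in S^1\}$ be the $(n-1)$-dimensional torus and set $x_n=\infty$. For $1\leq i<j<k\leq n$ let $A_{ijk}\subset T^{n-1}$ be the subset of points satisfying $x_i=x_j=x_k$, and let $A_n=\bigcup_{1\leq i<j<k\leq n}A_{ijk}$. The space $Q_n$ is the complement $T^{n-1}\setminus A_n$. For $m\ge 1$, $M_{m,3}(\mathbb{R})\subset\mathbb{R}^m$ is the space of configurations $(x_1,\dots,x_m)$ of $m$ ordered points in $\mathbb{R}$ no three of which coincide. Identifying $S^1\setminus\{\infty\}$ with $\mathbb{R}$, the space $M_{n-1,3}(\mathbb{R})$ is included in $Q_n$ as the subspace of configurations $(x_1,\dots,x_{n-1})$ with $x_i\neq\infty$ for all $i<n$ (i.e. those in which the point at infinity has multiplicity 1). *)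

theory Defs
  imports "HOL-Homology.Homology" "HOL-Algebra.Product_Groups"
begin

section \<open>Singular cohomology with integer coefficients\<close>

text \<open>The cochain group in degree \<open>p\<close> is \<open>Hom(C\<^sub>p(X), \<int>)\<close>. Homomorphisms are made extensional
  so that equality of cochains is equality on chains in \<open>X\<close>.\<close>

definition cochain_group :: "nat \<Rightarrow> 'a topology \<Rightarrow> ('a chain \<Rightarrow> int) monoid" where
  "cochain_group p X =
     \<lparr>carrier = hom (chain_group p X) integer_group \<inter> extensional (singular_chain_set p X),
      monoid.mult = (\<lambda>\<phi> \<psi>. \<lambda>c\<in>singular_chain_set p X. \<phi> c + \<psi> c),
      one = (\<lambda>c\<in>singular_chain_set p X. 0)\<rparr>"

definition coboundary :: "nat \<Rightarrow> 'a topology \<Rightarrow> ('a chain \<Rightarrow> int) \<Rightarrow> 'a chain \<Rightarrow> int" where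
  "coboundary p X \<phi> = (\<lambda>c\<in>singular_chain_set (Suc p) X. \<phi> (chain_boundary (Suc p) c))"

definition cocycle_set :: "nat \<Rightarrow> 'a topology \<Rightarrow> ('a chain \<Rightarrow> int) set" where
  "cocycle_set p X = kernel (cochain_group p X) (cochain_group (Suc p) X) (coboundary p X)"

definition coboundary_set :: "nat \<Rightarrow> 'a topology \<Rightarrow> ('a chain \<Rightarrow> int) set" where
  "coboundary_set p X =
     (case p of 0 \<Rightarrow> {\<one>\<^bsub>cochain_group 0 X\<^esub>}
      | Suc q \<Rightarrow> coboundary q X ` carrier (cochain_group q X))"

text \<open>As for \<^const>\<open>homology_group\<close>, the degree is an integer and the groups in negative
  degrees are trivial.\<close>

definition cohomology_group :: "int \<Rightarrow> 'a topology \<Rightarrow> ('a chain \<Rightarrow> int) set monoid" where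
  "cohomology_group p X =
     (if p < 0 then singleton_group undefined
      else (cochain_group (nat p) X)\<lparr>carrier := cocycle_set (nat p) X\<rparr> Mod coboundary_set (nat p) X)"

definition cochain_map ::
    "nat \<Rightarrow> 'a topology \<Rightarrow> ('a \<Rightarrow> 'b) \<Rightarrow> ('b chain \<Rightarrow> int) \<Rightarrow> 'a chain \<Rightarrow> int" where
  "cochain_map p X f \<phi> = (\<lambda>c\<in>singular_chain_set p X. \<phi> (chain_map p f c))"

text \<open>For \<open>f : X \<rightarrow> Y\<close>, the map \<open>H\<^sup>p(Y) \<rightarrow> H\<^sup>p(X)\<close> sending the class of \<open>\<phi>\<close> to the class of its
  pullback. The union ranges over all representatives; they all give the same coset
  (\<open>cohom_induced_coset\<close>). The topology on \<open>Y\<close> is not needed to define it.\<close>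

definition cohom_induced ::
    "int \<Rightarrow> 'a topology \<Rightarrow> ('a \<Rightarrow> 'b) \<Rightarrow> ('b chain \<Rightarrow> int) set \<Rightarrow> ('a chain \<Rightarrow> int) set" where
  "cohom_induced p X f A =
     (if p < 0 then undefined
      else \<Union>\<phi>\<in>A. coboundary_set (nat p) X #>\<^bsub>cochain_group (nat p) X\<^esub> cochain_map (nat p) X f \<phi>)"


subsection \<open>Well-definedness\<close>

lemma cochain_group_simps [simp]:
  "carrier (cochain_group p X) =
     hom (chain_group p X) integer_group \<inter> extensional (singular_chain_set p X)"
  "\<phi> \<otimes>\<^bsub>cochain_group p X\<^esub> \<psi> = (\<lambda>c\<in>singular_chain_set p X. \<phi> c + \<psi> c)"
  "\<one>\<^bsub>cochain_group p X\<^esub> = (\<lambda>c\<in>singular_chain_set p X. 0)"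
  by (simp_all add: cochain_group_def)

lemma comm_group_cochain_group: "comm_group (cochain_group p X)"
proof (rule comm_groupI)
  fix \<phi> assume \<phi>: "\<phi> \<in> carrier (cochain_group p X)"
  show "\<exists>\<psi>\<in>carrier (cochain_group p X). \<psi> \<otimes>\<^bsub>cochain_group p X\<^esub> \<phi> = \<one>\<^bsub>cochain_group p X\<^esub>"
    by (rule bexI [of _ "\<lambda>c\<in>singular_chain_set p X. - \<phi> c"])
       (use \<phi> in \<open>auto simp: hom_def singular_chain_add\<close>)
qed (auto simp: hom_def singular_chain_add extensional_def fun_eq_iff)

lemma coboundary_hom: "coboundary p X \<in> hom (cochain_group p X) (cochain_group (Suc p) X)"
  by (rule homI)
     (auto simp: hom_def coboundary_def singular_chain_add chain_boundary_add fun_eq_iff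
        dest: singular_chain_boundary_alt)

lemma coboundary_coboundary:
  assumes "\<phi> \<in> carrier (cochain_group p X)"
  shows "coboundary (Suc p) X (coboundary p X \<phi>) = \<one>\<^bsub>cochain_group (Suc (Suc p)) X\<^esub>"
proof -
  have "\<phi> 0 = 0"
    using assms hom_one [of \<phi> "chain_group p X" integer_group] by simp
  then show ?thesis
    by (auto simp: coboundary_def fun_eq_iff singular_chain_boundary_alt
        chain_boundary_boundary_alt)
qed

lemma subgroup_cocycle_set: "subgroup (cocycle_set p X) (cochain_group p X)"
  unfolding cocycle_set_def
  by (intro group_hom.subgroup_kernel group_hom.intro group_hom_axioms.intro coboundary_hom
      comm_group.axioms(2) comm_group_cochain_group)

lemma subgroup_coboundary_set: "subgroup (coboundary_set p X) (cochain_group p X)"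
proof (cases p)
  case 0
  then show ?thesis
    using group.triv_subgroup [OF comm_group.axioms(2) [OF comm_group_cochain_group [of 0 X]]]
    by (simp add: coboundary_set_def)
next
  case (Suc q)
  have "group_hom (cochain_group q X) (cochain_group p X) (coboundary q X)"
    unfolding Suc
    by (intro group_hom.intro group_hom_axioms.intro coboundary_hom comm_group.axioms(2)
        comm_group_cochain_group)
  then show ?thesis
    unfolding Suc coboundary_set_def using group_hom.img_is_subgroup by fastforce
qed

lemma coboundary_set_subset_cocycle_set: "coboundary_set p X \<subseteq> cocycle_set p X"
proof (cases p)
  case 0
  then show ?thesis
    using subgroup.one_closed [OF subgroup_cocycle_set [of 0 X]] by (simp add: coboundary_set_def)
next
  case (Suc q)
  then show ?thesis
    using coboundary_coboundary [of _ q X] hom_in_carrier [OF coboundary_hom [of q X]]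
    by (fastforce simp: coboundary_set_def cocycle_set_def kernel_def)
qed

lemma comm_group_cocycle: "comm_group ((cochain_group p X)\<lparr>carrier := cocycle_set p X\<rparr>)"
proof (rule group.group_comm_groupI)
  show "group ((cochain_group p X)\<lparr>carrier := cocycle_set p X\<rparr>)"
    by (intro group.subgroup_imp_group comm_group.axioms(2) comm_group_cochain_group
        subgroup_cocycle_set)
qed (auto simp: fun_eq_iff)

lemma subgroup_coboundary_cocycle:
  "subgroup (coboundary_set p X) ((cochain_group p X)\<lparr>carrier := cocycle_set p X\<rparr>)"
  by (intro group.subgroup_incl comm_group.axioms(2) comm_group_cochain_group
      subgroup_coboundary_set subgroup_cocycle_set coboundary_set_subset_cocycle_set)

lemma comm_group_cohomology_group: "comm_group (cohomology_group p X)"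
  unfolding cohomology_group_def
  by (auto intro: comm_group.abelian_FactGroup comm_group_cocycle subgroup_coboundary_cocycle)

lemma group_cohomology_group [simp]: "group (cohomology_group p X)"
  using comm_group_cohomology_group by (rule comm_group.axioms(2))

lemma cochain_map_hom:
  assumes "continuous_map X Y f"
  shows "cochain_map p X f \<in> hom (cochain_group p Y) (cochain_group p X)"
  using assms
  by (intro homI)
     (auto simp: hom_def cochain_map_def singular_chain_add chain_map_add fun_eq_iff
        dest: singular_chain_chain_map)

lemma coboundary_cochain_map:
  assumes "continuous_map X Y f"
  shows "coboundary p X (cochain_map p X f \<phi>) = cochain_map (Suc p) X f (coboundary p Y \<phi>)"
  using assms
  by (auto simp: coboundary_def cochain_map_def fun_eq_iff singular_chain_boundary_alt
      singular_chain_chain_map chain_boundary_chain_map)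

lemma cochain_map_cocycle:
  assumes f: "continuous_map X Y f" and \<phi>: "\<phi> \<in> cocycle_set p Y"
  shows "cochain_map p X f \<phi> \<in> cocycle_set p X"
proof -
  have "cochain_map p X f \<phi> \<in> carrier (cochain_group p X)"
    using hom_in_carrier [OF cochain_map_hom [OF f]] \<phi> by (simp add: cocycle_set_def kernel_def)
  moreover have "coboundary p X (cochain_map p X f \<phi>) = \<one>\<^bsub>cochain_group (Suc p) X\<^esub>"
    using \<phi> f unfolding coboundary_cochain_map [OF f]
    by (auto simp: cocycle_set_def kernel_def cochain_map_def fun_eq_iff singular_chain_chain_map)
  ultimately show ?thesis
    by (simp add: cocycle_set_def kernel_def)
qed

lemma cochain_map_coboundary:
  assumes f: "continuous_map X Y f" and \<phi>: "\<phi> \<in> coboundary_set p Y"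
  shows "cochain_map p X f \<phi> \<in> coboundary_set p X"
proof (cases p)
  case 0
  then show ?thesis
    using \<phi> f by (auto simp: coboundary_set_def cochain_map_def fun_eq_iff singular_chain_chain_map)
next
  case (Suc q)
  then obtain \<psi> where \<psi>: "\<psi> \<in> carrier (cochain_group q Y)" "\<phi> = coboundary q Y \<psi>"
    using \<phi> by (auto simp: coboundary_set_def)
  then have "cochain_map p X f \<phi> = coboundary q X (cochain_map q X f \<psi>)"
    by (simp add: Suc coboundary_cochain_map [OF f])
  then show ?thesis
    using hom_in_carrier [OF cochain_map_hom [OF f] \<psi>(1)] by (auto simp: Suc coboundary_set_def)
qed

lemma cohom_induced_coset:
  assumes f: "continuous_map X Y f" and \<phi>: "\<phi> \<in> cocycle_set p Y"
  shows "cohom_induced (int p) X f (coboundary_set p Y #>\<^bsub>cochain_group p Y\<^esub> \<phi>) =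
         coboundary_set p X #>\<^bsub>cochain_group p X\<^esub> cochain_map p X f \<phi>"
proof -
  let ?CX = "cochain_group p X" and ?CY = "cochain_group p Y"
  interpret X: comm_group ?CX by (rule comm_group_cochain_group)
  interpret Y: comm_group ?CY by (rule comm_group_cochain_group)
  have \<phi>C: "\<phi> \<in> carrier ?CY"
    using \<phi> by (simp add: cocycle_set_def kernel_def)
  have "coboundary_set p X #>\<^bsub>?CX\<^esub> cochain_map p X f \<psi> =
        coboundary_set p X #>\<^bsub>?CX\<^esub> cochain_map p X f \<phi>"
    if "\<psi> \<in> coboundary_set p Y #>\<^bsub>?CY\<^esub> \<phi>" for \<psi>
  proof -
    from that obtain \<beta> where \<beta>: "\<beta> \<in> coboundary_set p Y" "\<psi> = \<beta> \<otimes>\<^bsub>?CY\<^esub> \<phi>"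
      unfolding r_coset_def by blast
    have "\<beta> \<in> carrier ?CY"
      using \<beta> subgroup.mem_carrier [OF subgroup_coboundary_set] by blast
    then have "cochain_map p X f \<psi> = cochain_map p X f \<beta> \<otimes>\<^bsub>?CX\<^esub> cochain_map p X f \<phi>"
      unfolding \<beta>(2) by (intro hom_mult [OF cochain_map_hom [OF f]] \<phi>C)
    then have "cochain_map p X f \<psi> \<in> coboundary_set p X #>\<^bsub>?CX\<^esub> cochain_map p X f \<phi>"
      using cochain_map_coboundary [OF f \<beta>(1)] unfolding r_coset_def by blast
    then show ?thesis
      using hom_in_carrier [OF cochain_map_hom [OF f] \<phi>C] subgroup_coboundary_set
      by (rule X.repr_independence [symmetric])
  qed
  moreover have "\<phi> \<in> coboundary_set p Y #>\<^bsub>?CY\<^esub> \<phi>"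
    by (rule Y.rcos_self [OF \<phi>C subgroup_coboundary_set])
  ultimately have "(\<Union>\<psi>\<in>coboundary_set p Y #>\<^bsub>?CY\<^esub> \<phi>.
      coboundary_set p X #>\<^bsub>?CX\<^esub> cochain_map p X f \<psi>) =
      coboundary_set p X #>\<^bsub>?CX\<^esub> cochain_map p X f \<phi>"
    by (intro UN_constant_eq ballI)
  then show ?thesis
    by (simp only: cohom_induced_def nat_int of_nat_less_0_iff if_False)
qed

lemma cohom_induced_hom:
  assumes f: "continuous_map X Y f"
  shows "cohom_induced p X f \<in> hom (cohomology_group p Y) (cohomology_group p X)"
proof (cases "p < 0")
  case True
  then show ?thesis
    by (simp add: cohomology_group_def cohom_induced_def)
next
  case False
  define q where "q = nat p"
  have p: "p = int q"
    using False by (simp add: q_def)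
  have r: "r_coset (cochain_group q Z\<lparr>carrier := A\<rparr>) = r_coset (cochain_group q Z)"
    for Z :: "'c topology" and A
    by (simp add: r_coset_def fun_eq_iff)
  have n: "coboundary_set q Z \<lhd> (cochain_group q Z)\<lparr>carrier := cocycle_set q Z\<rparr>"
    for Z :: "'c topology"
    by (intro comm_group.subgroup_imp_normal comm_group_cocycle subgroup_coboundary_cocycle)
  have carr: "A \<in> carrier (cohomology_group p Z) \<longleftrightarrow>
      (\<exists>\<phi>\<in>cocycle_set q Z. A = coboundary_set q Z #>\<^bsub>cochain_group q Z\<^esub> \<phi>)"
    for Z :: "'c topology" and A
    unfolding p cohomology_group_def by (simp add: FactGroup_def RCOSETS_def r_coset_def)
  have mult: "(coboundary_set q Z #>\<^bsub>cochain_group q Z\<^esub> \<phi>) \<otimes>\<^bsub>cohomology_group p Z\<^esub>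
      (coboundary_set q Z #>\<^bsub>cochain_group q Z\<^esub> \<psi>) =
      coboundary_set q Z #>\<^bsub>cochain_group q Z\<^esub> (\<phi> \<otimes>\<^bsub>cochain_group q Z\<^esub> \<psi>)"
    if "\<phi> \<in> cocycle_set q Z" "\<psi> \<in> cocycle_set q Z" for Z :: "'c topology" and \<phi> \<psi>
    using normal.rcos_sum [OF n, of \<phi> Z \<psi>] that
    unfolding p cohomology_group_def by (simp add: FactGroup_def r)
  note ind = cohom_induced_coset [OF f, of _ q, folded p]
  show ?thesis
  proof (rule homI)
    fix A assume "A \<in> carrier (cohomology_group p Y)"
    then obtain \<phi> where \<phi>: "\<phi> \<in> cocycle_set q Y"
      and A: "A = coboundary_set q Y #>\<^bsub>cochain_group q Y\<^esub> \<phi>"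
      unfolding carr by blast
    show "cohom_induced p X f A \<in> carrier (cohomology_group p X)"
      unfolding carr A ind [OF \<phi>] using cochain_map_cocycle [OF f \<phi>] by blast
  next
    fix A B
    assume "A \<in> carrier (cohomology_group p Y)" "B \<in> carrier (cohomology_group p Y)"
    then obtain \<phi> \<psi> where \<phi>: "\<phi> \<in> cocycle_set q Y"
      and A: "A = coboundary_set q Y #>\<^bsub>cochain_group q Y\<^esub> \<phi>"
      and \<psi>: "\<psi> \<in> cocycle_set q Y"
      and B: "B = coboundary_set q Y #>\<^bsub>cochain_group q Y\<^esub> \<psi>"
      unfolding carr by blast
    have \<phi>\<psi>: "\<phi> \<otimes>\<^bsub>cochain_group q Y\<^esub> \<psi> \<in> cocycle_set q Y"
      using subgroup.m_closed [OF subgroup_cocycle_set \<phi> \<psi>] .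
    have "cochain_map q X f (\<phi> \<otimes>\<^bsub>cochain_group q Y\<^esub> \<psi>) =
        cochain_map q X f \<phi> \<otimes>\<^bsub>cochain_group q X\<^esub> cochain_map q X f \<psi>"
      using hom_mult [OF cochain_map_hom [OF f]] \<phi> \<psi> by (simp add: cocycle_set_def kernel_def)
    then show "cohom_induced p X f (A \<otimes>\<^bsub>cohomology_group p Y\<^esub> B) =
        cohom_induced p X f A \<otimes>\<^bsub>cohomology_group p X\<^esub> cohom_induced p X f B"
      unfolding A B mult [OF \<phi> \<psi>] ind [OF \<phi>] ind [OF \<psi>] ind [OF \<phi>\<psi>]
        mult [OF cochain_map_cocycle [OF f \<phi>] cochain_map_cocycle [OF f \<psi>]]
      by (rule arg_cong)
  qed
qed


section \<open>Exactness\<close>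

text \<open>Exactness of \<open>G \<rightarrow> H \<rightarrow> K\<close> at \<open>H\<close>. The library's \<^const>\<open>exact_seq\<close> needs all groups to have
  elements of one type, which fails here.\<close>

definition exact_at ::
    "'a monoid \<Rightarrow> ('a \<Rightarrow> 'b) \<Rightarrow> 'b monoid \<Rightarrow> ('b \<Rightarrow> 'c) \<Rightarrow> 'c monoid \<Rightarrow> bool" where
  "exact_at G f H g K \<longleftrightarrow> group_hom G H f \<and> group_hom H K g \<and> kernel H K g = f ` carrier G"


section \<open>The spaces\<close>

text \<open>\<open>M\<^bsub>m,3\<^esub>(\<real>)\<close>: configurations of \<open>m\<close> points in \<open>\<real>\<close>, no three of which coincide.\<close>

definition no_three_config :: "nat \<Rightarrow> (nat \<Rightarrow> real) topology" where
  "no_three_config m =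
     subtopology (powertop_real {1..m})
       {x. \<forall>i j k. 1 \<le> i \<and> i < j \<and> j < k \<and> k \<le> m \<longrightarrow> \<not> (x i = x j \<and> x j = x k)}"

abbreviation circle :: "complex set" where
  "circle \<equiv> sphere 0 1"

definition torus :: "nat \<Rightarrow> (nat \<Rightarrow> complex) topology" where
  "torus m = product_topology (\<lambda>_. top_of_set circle) {1..m}"

text \<open>In the next two definitions \<open>w\<close> is the base point of the circle (the point at infinity);
  the update \<open>x(n := w)\<close> is the convention \<open>x\<^sub>n = \<infinity>\<close>.\<close>

definition triple_diagonal ::
    "nat \<Rightarrow> complex \<Rightarrow> nat \<Rightarrow> nat \<Rightarrow> nat \<Rightarrow> (nat \<Rightarrow> complex) set" where
  "triple_diagonal n w i j k =
     {x \<in> topspace (torus (n - 1)). (x(n := w)) i = (x(n := w)) j \<and> (x(n := w)) j = (x(n := w)) k}"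

definition Q_space :: "nat \<Rightarrow> complex \<Rightarrow> (nat \<Rightarrow> complex) topology" where
  "Q_space n w =
     subtopology (torus (n - 1))
       (topspace (torus (n - 1)) -
        (\<Union>(i, j, k) \<in> {(i, j, k). 1 \<le> i \<and> i < j \<and> j < k \<and> k \<le> n}. triple_diagonal n w i j k))"

text \<open>The inclusion of \<open>M\<^bsub>n-1,3\<^esub>(\<real>)\<close> into \<open>Q\<^sub>n\<close> determined by an identification \<open>h\<close> of \<open>\<real>\<close> with the
  punctured circle.\<close>

definition config_inclusion :: "nat \<Rightarrow> (real \<Rightarrow> complex) \<Rightarrow> (nat \<Rightarrow> real) \<Rightarrow> nat \<Rightarrow> complex" where
  "config_inclusion n h x = (\<lambda>i\<in>{1..n - 1}. h (x i))"

lemma continuous_map_config_inclusion: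
  assumes h: "homeomorphic_map euclideanreal (top_of_set (circle - {w})) h"
  shows "continuous_map (no_three_config (n - 1)) (Q_space n w) (config_inclusion n h)"
proof -
  have cont: "continuous_map euclideanreal (top_of_set circle) h"
    using homeomorphic_imp_continuous_map [OF h]
    by (auto simp: continuous_map_in_subtopology)
  have inj: "h s = h t \<longleftrightarrow> s = t" and w: "h s \<noteq> w" "w \<noteq> h s" for s t
    using homeomorphic_imp_injective_map [OF h] homeomorphic_imp_surjective_map [OF h]
    by (auto simp: inj_on_def)
  have "continuous_map (powertop_real {1..n - 1}) (torus (n - 1)) (config_inclusion n h)"
    unfolding torus_def config_inclusion_def continuous_map_componentwise
  proof (intro conjI ballI)
    fix i assume i: "i \<in> {1..n - 1}"
    have "continuous_map (powertop_real {1..n - 1}) (top_of_set circle) (h \<circ> (\<lambda>x. x i))"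
      using continuous_map_product_projection [OF i] cont by (rule continuous_map_compose)
    then show "continuous_map (powertop_real {1..n - 1}) (top_of_set circle)
        (\<lambda>x. (\<lambda>i\<in>{1..n - 1}. h (x i)) i)"
      using i by (simp add: o_def)
  qed auto
  then have *: "continuous_map (no_three_config (n - 1)) (torus (n - 1)) (config_inclusion n h)"
    unfolding no_three_config_def by (rule continuous_map_from_subtopology)
  have "config_inclusion n h x \<notin> triple_diagonal n w i j k"
    if "x \<in> topspace (no_three_config (n - 1))" "1 \<le> i" "i < j" "j < k" "k \<le> n" for x i j k
    using that by (auto simp: triple_diagonal_def config_inclusion_def no_three_config_def inj w)
  then show ?thesis
    using * continuous_map_image_subset_topspace [OF *]
    unfolding Q_space_def continuous_map_in_subtopology by (auto simp: image_subset_iff)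
qed

lemma config_inclusion_image:
  assumes h: "homeomorphic_map euclideanreal (top_of_set (circle - {w})) h"
  shows "config_inclusion n h ` topspace (no_three_config (n - 1)) =
         {x \<in> topspace (Q_space n w). \<forall>i\<in>{1..n - 1}. x i \<noteq> w}"
proof -
  have im: "range h = circle - {w}"
    using homeomorphic_imp_surjective_map [OF h] by simp
  have "x \<in> config_inclusion n h ` topspace (no_three_config (n - 1))"
    if x: "x \<in> topspace (Q_space n w)" "\<forall>i\<in>{1..n - 1}. x i \<noteq> w" for x
  proof -
    have xT: "x \<in> (\<Pi>\<^sub>E i\<in>{1..n - 1}. circle)"
      using x by (simp add: Q_space_def torus_def)
    then have "\<forall>i\<in>{1..n - 1}. \<exists>t. x i = h t"
      using x(2) im by (metis DiffI PiE_mem rangeE singletonD)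
    then obtain y where y: "\<And>i. i \<in> {1..n - 1} \<Longrightarrow> x i = h (y i)"
      by metis
    define z where "z = restrict y {1..n - 1}"
    have xz: "x = config_inclusion n h z"
      using xT y by (auto simp: config_inclusion_def z_def PiE_iff extensional_def fun_eq_iff)
    have "\<not> (z i = z j \<and> z j = z k)" if "1 \<le> i" "i < j" "j < k" "k \<le> n - 1" for i j k
    proof
      assume "z i = z j \<and> z j = z k"
      moreover have "i \<in> {1..n - 1}" "j \<in> {1..n - 1}" "k \<in> {1..n - 1}"
        using that by auto
      moreover have "i < n" "j < n" "k < n"
        using that by auto
      ultimately have "x \<in> triple_diagonal n w i j k"
        using x(1) xz by (simp add: triple_diagonal_def Q_space_def config_inclusion_def)
      then show False
        using x(1) that by (auto simp: Q_space_def)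
    qed
    then have "z \<in> topspace (no_three_config (n - 1))"
      by (auto simp: no_three_config_def z_def)
    then show ?thesis
      using xz by blast
  qed
  moreover have "\<forall>i\<in>{1..n - 1}. config_inclusion n h z i \<noteq> w" for z
    using im by (auto simp: config_inclusion_def)
  ultimately show ?thesis
    using continuous_map_image_subset_topspace [OF continuous_map_config_inclusion [OF h, of n]]
    by blast
qed

end

theory Submission
  imports Defs
begin

text \<open>The complement of \<open>M\<^bsub>n-1,3\<^esub>(\<real>)\<close> in \<open>Q\<^sub>n\<close> is the disjoint union of the closed sets
  \<open>C\<^sub>i = {x. x\<^sub>i = \<infinity>}\<close>, since two points at infinity together with \<open>x\<^sub>n\<close> would form a forbidden
  triple; each \<open>C\<^sub>i\<close> is a copy of \<open>M\<^bsub>n-2,3\<^esub>(\<real>)\<close>. The configurations in which \<open>x\<^sub>i\<close> is strictly closer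
  to infinity than all the other points form an open collar of \<open>C\<^sub>i\<close>, and these collars are disjoint.
  Forgetting \<open>x\<^sub>i\<close> is a homotopy equivalence from the collar to \<open>M\<^bsub>n-2,3\<^esub>(\<real>)\<close>, and also from each of
  the two sides of \<open>C\<^sub>i\<close> in it. So the Mayer-Vietoris sequence of the cover of \<open>Q\<^sub>n\<close> by
  \<open>M\<^bsub>n-1,3\<^esub>(\<real>)\<close> and the collars reduces to the stated one, with \<open>d\<close> the difference of the
  restrictions to the two sides.\<close>

section \<open>Cochains as functions on simplices\<close>

text \<open>Statements about homology groups do not dualise, chain homotopies do. So homotopy
  invariance and the passage to small simplices are obtained as explicit chain homotopies, which are
  then composed with cochains; classes enter only at the end. The reduction of Mayer-Vietoris rests
  on a diagonal: under the projections, the restriction from H^k of a collar to H^k of its two sides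
  becomes x -> (x, x), because the section of either side inverts the projection of the whole collar
  up to homotopy. Its cokernel is one copy of H^k of the smaller configuration space, by (x, y) -> x
  - y, and every class in it has a representative that is 0 on the side \<open>False\<close>. Hence
  the normalisation in \<open>connects\<close>, and hence a difference as \<open>d\<close>. The
  geometric obstacle is that no fixed radius gives a collar: comparing \<open>gap (x i)\<close> with
  the other gaps lets the width depend on the configuration, and straight-line motion in the
  coordinate \<open>arc\<close> stays within it. Since n > 2, a collar point has a second coordinate
  besides x_i, which keeps x_i away from \<open>h 0\<close>, where \<open>arc\<close> jumps.\<close>

definition cochain_eval :: "('s \<Rightarrow> int) \<Rightarrow> ('s \<Rightarrow>\<^sub>0 int) \<Rightarrow> int" where
  "cochain_eval u c = (\<Sum>\<sigma>\<in>Poly_Mapping.keys c. Poly_Mapping.lookup c \<sigma> * u \<sigma>)"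

lemma cochain_eval_superset:
  assumes "finite A" "Poly_Mapping.keys c \<subseteq> A"
  shows "cochain_eval u c = (\<Sum>\<sigma>\<in>A. Poly_Mapping.lookup c \<sigma> * u \<sigma>)"
  unfolding cochain_eval_def
  by (rule sum.mono_neutral_left) (use assms in \<open>auto simp: in_keys_iff\<close>)

lemma cochain_eval_0 [simp]: "cochain_eval u 0 = 0"
  by (simp add: cochain_eval_def)

lemma cochain_eval_of [simp]: "cochain_eval u (frag_of \<sigma>) = u \<sigma>"
  by (simp add: cochain_eval_def)

lemma cochain_eval_add: "cochain_eval u (a + b) = cochain_eval u a + cochain_eval u b"
proof -
  let ?A = "Poly_Mapping.keys a \<union> Poly_Mapping.keys b"
  have "Poly_Mapping.keys (a + b) \<subseteq> ?A"
    by (rule keys_add)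
  then show ?thesis
    by (simp add: cochain_eval_superset [of ?A] lookup_add sum.distrib distrib_right)
qed

lemma cochain_eval_cmul: "cochain_eval u (frag_cmul k a) = k * cochain_eval u a"
  using cochain_eval_superset [of "Poly_Mapping.keys a" "frag_cmul k a" u]
  by (simp add: keys_cmul cochain_eval_def [of u a] sum_distrib_left mult.assoc)

lemma cochain_eval_minus: "cochain_eval u (- a) = - cochain_eval u a"
  using cochain_eval_cmul [of u "-1" a] by simp

lemma cochain_eval_diff: "cochain_eval u (a - b) = cochain_eval u a - cochain_eval u b"
  using cochain_eval_add [of u a "- b"] by (simp add: cochain_eval_minus)

lemma cochain_eval_sum: "cochain_eval u (sum f A) = (\<Sum>x\<in>A. cochain_eval u (f x))"
  by (induction A rule: infinite_finite_induct) (auto simp: cochain_eval_add)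

lemma cochain_eval_extend:
  "cochain_eval u (frag_extend f c) = cochain_eval (\<lambda>\<sigma>. cochain_eval u (f \<sigma>)) c"
  by (simp add: frag_extend_def cochain_eval_sum cochain_eval_cmul cochain_eval_def [of _ c])

lemma cochain_eval_cong:
  assumes "singular_chain p X c" "\<And>\<sigma>. singular_simplex p X \<sigma> \<Longrightarrow> u \<sigma> = v \<sigma>"
  shows "cochain_eval u c = cochain_eval v c"
  using assms unfolding cochain_eval_def singular_chain_def
  by (intro sum.cong) auto

lemma cochain_eval_plus_left: "cochain_eval (\<lambda>\<sigma>. u \<sigma> + v \<sigma>) c = cochain_eval u c + cochain_eval v c"
  by (simp add: cochain_eval_def distrib_left sum.distrib)

lemma cochain_eval_minus_left: "cochain_eval (\<lambda>\<sigma>. - u \<sigma>) c = - cochain_eval u c"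
  by (simp add: cochain_eval_def sum_negf)

lemma cochain_eval_diff_left: "cochain_eval (\<lambda>\<sigma>. u \<sigma> - v \<sigma>) c = cochain_eval u c - cochain_eval v c"
  by (simp add: cochain_eval_def right_diff_distrib sum_subtractf)

lemma cochain_eval_zero_left [simp]: "cochain_eval (\<lambda>\<sigma>. 0) c = 0"
  by (simp add: cochain_eval_def)

lemma cochain_eval_chain_map:
  "cochain_eval u (chain_map p f c) = cochain_eval (\<lambda>\<sigma>. u (simplex_map p f \<sigma>)) c"
  by (simp add: chain_map_def cochain_eval_extend)

text \<open>A cochain is a total function, tied to no space and no degree. The chain groups are free
  on the simplices, so nothing is lost (\<open>cochain_hom_surj\<close>), and restricting to a
  subspace leaves the function as it is: only the range of the quantifiers in the predicates below
  changes.\<close>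

type_synonym 'a cochain = "((nat \<Rightarrow> real) \<Rightarrow> 'a) \<Rightarrow> int"

definition cob :: "nat \<Rightarrow> 'a cochain \<Rightarrow> 'a cochain" where
  "cob p u \<sigma> = cochain_eval u (chain_boundary (Suc p) (frag_of \<sigma>))"

definition cocycle :: "nat \<Rightarrow> 'a topology \<Rightarrow> 'a cochain \<Rightarrow> bool" where
  "cocycle p X u \<longleftrightarrow> (\<forall>\<sigma>. singular_simplex (Suc p) X \<sigma> \<longrightarrow> cob p u \<sigma> = 0)"

text \<open>The primitive \<open>v\<close> is unrestricted, since only its values on faces of
  simplices of \<open>X\<close> enter. There are no cochains in degree -1, so in degree 0 the only
  coboundary is zero.\<close>

definition cobounds :: "nat \<Rightarrow> 'a topology \<Rightarrow> 'a cochain \<Rightarrow> bool" where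
  "cobounds p X u \<longleftrightarrow> (case p of 0 \<Rightarrow> (\<forall>\<sigma>. singular_simplex 0 X \<sigma> \<longrightarrow> u \<sigma> = 0)
     | Suc q \<Rightarrow> (\<exists>v. \<forall>\<sigma>. singular_simplex p X \<sigma> \<longrightarrow> u \<sigma> = cob q v \<sigma>))"

lemma cobounds_0: "cobounds 0 X u \<longleftrightarrow> (\<forall>\<sigma>. singular_simplex 0 X \<sigma> \<longrightarrow> u \<sigma> = 0)"
  by (simp add: cobounds_def)

lemma cobounds_Suc: "cobounds (Suc q) X u \<longleftrightarrow> (\<exists>v. \<forall>\<sigma>. singular_simplex (Suc q) X \<sigma> \<longrightarrow> u \<sigma> = cob q v \<sigma>)"
  by (simp add: cobounds_def)

lemma chain_boundary_extend:
  "chain_boundary p c = frag_extend (\<lambda>\<sigma>. chain_boundary p (frag_of \<sigma>)) c"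
  by (simp add: chain_boundary_def frag_extend_eq_0)

lemma cochain_eval_cob: "cochain_eval (cob p u) c = cochain_eval u (chain_boundary (Suc p) c)"
  unfolding cob_def using chain_boundary_extend [of "Suc p" c] cochain_eval_extend [of u] by metis

lemma singular_chain_boundary_of:
  "singular_simplex (Suc p) X \<sigma> \<Longrightarrow> singular_chain p X (chain_boundary (Suc p) (frag_of \<sigma>))"
  by (simp add: singular_chain_boundary_alt singular_chain_of)

text \<open>Faces of a simplex of \<open>X\<close> stay in \<open>X\<close>. A cochain glued from
  pieces therefore has, over each piece, the coboundary of that piece.\<close>

lemma cob_cong:
  assumes "singular_simplex (Suc p) X \<sigma>" "\<And>\<tau>. singular_simplex p X \<tau> \<Longrightarrow> u \<tau> = v \<tau>"
  shows "cob p u \<sigma> = cob p v \<sigma>"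
  unfolding cob_def using singular_chain_boundary_of [OF assms(1)] assms(2)
  by (rule cochain_eval_cong)

lemma cob_add: "cob p (\<lambda>\<tau>. u \<tau> + v \<tau>) \<sigma> = cob p u \<sigma> + cob p v \<sigma>"
  by (simp add: cob_def cochain_eval_plus_left)

lemma cob_diff: "cob p (\<lambda>\<tau>. u \<tau> - v \<tau>) \<sigma> = cob p u \<sigma> - cob p v \<sigma>"
  by (simp add: cob_def cochain_eval_diff_left)

lemma cob_minus: "cob p (\<lambda>\<tau>. - u \<tau>) \<sigma> = - cob p u \<sigma>"
  by (simp add: cob_def cochain_eval_minus_left)

lemma cob_zero [simp]: "cob p (\<lambda>\<tau>. 0) \<sigma> = 0"
  by (simp add: cob_def)

lemma cob_cob: "singular_simplex (Suc (Suc p)) X \<sigma> \<Longrightarrow> cob (Suc p) (cob p u) \<sigma> = 0"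
  unfolding cob_def [of "Suc p"] cochain_eval_cob
  using chain_boundary_boundary_alt [of "Suc p" X "frag_of \<sigma>"] by (simp add: singular_chain_of)

lemma cob_simplex_map:
  assumes "singular_simplex (Suc p) X \<sigma>"
  shows "cob p (\<lambda>\<tau>. u (simplex_map p f \<tau>)) \<sigma> = cob p u (simplex_map (Suc p) f \<sigma>)"
proof -
  have "singular_chain (Suc p) X (frag_of \<sigma>)"
    using assms by (simp add: singular_chain_of)
  from chain_boundary_chain_map [OF this, of f] show ?thesis
    by (simp add: cob_def cochain_eval_chain_map)
qed

lemma cocycle_cong:
  assumes "\<And>\<tau>. singular_simplex p X \<tau> \<Longrightarrow> u \<tau> = v \<tau>"
  shows "cocycle p X u \<longleftrightarrow> cocycle p X v"
  unfolding cocycle_def using cob_cong [of p X _ u v] assms by simp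

lemma cobounds_cong:
  assumes "\<And>\<tau>. singular_simplex p X \<tau> \<Longrightarrow> u \<tau> = v \<tau>"
  shows "cobounds p X u \<longleftrightarrow> cobounds p X v"
  using assms by (cases p) (simp_all add: cobounds_0 cobounds_Suc)

lemma cocycle_eqI: "cocycle p X v \<Longrightarrow> (\<And>\<tau>. singular_simplex p X \<tau> \<Longrightarrow> u \<tau> = v \<tau>) \<Longrightarrow> cocycle p X u"
  using cocycle_cong [of p X u v] by blast

lemma cobounds_eqI: "cobounds p X v \<Longrightarrow> (\<And>\<tau>. singular_simplex p X \<tau> \<Longrightarrow> u \<tau> = v \<tau>) \<Longrightarrow> cobounds p X u"
  using cobounds_cong [of p X u v] by blast

lemma cocycle_zero [simp]: "cocycle p X (\<lambda>\<tau>. 0)"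
  by (simp add: cocycle_def)

lemma cocycle_add: "cocycle p X u \<Longrightarrow> cocycle p X v \<Longrightarrow> cocycle p X (\<lambda>\<tau>. u \<tau> + v \<tau>)"
  by (simp add: cocycle_def cob_add)

lemma cocycle_diff: "cocycle p X u \<Longrightarrow> cocycle p X v \<Longrightarrow> cocycle p X (\<lambda>\<tau>. u \<tau> - v \<tau>)"
  by (simp add: cocycle_def cob_diff)

lemma cocycle_minus: "cocycle p X u \<Longrightarrow> cocycle p X (\<lambda>\<tau>. - u \<tau>)"
  by (simp add: cocycle_def cob_minus)

lemma cobounds_zero [simp]: "cobounds p X (\<lambda>\<tau>. 0)"
proof (cases p)
  case (Suc q)
  show ?thesis
    unfolding Suc cobounds_Suc by (rule exI [of _ "\<lambda>_. 0"]) simp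
qed (simp add: cobounds_0)

lemma cobounds_add:
  assumes "cobounds p X u" "cobounds p X v"
  shows "cobounds p X (\<lambda>\<tau>. u \<tau> + v \<tau>)"
proof (cases p)
  case (Suc q)
  then obtain a b where "\<And>\<sigma>. singular_simplex p X \<sigma> \<Longrightarrow> u \<sigma> = cob q a \<sigma>"
      "\<And>\<sigma>. singular_simplex p X \<sigma> \<Longrightarrow> v \<sigma> = cob q b \<sigma>"
    using assms by (auto simp: cobounds_Suc)
  then show ?thesis
    by (auto simp: Suc cobounds_Suc cob_add intro!: exI [of _ "\<lambda>\<tau>. a \<tau> + b \<tau>"])
qed (use assms in \<open>auto simp: cobounds_0\<close>)

lemma cobounds_minus:
  assumes "cobounds p X u"
  shows "cobounds p X (\<lambda>\<tau>. - u \<tau>)"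
proof (cases p)
  case (Suc q)
  then obtain a where "\<And>\<sigma>. singular_simplex p X \<sigma> \<Longrightarrow> u \<sigma> = cob q a \<sigma>"
    using assms by (auto simp: cobounds_Suc)
  then show ?thesis
    by (auto simp: Suc cobounds_Suc cob_minus intro!: exI [of _ "\<lambda>\<tau>. - a \<tau>"])
qed (use assms in \<open>auto simp: cobounds_0\<close>)

lemma cobounds_commute: "cobounds p X (\<lambda>\<tau>. u \<tau> - v \<tau>) \<longleftrightarrow> cobounds p X (\<lambda>\<tau>. v \<tau> - u \<tau>)"
  using cobounds_minus [of p X "\<lambda>\<tau>. u \<tau> - v \<tau>"] cobounds_minus [of p X "\<lambda>\<tau>. v \<tau> - u \<tau>"] by auto

lemma cocycle_pullback:
  assumes f: "continuous_map X Y f" and u: "cocycle p Y u"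
  shows "cocycle p X (\<lambda>\<tau>. u (simplex_map p f \<tau>))"
  using u unfolding cocycle_def
  by (simp add: cob_simplex_map singular_simplex_simplex_map [OF _ f])

lemma cobounds_pullback:
  assumes f: "continuous_map X Y f" and u: "cobounds p Y u"
  shows "cobounds p X (\<lambda>\<tau>. u (simplex_map p f \<tau>))"
proof (cases p)
  case 0
  then show ?thesis
    using u by (auto simp: cobounds_0 singular_simplex_simplex_map [OF _ f])
next
  case (Suc q)
  then obtain v where v: "\<And>\<sigma>. singular_simplex p Y \<sigma> \<Longrightarrow> u \<sigma> = cob q v \<sigma>"
    using u by (auto simp: cobounds_Suc)
  show ?thesis
    unfolding Suc cobounds_Suc
  proof (intro exI allI impI)
    fix \<sigma> assume "singular_simplex (Suc q) X \<sigma>"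
    then show "u (simplex_map (Suc q) f \<sigma>) = cob q (\<lambda>\<tau>. v (simplex_map q f \<tau>)) \<sigma>"
      using v [of "simplex_map p f \<sigma>"] singular_simplex_simplex_map [OF _ f, of p]
      by (simp add: cob_simplex_map Suc)
  qed
qed

lemma cocycle_subset: "cocycle p (subtopology X T) u \<Longrightarrow> S \<subseteq> T \<Longrightarrow> cocycle p (subtopology X S) u"
  unfolding cocycle_def using singular_simplex_mono by blast

lemma cocycle_subtopology: "cocycle p X u \<Longrightarrow> cocycle p (subtopology X S) u"
  unfolding cocycle_def by (auto simp: singular_simplex_subtopology)

lemma cobounds_subset: "cobounds p (subtopology X T) u \<Longrightarrow> S \<subseteq> T \<Longrightarrow> cobounds p (subtopology X S) u"
  by (cases p) (auto simp: cobounds_0 cobounds_Suc dest: singular_simplex_mono)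

section \<open>Homotopy invariance\<close>

lemma chain_map_o: "chain_map p (g \<circ> f) c = chain_map p g (chain_map p f c)"
  by (simp add: chain_map_compose)

lemma contractible_space_standard_simplex:
  "contractible_space (subtopology (powertop_real UNIV) (standard_simplex p))"
proof -
  let ?D = "subtopology (powertop_real UNIV) (standard_simplex p)"
  \<comment> \<open>\<open>e\<close> is vertex 0 of the simplex; by convexity the straight-line
    contraction \<open>h\<close> to it stays inside.\<close>
  define e :: "nat \<Rightarrow> real" where "e = (\<lambda>j. if j = 0 then 1 else 0)"
  define h where "h = (\<lambda>(t::real, x::nat \<Rightarrow> real) i. (1 - t) * x i + t * e i)"
  have e: "e \<in> standard_simplex p"
    by (simp add: e_def)
  let ?ID = "prod_topology (top_of_set {0..1::real}) ?D"
  have comp: "continuous_map ?D euclideanreal (\<lambda>x. x i)" for i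
    by (intro continuous_map_from_subtopology continuous_map_product_projection) simp
  have snd: "continuous_map ?ID euclideanreal (\<lambda>z. snd z i)" for i
    using continuous_map_compose [OF continuous_map_snd comp] by (simp add: o_def)
  have fst: "continuous_map ?ID euclideanreal fst"
    using continuous_map_fst by (rule continuous_map_into_fulltopology)
  have "continuous_map ?ID (powertop_real UNIV) h"
    unfolding continuous_map_componentwise_UNIV h_def case_prod_unfold
    by (intro allI continuous_map_add continuous_map_real_mult continuous_map_diff snd fst)
       simp_all
  moreover have "h (t, x) \<in> standard_simplex p" if "t \<in> {0..1}" "x \<in> standard_simplex p" for t x
    using convex_standard_simplex [OF that(2) e, of t] that(1) by (simp add: h_def)
  ultimately have "continuous_map (prod_topology (top_of_set {0..1}) ?D) ?D h"
    by (auto simp: continuous_map_in_subtopology)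
  then have "homotopic_with (\<lambda>_. True) ?D ?D id (\<lambda>_. e)"
    unfolding homotopic_with_def by (intro exI [of _ h]) (auto simp: h_def)
  then show ?thesis
    unfolding contractible_space_def by blast
qed

text \<open>The cycle is homologous to its image under a constant map. That image lies in a
  one-point space, where cycles of positive degree bound.\<close>

lemma cycle_contractible_space_bounds:
  assumes X: "contractible_space X" and p: "1 \<le> p"
    and c: "singular_chain p X c" "chain_boundary p c = 0"
  obtains d where "singular_chain (Suc p) X d" "chain_boundary (Suc p) d = c"
proof -
  obtain a where a: "homotopic_with (\<lambda>_. True) X X id (\<lambda>_. a)"
    using X by (auto simp: contractible_space_def)
  have cyc: "singular_relcycle p X {} c"
    using c by (simp add: singular_cycle)
  have "homologous_rel p X {} (chain_map p id c) (chain_map p (\<lambda>_. a) c)"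
    using a by (intro homotopic_imp_homologous_rel_chain_maps [OF _ cyc]) simp
  moreover have "chain_map p id c = c"
    using c(1) by (rule chain_map_ident)
  moreover have "singular_relboundary p X {} (chain_map p (\<lambda>_. a) c)"
  \<comment> \<open>The value \<open>a\<close> has to be a point of \<open>X\<close> only if
    \<open>X\<close> is nonempty; the empty space carries no chain but 0.\<close>
  proof (cases "topspace X = {}")
    case True
    then have "c = 0"
      using c singular_chain_empty by metis
    then show ?thesis by simp
  next
    case False
    have cont: "continuous_map X X (\<lambda>_. a)"
      using homotopic_with_imp_continuous_maps [OF a] by blast
    then have "a \<in> topspace X"
      using False by (auto simp: continuous_map_def)
    then have top: "topspace (subtopology X {a}) = {a}"
      by auto
    have "continuous_map X (subtopology X {a}) (\<lambda>_. a)"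
      using cont by (simp add: continuous_map_in_subtopology del: continuous_map_const)
    then have "singular_relcycle p (subtopology X {a}) {} (chain_map p (\<lambda>_. a) c)"
      by (rule singular_relcycle_chain_map [OF cyc]) simp
    then have "singular_relboundary p (subtopology X {a}) {} (chain_map p (\<lambda>_. a) c)"
      using singular_boundary_eq_cycle_singleton [OF top p] by simp
    then show ?thesis
      using singular_boundary_mono [of "{a}" UNIV p X] by simp
  qed
  ultimately have "singular_relboundary p X {} c"
    using homologous_rel_def singular_relboundary_add
    by (metis diff_add_cancel)
  then show thesis
    using that by (auto simp: singular_boundary)
qed

section \<open>The prism operator, by acyclic models\<close>

definition fundamental_simplex :: "nat \<Rightarrow> (nat \<Rightarrow> real) \<Rightarrow> nat \<Rightarrow> real" where
  "fundamental_simplex p = restrict id (standard_simplex p)"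

lemma singular_simplex_fundamental:
  "singular_simplex p (subtopology (powertop_real UNIV) (standard_simplex p)) (fundamental_simplex p)"
  unfolding singular_simplex_def fundamental_simplex_def
  by (auto intro: continuous_map_eq [where f = id] simp: continuous_map_in_subtopology)

text \<open>Universality of the identity simplex: a natural operation on chains is determined by its
  value there, so \<open>prism\<close> needs a single model in each degree.\<close>

lemma simplex_map_fundamental:
  "singular_simplex p X \<sigma> \<Longrightarrow> simplex_map p \<sigma> (fundamental_simplex p) = \<sigma>"
  using singular_simplex_chain_map_id [of p X \<sigma>]
  by (simp add: fundamental_simplex_def frag_of_eq)

text \<open>The natural extension of a model \<open>m\<close> to all chains. The model is an
  argument because the recursion for \<open>prism_model\<close> already needs the operator of the
  previous degree.\<close>

definition prism_step ::
    "((real \<times> (nat \<Rightarrow> real)) chain) \<Rightarrow> nat \<Rightarrow> 'a chain \<Rightarrow> (real \<times> 'a) chain" where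
  "prism_step m p = frag_extend (\<lambda>\<sigma>. chain_map (Suc p) (map_prod id \<sigma>) m)"

text \<open>A triangulation of \<open>[0,1] \<times> \<Delta>\<^sup>p\<close> compatible with faces. It is chosen degree by degree, since
  \<open>[0,1] \<times> \<Delta>\<^sup>p\<close> is acyclic.\<close>

primrec prism_model :: "nat \<Rightarrow> (real \<times> (nat \<Rightarrow> real)) chain" where
  "prism_model 0 = (SOME c.
     singular_chain (Suc 0)
       (prod_topology (top_of_set {0..1}) (subtopology (powertop_real UNIV) (standard_simplex 0))) c \<and>
     chain_boundary (Suc 0) c =
       chain_map 0 (Pair 1) (frag_of (fundamental_simplex 0))
       - chain_map 0 (Pair 0) (frag_of (fundamental_simplex 0)))"
| "prism_model (Suc p) = (SOME c.
     singular_chain (Suc (Suc p))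
       (prod_topology (top_of_set {0..1}) (subtopology (powertop_real UNIV) (standard_simplex (Suc p)))) c \<and>
     chain_boundary (Suc (Suc p)) c =
       chain_map (Suc p) (Pair 1) (frag_of (fundamental_simplex (Suc p)))
       - chain_map (Suc p) (Pair 0) (frag_of (fundamental_simplex (Suc p)))
       - prism_step (prism_model p) p (chain_boundary (Suc p) (frag_of (fundamental_simplex (Suc p)))))"

definition prism :: "nat \<Rightarrow> 'a chain \<Rightarrow> (real \<times> 'a) chain" where
  "prism p = prism_step (prism_model p) p"

lemma prism_of: "prism p (frag_of \<sigma>) = chain_map (Suc p) (map_prod id \<sigma>) (prism_model p)"
  by (simp add: prism_def prism_step_def)

lemma prism_0 [simp]: "prism p 0 = 0"
  by (simp add: prism_def prism_step_def)

lemma prism_diff: "prism p (a - b) = prism p a - prism p b"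
  by (simp add: prism_def prism_step_def frag_extend_diff)

text \<open>\<open>prism_model\<close> is a mere choice, and that a suitable chain exists in one
  degree depends on this property in the lower ones. The equation is the chain homotopy formula at
  the universal simplex; its face term is missing in degree 0, where boundaries vanish.\<close>

definition prism_correct :: "nat \<Rightarrow> bool" where
  "prism_correct p \<longleftrightarrow>
     singular_chain (Suc p)
       (prod_topology (top_of_set {0..1}) (subtopology (powertop_real UNIV) (standard_simplex p)))
       (prism_model p) \<and>
     chain_boundary (Suc p) (prism_model p) =
       chain_map p (Pair 1) (frag_of (fundamental_simplex p))
       - chain_map p (Pair 0) (frag_of (fundamental_simplex p))
       - (case p of 0 \<Rightarrow> 0 | Suc q \<Rightarrow> prism q (chain_boundary p (frag_of (fundamental_simplex p))))"

lemma continuous_map_map_prod_simplex: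
  assumes "singular_simplex p X \<sigma>"
  shows "continuous_map
    (prod_topology (top_of_set {0..1::real}) (subtopology (powertop_real UNIV) (standard_simplex p)))
    (prod_topology (top_of_set {0..1}) X) (map_prod id \<sigma>)"
  using assms unfolding singular_simplex_def map_prod_def
  by (auto simp: continuous_map_prod_top)

lemma continuous_map_Pair_unit:
  "t \<in> {0..1::real} \<Longrightarrow> continuous_map X (prod_topology (top_of_set {0..1}) X) (Pair t)"
  by (auto simp: continuous_map_pairwise o_def)

lemma singular_chain_prism:
  assumes P: "prism_correct p" and c: "singular_chain p X c"
  shows "singular_chain (Suc p) (prod_topology (top_of_set {0..1}) X) (prism p c)"
  unfolding prism_def prism_step_def
proof (rule singular_chain_extend)
  fix \<sigma> assume "\<sigma> \<in> Poly_Mapping.keys c"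
  then have "singular_simplex p X \<sigma>"
    using c by (auto simp: singular_chain_def)
  then show "singular_chain (Suc p) (prod_topology (top_of_set {0..1}) X)
      (chain_map (Suc p) (map_prod id \<sigma>) (prism_model p))"
    using P unfolding prism_correct_def
    by (blast intro: singular_chain_chain_map continuous_map_map_prod_simplex)
qed

text \<open>Naturality is built in: both sides are images of the same model under composite
  maps.\<close>

lemma chain_map_prism:
  assumes P: "prism_correct p" and c: "singular_chain p X c"
  shows "chain_map (Suc p) (map_prod id f) (prism p c) = prism p (chain_map p f c)"
  using c unfolding singular_chain_def
proof (induction c rule: frag_induction)
  case (one \<sigma>)
  have "chain_map (Suc p) (map_prod id f) (prism p (frag_of \<sigma>)) =
      chain_map (Suc p) (map_prod id f \<circ> map_prod id \<sigma>) (prism_model p)"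
    by (simp add: prism_of chain_map_compose)
  \<comment> \<open>\<open>simplex_map p f \<sigma>\<close> is the composite cut down to the
    standard simplex, so the two maps agree only over that simplex. This suffices, as the model is a
    chain there.\<close>
  also have "\<dots> = chain_map (Suc p) (map_prod id (simplex_map p f \<sigma>)) (prism_model p)"
    using P unfolding prism_correct_def
    by (elim conjE, intro chain_map_eq) (auto simp: simplex_map_def)
  finally show ?case
    by (simp only: prism_of chain_map_of)
qed (auto simp: prism_diff chain_map_diff)

text \<open>The formula holds for the universal simplex by \<open>prism_correct\<close>; pushing it
  forward along \<sigma> and using naturality one degree lower gives it for every \<sigma>.\<close>

lemma chain_boundary_prism:
  assumes P: "prism_correct p" and Q: "\<And>q. p = Suc q \<Longrightarrow> prism_correct q"
    and c: "singular_chain p X c"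
  shows "chain_boundary (Suc p) (prism p c) =
    chain_map p (Pair 1) c - chain_map p (Pair 0) c
    - (case p of 0 \<Rightarrow> 0 | Suc q \<Rightarrow> prism q (chain_boundary p c))"
  using c unfolding singular_chain_def
proof (induction c rule: frag_induction)
  case (one \<sigma>)
  let ?\<iota> = "frag_of (fundamental_simplex p)"
  have \<sigma>: "singular_simplex p X \<sigma>"
    using one by simp
  have \<iota>: "singular_chain p (subtopology (powertop_real UNIV) (standard_simplex p)) ?\<iota>"
    by (simp add: singular_chain_of singular_simplex_fundamental)
  have \<sigma>\<iota>: "chain_map p \<sigma> ?\<iota> = frag_of \<sigma>"
    by (simp add: simplex_map_fundamental [OF \<sigma>])
  have PairM: "chain_map p (map_prod id \<sigma>) (chain_map p (Pair t) ?\<iota>) = chain_map p (Pair t) (frag_of \<sigma>)" for t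
  proof -
    have "chain_map p (map_prod id \<sigma>) (chain_map p (Pair t) ?\<iota>) = chain_map p (map_prod id \<sigma> \<circ> Pair t) ?\<iota>"
      by (rule chain_map_o [symmetric])
    also have "map_prod id \<sigma> \<circ> Pair t = Pair t \<circ> \<sigma>"
      by auto
    finally show ?thesis
      by (simp only: chain_map_o \<sigma>\<iota>)
  qed
  have m: "singular_chain (Suc p)
       (prod_topology (top_of_set {0..1}) (subtopology (powertop_real UNIV) (standard_simplex p)))
       (prism_model p)"
    using P by (simp add: prism_correct_def)
  have "chain_boundary (Suc p) (prism p (frag_of \<sigma>)) =
      chain_map p (map_prod id \<sigma>) (chain_boundary (Suc p) (prism_model p))"
    using chain_boundary_chain_map [OF m, of "map_prod id \<sigma>"] by (simp add: prism_of)
  also have "\<dots> = chain_map p (Pair 1) (frag_of \<sigma>) - chain_map p (Pair 0) (frag_of \<sigma>)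
    - chain_map p (map_prod id \<sigma>) (case p of 0 \<Rightarrow> 0 | Suc q \<Rightarrow> prism q (chain_boundary p ?\<iota>))"
    using P unfolding prism_correct_def by (simp add: chain_map_diff PairM del: chain_map_of)
  also have "chain_map p (map_prod id \<sigma>) (case p of 0 \<Rightarrow> 0 | Suc q \<Rightarrow> prism q (chain_boundary p ?\<iota>)) =
      (case p of 0 \<Rightarrow> 0 | Suc q \<Rightarrow> prism q (chain_boundary p (frag_of \<sigma>)))"
  proof (cases p)
    case (Suc q)
    have "singular_chain q (subtopology (powertop_real UNIV) (standard_simplex p)) (chain_boundary p ?\<iota>)"
      using singular_chain_boundary [OF \<iota>] Suc by simp
    from chain_map_prism [OF Q [OF Suc] this, of \<sigma>]
    show ?thesis
      using chain_boundary_chain_map [OF \<iota>, of \<sigma>] \<sigma>\<iota> by (simp add: Suc)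
  qed simp
  finally show ?case .
next
  case (diff a b)
  then show ?case
    by (cases p) (simp_all add: prism_diff chain_map_diff chain_boundary_diff)
qed (simp split: nat.split)

text \<open>The prescribed boundary is a cycle by the formula in lower degrees, and it bounds
  because the product of the interval and the simplex is contractible. So the choice in
  \<open>prism_model\<close> succeeds.\<close>

lemma prism_correct: "prism_correct p"
proof (induction p rule: less_induct)
  case (less p)
  let ?D = "subtopology (powertop_real UNIV) (standard_simplex p)"
  let ?ID = "prod_topology (top_of_set {0..1::real}) ?D"
  let ?\<iota> = "frag_of (fundamental_simplex p)"
  have \<iota>: "singular_chain p ?D ?\<iota>"
    by (simp add: singular_chain_of singular_simplex_fundamental)
  have cont: "continuous_map ?D ?ID (Pair 1)" "continuous_map ?D ?ID (Pair 0)"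
    by (auto intro: continuous_map_Pair_unit)
  show ?case
  proof (cases p)
    \<comment> \<open>A 0-cycle need not bound even in a contractible space. Here the required chain
      comes from the homotopy that runs from the end at 1 to the end at 0.\<close>
    case 0
    have "homotopic_with (\<lambda>_. True) ?D ?ID (Pair 1) (Pair (0::real))"
      unfolding homotopic_with_def
    proof (intro exI conjI allI)
      show "continuous_map (prod_topology (top_of_set {0..1}) ?D) ?ID (\<lambda>(t, x). (1 - t, x))"
        by (auto simp: continuous_map_prod_top continuous_map_in_subtopology intro!: continuous_intros)
    qed auto
    moreover have "singular_relcycle p ?D {} ?\<iota>"
      using \<iota> by (simp add: singular_cycle 0 chain_boundary_of)
    ultimately have "homologous_rel p ?ID {} (chain_map p (Pair 1) ?\<iota>) (chain_map p (Pair 0) ?\<iota>)"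
      by (intro homotopic_imp_homologous_rel_chain_maps) auto
    then have ex: "\<exists>c. singular_chain (Suc p) ?ID c \<and>
        chain_boundary (Suc p) c = chain_map p (Pair 1) ?\<iota> - chain_map p (Pair 0) ?\<iota>"
      by (simp add: homologous_rel_def singular_boundary)
    show ?thesis
      using someI_ex [OF ex] by (simp add: prism_correct_def 0)
  next
    case (Suc q)
    have Pq: "prism_correct q" "\<And>r. q = Suc r \<Longrightarrow> prism_correct r"
      using less Suc by auto
    let ?z = "chain_map p (Pair 1) ?\<iota> - chain_map p (Pair 0) ?\<iota> - prism q (chain_boundary p ?\<iota>)"
    have d\<iota>: "singular_chain q ?D (chain_boundary p ?\<iota>)"
      using singular_chain_boundary [OF \<iota>] Suc by simp
    have z: "singular_chain p ?ID ?z"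
      using \<iota> d\<iota> Pq cont singular_chain_prism [OF Pq(1) d\<iota>] Suc
      by (auto intro!: singular_chain_diff intro: singular_chain_chain_map simp del: chain_map_of)
    have dd: "chain_boundary q (chain_boundary p ?\<iota>) = 0"
      using \<iota> chain_boundary_boundary_alt [of q ?D ?\<iota>] Suc by simp
    have "chain_boundary p (prism q (chain_boundary p ?\<iota>)) =
        chain_map q (Pair 1) (chain_boundary p ?\<iota>) - chain_map q (Pair 0) (chain_boundary p ?\<iota>)"
      using chain_boundary_prism [OF Pq d\<iota>] unfolding dd prism_0 by (cases q) (simp_all add: Suc)
    then have "chain_boundary p ?z = 0"
      using chain_boundary_chain_map [OF \<iota>, of "Pair (1::real)"]
        chain_boundary_chain_map [OF \<iota>, of "Pair (0::real)"] Suc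
      by (simp add: chain_boundary_diff del: chain_map_of)
    moreover have "contractible_space ?ID"
    proof -
      have "contractible {0..1::real}"
        by (intro convex_imp_contractible convex_real_interval)
      then show ?thesis
        unfolding contractible_space_prod_topology contractible_space_top_of_set
        using contractible_space_standard_simplex by blast
    qed
    ultimately have ex: "\<exists>c. singular_chain (Suc p) ?ID c \<and> chain_boundary (Suc p) c = ?z"
      using cycle_contractible_space_bounds [OF _ _ z] Suc by (metis le_add1 plus_1_eq_Suc)
    show ?thesis
      using someI_ex [OF ex [unfolded Suc prism_def]]
      unfolding prism_correct_def Suc prism_def by simp
  qed
qed

text \<open>The prism followed by the homotopy \<open>h\<close> is a chain homotopy \<open>P\<close>
  between the two maps. A cocycle vanishes on the boundary of \<open>P \<sigma>\<close>, so the
  homotopy formula leaves only the face term, which is a coboundary.\<close>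

lemma homotopic_cocycles:
  assumes fg: "homotopic_with (\<lambda>_. True) X Y f g" and u: "cocycle p Y u"
  shows "cobounds p X (\<lambda>\<sigma>. u (simplex_map p f \<sigma>) - u (simplex_map p g \<sigma>))"
proof -
  let ?IX = "prod_topology (top_of_set {0..1::real}) X"
  obtain h where h: "continuous_map ?IX Y h" "\<And>x. h (0, x) = f x" "\<And>x. h (1, x) = g x"
    using fg by (auto simp: homotopic_with_def)
  define P where "P = (\<lambda>q c. chain_map (Suc q) h (prism q c))"
  have hP: "h \<circ> Pair 0 = f" "h \<circ> Pair 1 = g"
    using h by auto
  have PY: "singular_chain (Suc q) Y (P q c)" if "singular_chain q X c" for q c
    unfolding P_def using singular_chain_prism [OF prism_correct that] h(1)
    by (rule singular_chain_chain_map)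
  have ev: "cochain_eval u (chain_boundary (Suc p) (P p (frag_of \<sigma>))) = 0"
    if "singular_simplex p X \<sigma>" for \<sigma>
  proof -
    have "cochain_eval (cob p u) (P p (frag_of \<sigma>)) = cochain_eval (\<lambda>_. 0) (P p (frag_of \<sigma>))"
      using u PY [of p "frag_of \<sigma>"] that
      by (intro cochain_eval_cong [of "Suc p" Y]) (auto simp: cocycle_def singular_chain_of)
    then show ?thesis
      by (simp add: cochain_eval_cob)
  qed
  have dP: "chain_boundary (Suc p) (P p (frag_of \<sigma>)) =
      frag_of (simplex_map p g \<sigma>) - frag_of (simplex_map p f \<sigma>)
      - (case p of 0 \<Rightarrow> 0 | Suc q \<Rightarrow> P q (chain_boundary p (frag_of \<sigma>)))"
    if \<sigma>: "singular_simplex p X \<sigma>" for \<sigma>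
  proof -
    have c: "singular_chain p X (frag_of \<sigma>)"
      using \<sigma> by (simp add: singular_chain_of)
    have hp: "chain_map p h (chain_map p (Pair t) (frag_of \<sigma>)) = chain_map p (h \<circ> Pair t) (frag_of \<sigma>)" for t
      by (rule chain_map_o [symmetric])
    have "chain_boundary (Suc p) (P p (frag_of \<sigma>)) =
        chain_map p h (chain_boundary (Suc p) (prism p (frag_of \<sigma>)))"
      unfolding P_def
      using chain_boundary_chain_map [OF singular_chain_prism [OF prism_correct c]] by simp
    also have "\<dots> = chain_map p h (chain_map p (Pair 1) (frag_of \<sigma>))
        - chain_map p h (chain_map p (Pair 0) (frag_of \<sigma>))
        - chain_map p h (case p of 0 \<Rightarrow> 0 | Suc q \<Rightarrow> prism q (chain_boundary p (frag_of \<sigma>)))"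
      unfolding chain_boundary_prism [OF prism_correct prism_correct c] by (simp only: chain_map_diff)
    finally show ?thesis
      unfolding hp hP by (cases p) (simp_all add: P_def)
  qed
  show ?thesis
  proof (cases p)
    case 0
    show ?thesis
      using ev dP unfolding 0 cobounds_0 by (simp add: cochain_eval_diff)
  next
    case (Suc q)
    \<comment> \<open>The minus sign is due to the direction of the prism: its boundary is the end
      \<open>g\<close> minus the end \<open>f\<close>, minus the face term.\<close>
    define v where "v = (\<lambda>\<tau>. - cochain_eval u (P q (frag_of \<tau>)))"
    have Pext: "P q c = frag_extend (\<lambda>\<tau>. P q (frag_of \<tau>)) c" for c
    proof (induction c rule: frag_induction [OF subset_UNIV])
      case (3 a b)
      then show ?case
        by (simp add: P_def prism_diff chain_map_diff frag_extend_diff)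
    qed (simp_all add: P_def)
    have "u (simplex_map p f \<sigma>) - u (simplex_map p g \<sigma>) = cob q v \<sigma>" if "singular_simplex p X \<sigma>" for \<sigma>
    proof -
      have "cob q v \<sigma> = - cochain_eval u (P q (chain_boundary p (frag_of \<sigma>)))"
        unfolding cob_def v_def
        by (subst Pext) (simp add: Suc cochain_eval_minus_left cochain_eval_extend)
      then show ?thesis
        using ev [OF that] unfolding dP [OF that] by (simp add: cochain_eval_diff Suc)
    qed
    then show ?thesis
      unfolding Suc cobounds_Suc by blast
  qed
qed

section \<open>Small simplices\<close>

locale open_cover =
  fixes X :: "'a topology" and \<C> :: "'a set set"
  assumes openin_cover: "\<And>V. V \<in> \<C> \<Longrightarrow> openin X V"
    and covers: "topspace X \<subseteq> \<Union>\<C>"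
begin

definition small_simplex :: "nat \<Rightarrow> ((nat \<Rightarrow> real) \<Rightarrow> 'a) \<Rightarrow> bool" where
  "small_simplex p \<sigma> \<longleftrightarrow> (\<exists>V\<in>\<C>. singular_simplex p (subtopology X V) \<sigma>)"

definition small_chain :: "nat \<Rightarrow> 'a chain \<Rightarrow> bool" where
  "small_chain p c \<longleftrightarrow> Poly_Mapping.keys c \<subseteq> Collect (small_simplex p)"

lemma small_chain_0 [simp]: "small_chain p 0"
  by (simp add: small_chain_def)

lemma small_chain_of [simp]: "small_chain p (frag_of \<sigma>) \<longleftrightarrow> small_simplex p \<sigma>"
  by (simp add: small_chain_def)

lemma small_chain_diff: "small_chain p a \<Longrightarrow> small_chain p b \<Longrightarrow> small_chain p (a - b)"
  unfolding small_chain_def using keys_diff [of a b] by blast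

lemma small_chain_singular:
  assumes "V \<in> \<C>" "singular_chain p (subtopology X V) c"
  shows "small_chain p c"
  using assms unfolding small_chain_def singular_chain_def small_simplex_def by blast

lemma small_chain_boundary:
  assumes "small_chain (Suc p) c"
  shows "small_chain p (chain_boundary (Suc p) c)"
  using assms unfolding small_chain_def [of "Suc p"]
proof (induction c rule: frag_induction)
  case (one \<sigma>)
  then obtain V where "V \<in> \<C>" "singular_simplex (Suc p) (subtopology X V) \<sigma>"
    by (auto simp: small_simplex_def)
  then show ?case
    using small_chain_singular singular_chain_boundary_of by blast
qed (auto simp: chain_boundary_diff small_chain_diff)

lemma cochain_eval_small_cong:
  assumes "small_chain p c" "\<And>\<sigma>. small_simplex p \<sigma> \<Longrightarrow> u \<sigma> = v \<sigma>"
  shows "cochain_eval u c = cochain_eval v c"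
  using assms unfolding cochain_eval_def small_chain_def by (intro sum.cong) auto

text \<open>The image of a 0-simplex is a single point, which some member of the cover contains. For
  this reason \<open>shrink\<close> may be 0 in degree 0.\<close>

lemma small_simplex_0:
  assumes "singular_simplex 0 X \<sigma>"
  shows "small_simplex 0 \<sigma>"
proof -
  obtain x where x: "standard_simplex 0 = {x}"
    by (simp add: standard_simplex_0)
  then have "\<sigma> x \<in> topspace X"
    using assms by (auto simp: singular_simplex_def continuous_map_def)
  then obtain V where "V \<in> \<C>" "\<sigma> x \<in> V"
    using covers by blast
  then show ?thesis
    unfolding small_simplex_def singular_simplex_subtopology using assms x by auto
qed

text \<open>Enough subdivisions make \<open>z\<close> small, and \<open>h\<close> is a chain
  homotopy from the identity to that iterate. The homotopy formula contains \<open>h\<close> of the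
  boundary of \<open>z\<close> as well; the hypothesis that this boundary is small keeps that term
  small.\<close>

lemma subdivide_to_small:
  assumes z: "singular_chain p X z"
    and dz: "p \<noteq> 0 \<Longrightarrow> small_chain (p - Suc 0) (chain_boundary p z)"
  obtains c where "singular_chain (Suc p) X c" "small_chain p (z - chain_boundary (Suc p) c)"
proof -
  obtain n where n: "\<And>m f. \<lbrakk>n \<le> m; f \<in> Poly_Mapping.keys ((singular_subdivision p ^^ m) z)\<rbrakk>
      \<Longrightarrow> \<exists>V \<in> \<C>. f \<in> standard_simplex p \<rightarrow> V"
    using sufficient_iterated_singular_subdivision_exists [OF openin_cover covers z] by metis
  obtain h where h0: "\<And>p. h p 0 = (0 :: 'a chain)"
    and hdiff: "\<And>p c1 c2. h p (c1 - c2) = h p c1 - h p c2"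
    and hchain: "\<And>p X c. singular_chain p X c \<Longrightarrow> singular_chain (Suc p) X (h p c)"
    and hbd: "\<And>p X c. singular_chain p X c \<Longrightarrow>
      chain_boundary (Suc p) (h p c) + h (p - Suc 0) (chain_boundary p c)
        = (singular_subdivision p ^^ n) c - c"
    using chain_homotopic_iterated_singular_subdivision [of n] by metis
  \<comment> \<open>\<open>h\<close> sends chains of any space to chains of the same space. Applied
    to the members of the cover as spaces, this shows that it preserves smallness.\<close>
  have hsmall: "small_chain (Suc q) (h q c)" if "small_chain q c" for q c
    using that unfolding small_chain_def [of q]
  proof (induction c rule: frag_induction)
    case (one \<sigma>)
    then obtain V where "V \<in> \<C>" "singular_simplex q (subtopology X V) \<sigma>"
      by (auto simp: small_simplex_def)
    then show ?case
      using small_chain_singular hchain by (metis singular_chain_of)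
  qed (auto simp: h0 hdiff small_chain_diff)
  have "singular_chain p X ((singular_subdivision p ^^ m) z)" for m
    by (induction m) (auto simp: z singular_chain_singular_subdivision)
  then have "small_chain p ((singular_subdivision p ^^ n) z)"
    using n [OF order_refl]
    by (fastforce simp: small_chain_def small_simplex_def singular_simplex_subtopology
        singular_chain_def Pi_iff)
  moreover have "small_chain p (h (p - Suc 0) (chain_boundary p z))"
  proof (cases p)
    case 0
    then show ?thesis
      by (simp add: chain_boundary_def h0)
  next
    case (Suc q)
    then show ?thesis
      using hsmall [OF dz] by simp
  qed
  ultimately have "small_chain p ((singular_subdivision p ^^ n) z - h (p - Suc 0) (chain_boundary p z))"
    by (rule small_chain_diff)
  moreover have "(singular_subdivision p ^^ n) z - h (p - Suc 0) (chain_boundary p z) =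
      z - chain_boundary (Suc p) (- h p z)"
    using hbd [OF z] by (simp add: chain_boundary_minus algebra_simps)
  ultimately show thesis
    using that [of "- h p z"] hchain [OF z] by (simp add: singular_chain_minus)
qed

text \<open>Since the chain complex of \<open>X\<close> is free, it retracts onto the small chains: \<open>shrink\<close> is a
  homotopy from the identity to \<open>retract\<close>, and \<open>retract\<close> fixes the small chains.\<close>

primrec shrink :: "nat \<Rightarrow> ((nat \<Rightarrow> real) \<Rightarrow> 'a) \<Rightarrow> 'a chain" where
  "shrink 0 = (\<lambda>\<sigma>. 0)"
| "shrink (Suc p) = (\<lambda>\<sigma>. if small_simplex (Suc p) \<sigma> then 0 else
     SOME c. singular_chain (Suc (Suc p)) X c \<and>
       small_chain (Suc p) (frag_of \<sigma>
         - frag_extend (shrink p) (chain_boundary (Suc p) (frag_of \<sigma>))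
         - chain_boundary (Suc (Suc p)) c))"

definition retract :: "nat \<Rightarrow> ((nat \<Rightarrow> real) \<Rightarrow> 'a) \<Rightarrow> 'a chain" where
  "retract p \<sigma> = frag_of \<sigma>
     - (case p of 0 \<Rightarrow> 0 | Suc q \<Rightarrow> frag_extend (shrink q) (chain_boundary p (frag_of \<sigma>)))
     - chain_boundary (Suc p) (shrink p \<sigma>)"

lemma shrink_small: "small_simplex p \<sigma> \<Longrightarrow> shrink p \<sigma> = 0"
  by (cases p) simp_all

lemma frag_extend_shrink_small: "small_chain p c \<Longrightarrow> frag_extend (shrink p) c = 0"
  by (intro frag_extend_eq_0) (auto simp: small_chain_def shrink_small)

lemma retract_small:
  assumes "small_simplex p \<sigma>"
  shows "retract p \<sigma> = frag_of \<sigma>"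
proof (cases p)
  case 0
  then show ?thesis
    by (simp add: retract_def)
next
  case (Suc q)
  have "small_chain q (chain_boundary (Suc q) (frag_of \<sigma>))"
    using assms Suc by (intro small_chain_boundary) simp
  then show ?thesis
    using assms by (simp add: retract_def Suc frag_extend_shrink_small shrink_small del: shrink.simps)
qed

lemma extend_retract:
  "frag_extend (retract p) c = c
     - (case p of 0 \<Rightarrow> 0 | Suc q \<Rightarrow> frag_extend (shrink q) (chain_boundary p c))
     - chain_boundary (Suc p) (frag_extend (shrink p) c)"
proof (induction c rule: frag_induction [OF subset_UNIV])
  case (2 \<sigma>)
  then show ?case
    by (simp add: retract_def)
next
  case (3 a b)
  then show ?case
    by (cases p) (simp_all add: frag_extend_diff chain_boundary_diff del: shrink.simps)
qed (simp split: nat.split)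

lemma small_chain_extend:
  assumes "singular_chain p X c" "\<And>\<sigma>. singular_simplex p X \<sigma> \<Longrightarrow> small_chain q (f \<sigma>)"
  shows "small_chain q (frag_extend f c)"
proof -
  have "Poly_Mapping.keys (frag_extend f c) \<subseteq> (\<Union>\<sigma>\<in>Poly_Mapping.keys c. Poly_Mapping.keys (f \<sigma>))"
    by (rule keys_frag_extend)
  then show ?thesis
    using assms unfolding small_chain_def singular_chain_def by blast
qed

text \<open>By induction, the simplex minus \<open>shrink\<close> of its boundary has boundary
  \<open>retract\<close> of the original boundary, which is small. So
  \<open>subdivide_to_small\<close> applies to it, and the choice in \<open>shrink\<close>
  succeeds.\<close>

lemma shrink_retract:
  assumes "singular_simplex p X \<sigma>"
  shows "singular_chain (Suc p) X (shrink p \<sigma>) \<and> small_chain p (retract p \<sigma>)"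
  using assms
proof (induction p arbitrary: \<sigma>)
  case 0
  then show ?case
    using small_simplex_0 [OF 0] retract_small [of 0 \<sigma>] by simp
next
  case (Suc p)
  show ?case
  proof (cases "small_simplex (Suc p) \<sigma>")
    case True
    then show ?thesis
      by (simp add: retract_small)
  next
    case False
    let ?d = "chain_boundary (Suc p) (frag_of \<sigma>)"
    let ?z = "frag_of \<sigma> - frag_extend (shrink p) ?d"
    have \<sigma>: "singular_chain (Suc p) X (frag_of \<sigma>)"
      using Suc.prems by (simp add: singular_chain_of)
    have d: "singular_chain p X ?d"
      using Suc.prems by (rule singular_chain_boundary_of)
    have dd: "chain_boundary p ?d = 0"
      using \<sigma> by (rule chain_boundary_boundary_alt)
    have "singular_chain (Suc p) X (frag_extend (shrink p) ?d)"
      using d Suc.IH by (intro singular_chain_extend) (auto simp: singular_chain_def)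
    then have z: "singular_chain (Suc p) X ?z"
      using \<sigma> by (intro singular_chain_diff)
    have "small_chain p (frag_extend (retract p) ?d)"
      using d Suc.IH by (intro small_chain_extend) auto
    moreover have "frag_extend (retract p) ?d = chain_boundary (Suc p) ?z"
      unfolding extend_retract dd by (simp add: chain_boundary_diff split: nat.split)
    ultimately have "\<exists>c. singular_chain (Suc (Suc p)) X c \<and>
        small_chain (Suc p) (?z - chain_boundary (Suc (Suc p)) c)"
      using subdivide_to_small [OF z] by (metis diff_Suc_1 One_nat_def)
    from someI_ex [OF this] show ?thesis
      using False by (simp add: retract_def)
  qed
qed

text \<open>\<open>retract\<close> is the identity minus a commutator term of a homotopy with the
  boundary, hence a chain map.\<close>

lemma boundary_retract:
  assumes "singular_simplex (Suc p) X \<sigma>"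
  shows "frag_extend (retract p) (chain_boundary (Suc p) (frag_of \<sigma>)) =
    chain_boundary (Suc p) (retract (Suc p) \<sigma>)"
proof -
  have \<sigma>: "singular_chain (Suc p) X (frag_of \<sigma>)"
    using assms by (simp add: singular_chain_of)
  have "singular_chain (Suc (Suc p)) X (shrink (Suc p) \<sigma>)"
    using shrink_retract [OF assms] by blast
  then have ss: "chain_boundary (Suc p) (chain_boundary (Suc (Suc p)) (shrink (Suc p) \<sigma>)) = 0"
    by (rule chain_boundary_boundary_alt)
  have dd: "chain_boundary p (chain_boundary (Suc p) (frag_of \<sigma>)) = 0"
    using \<sigma> by (rule chain_boundary_boundary_alt)
  show ?thesis
    unfolding extend_retract dd retract_def chain_boundary_diff ss
    by (simp del: shrink.simps split: nat.split)
qed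

text \<open>Composition with \<open>retract\<close> extends \<open>w\<close>: the coboundary of the
  composite is that of \<open>w\<close> on a small chain, so it vanishes, and on small simplices
  \<open>retract\<close> is the identity.\<close>

lemma extend_small_cocycle:
  assumes w: "\<And>V. V \<in> \<C> \<Longrightarrow> cocycle p (subtopology X V) w"
  obtains w' where "cocycle p X w'"
    "\<And>V \<sigma>. V \<in> \<C> \<Longrightarrow> singular_simplex p (subtopology X V) \<sigma> \<Longrightarrow> w' \<sigma> = w \<sigma>"
proof
  define w' where "w' = (\<lambda>\<tau>. cochain_eval w (retract p \<tau>))"
  show "w' \<sigma> = w \<sigma>" if "V \<in> \<C>" "singular_simplex p (subtopology X V) \<sigma>" for V \<sigma>
  proof -
    have "small_simplex p \<sigma>"
      using that by (auto simp: small_simplex_def)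
    then show ?thesis
      by (simp add: w'_def retract_small)
  qed
  show "cocycle p X w'"
    unfolding cocycle_def
  proof (intro allI impI)
    fix \<sigma> assume \<sigma>: "singular_simplex (Suc p) X \<sigma>"
    have "cob p w' \<sigma> = cochain_eval w (frag_extend (retract p) (chain_boundary (Suc p) (frag_of \<sigma>)))"
      by (simp add: cob_def w'_def cochain_eval_extend)
    also have "\<dots> = cochain_eval (cob p w) (retract (Suc p) \<sigma>)"
      by (simp add: boundary_retract [OF \<sigma>] cochain_eval_cob)
    also have "\<dots> = cochain_eval (\<lambda>_. 0) (retract (Suc p) \<sigma>)"
      using shrink_retract [OF \<sigma>] w
      by (intro cochain_eval_small_cong [of "Suc p"]) (auto simp: small_simplex_def cocycle_def)
    finally show "cob p w' \<sigma> = 0"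
      by simp
  qed
qed

text \<open>On the small chain \<open>retract \<sigma>\<close> the cocycle \<open>w\<close> is the
  coboundary of \<open>v\<close>. Since \<open>w\<close> is closed, its values on \<sigma> and on
  \<open>retract \<sigma>\<close> differ only by its value on \<open>shrink\<close> of the boundary,
  which explains the second summand of \<open>v'\<close>.\<close>

lemma cobounds_if_small_coboundary:
  assumes w: "cocycle (Suc q) X w"
    and v: "\<And>V \<sigma>. V \<in> \<C> \<Longrightarrow> singular_simplex (Suc q) (subtopology X V) \<sigma> \<Longrightarrow> w \<sigma> = cob q v \<sigma>"
  shows "cobounds (Suc q) X w"
proof -
  define v' where "v' = (\<lambda>\<tau>. cochain_eval v (retract q \<tau>) + cochain_eval w (shrink q \<tau>))"
  have "w \<sigma> = cob q v' \<sigma>" if \<sigma>: "singular_simplex (Suc q) X \<sigma>" for \<sigma>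
  proof -
    let ?d = "chain_boundary (Suc q) (frag_of \<sigma>)" and ?s = "shrink (Suc q) \<sigma>"
      and ?r = "retract (Suc q) \<sigma>"
    have r: "?r = frag_of \<sigma> - frag_extend (shrink q) ?d - chain_boundary (Suc (Suc q)) ?s"
      by (simp add: retract_def)
    have "cob q v' \<sigma> = cochain_eval v (frag_extend (retract q) ?d)
        + cochain_eval w (frag_extend (shrink q) ?d)"
      by (simp add: cob_def v'_def cochain_eval_plus_left cochain_eval_extend)
    also have "cochain_eval v (frag_extend (retract q) ?d) = cochain_eval (cob q v) ?r"
      by (simp add: boundary_retract [OF \<sigma>] cochain_eval_cob)
    also have "\<dots> = cochain_eval w ?r"
      using shrink_retract [OF \<sigma>] v
      by (intro cochain_eval_small_cong [of "Suc q"]) (auto simp: small_simplex_def)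
    also have "\<dots> = w \<sigma> - cochain_eval w (frag_extend (shrink q) ?d) - cochain_eval (cob (Suc q) w) ?s"
      unfolding r by (simp add: cochain_eval_diff cochain_eval_cob del: shrink.simps)
    also have "cochain_eval (cob (Suc q) w) ?s = cochain_eval (\<lambda>_. 0) ?s"
      using shrink_retract [OF \<sigma>] w
      by (intro cochain_eval_cong [of "Suc (Suc q)" X]) (auto simp: cocycle_def)
    finally show ?thesis
      by simp
  qed
  then show ?thesis
    unfolding cobounds_Suc by blast
qed

lemma cobounds_0_if_small:
  assumes "\<And>V. V \<in> \<C> \<Longrightarrow> cobounds 0 (subtopology X V) w"
  shows "cobounds 0 X w"
  using assms small_simplex_0 unfolding cobounds_0 small_simplex_def by blast

end

section \<open>Two-sided collars\<close>

text \<open>Simplices are nonempty, so each lies in at most one of the disjoint sets; values of a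
  cochain on different simplices are independent of each other.\<close>

lemma patch_cochains:
  assumes "\<And>k l. k \<in> K \<Longrightarrow> l \<in> K \<Longrightarrow> k \<noteq> l \<Longrightarrow> A k \<inter> A l = {}"
  obtains v :: "'a cochain"
  where "\<And>k \<sigma>. k \<in> K \<Longrightarrow> singular_simplex q (subtopology X (A k)) \<sigma> \<Longrightarrow> v \<sigma> = a k \<sigma>"
proof
  fix k and \<sigma> :: "(nat \<Rightarrow> real) \<Rightarrow> 'a"
  assume k: "k \<in> K" and \<sigma>: "singular_simplex q (subtopology X (A k)) \<sigma>"
  then have sub: "\<sigma> ` standard_simplex q \<subseteq> A k"
    by (simp add: singular_simplex_subtopology)
  obtain x where x: "x \<in> standard_simplex q"
    using nonempty_standard_simplex by blast
  have "l = k" if "l \<in> K \<and> \<sigma> ` standard_simplex q \<subseteq> A l" for l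
    using that sub x k assms [of k l] by blast
  with k sub have "(SOME k. k \<in> K \<and> \<sigma> ` standard_simplex q \<subseteq> A k) = k"
    by (intro some_equality conjI)
  then show "(\<lambda>\<sigma>. a (SOME k. k \<in> K \<and> \<sigma> ` standard_simplex q \<subseteq> A k) \<sigma>) \<sigma> = a k \<sigma>"
    by simp
qed

text \<open>\<open>U i\<close> is a collar of a closed set homeomorphic to \<open>N\<close>, and \<open>V i True\<close>, \<open>V i False\<close> are its
  two sides.\<close>

locale two_sided_collars =
  fixes Q :: "'a topology" and M :: "'b topology" and N :: "'c topology" and I :: "'i set"
    and MM :: "'a set" and U :: "'i \<Rightarrow> 'a set" and V :: "'i \<Rightarrow> bool \<Rightarrow> 'a set"
    and j :: "'b \<Rightarrow> 'a" and jv :: "'a \<Rightarrow> 'b"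
    and pr :: "'i \<Rightarrow> 'a \<Rightarrow> 'c" and r :: "'i \<Rightarrow> bool \<Rightarrow> 'c \<Rightarrow> 'b"
  assumes open_MM: "openin Q MM"
    and open_U: "\<And>i. i \<in> I \<Longrightarrow> openin Q (U i)"
    and covers: "topspace Q \<subseteq> MM \<union> (\<Union>i\<in>I. U i)"
    and disjoint_U: "\<And>i k. i \<in> I \<Longrightarrow> k \<in> I \<Longrightarrow> i \<noteq> k \<Longrightarrow> U i \<inter> U k = {}"
    and open_V: "\<And>i b. i \<in> I \<Longrightarrow> openin Q (V i b)"
    and V_union: "\<And>i. i \<in> I \<Longrightarrow> U i \<inter> MM = V i True \<union> V i False"
    and disjoint_V: "\<And>i. i \<in> I \<Longrightarrow> V i True \<inter> V i False = {}"
    and j: "homeomorphic_maps M (subtopology Q MM) j jv"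
    and pr: "\<And>i. i \<in> I \<Longrightarrow> continuous_map (subtopology Q (U i)) N (pr i)"
    and r: "\<And>i b. i \<in> I \<Longrightarrow> continuous_map N M (r i b)"
    and r_V: "\<And>i b x. i \<in> I \<Longrightarrow> x \<in> topspace N \<Longrightarrow> j (r i b x) \<in> V i b"
    and pr_r: "\<And>i b x. i \<in> I \<Longrightarrow> x \<in> topspace N \<Longrightarrow> pr i (j (r i b x)) = x"
    and homotopic_U: "\<And>i b. i \<in> I \<Longrightarrow>
      homotopic_with (\<lambda>_. True) (subtopology Q (U i)) (subtopology Q (U i)) id (j \<circ> r i b \<circ> pr i)"
    and homotopic_V: "\<And>i b. i \<in> I \<Longrightarrow>
      homotopic_with (\<lambda>_. True) (subtopology Q (V i b)) (subtopology Q (V i b)) id (j \<circ> r i b \<circ> pr i)"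
begin

abbreviation simp_in :: "nat \<Rightarrow> 'a set \<Rightarrow> ((nat \<Rightarrow> real) \<Rightarrow> 'a) \<Rightarrow> bool" where
  "simp_in q A \<equiv> singular_simplex q (subtopology Q A)"

text \<open>\<open>r\<close> takes values in \<open>M\<close>, so that \<open>d\<close> can be
  written with maps induced by continuous maps \<open>N\<close> to \<open>M\<close>; composing with
  \<open>j\<close> moves them into the sides, which are subsets of \<open>Q\<close>.\<close>

definition sec :: "nat \<Rightarrow> 'i \<Rightarrow> bool \<Rightarrow> ((nat \<Rightarrow> real) \<Rightarrow> 'c) \<Rightarrow> (nat \<Rightarrow> real) \<Rightarrow> 'a" where
  "sec q i b \<tau> = simplex_map q (j \<circ> r i b) \<tau>"

definition proj :: "nat \<Rightarrow> 'i \<Rightarrow> ((nat \<Rightarrow> real) \<Rightarrow> 'a) \<Rightarrow> (nat \<Rightarrow> real) \<Rightarrow> 'c" where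
  "proj q i \<sigma> = simplex_map q (pr i) \<sigma>"

lemma V_subset:
  assumes i: "i \<in> I"
  shows "V i b \<subseteq> U i" "V i b \<subseteq> MM"
proof -
  have "V i b \<subseteq> U i \<inter> MM"
    unfolding V_union [OF i] by (cases b) auto
  then show "V i b \<subseteq> U i" "V i b \<subseteq> MM"
    by simp_all
qed

lemma continuous_j: "continuous_map M (subtopology Q MM) j"
  and continuous_jv: "continuous_map (subtopology Q MM) M jv"
  using j by (auto simp: homeomorphic_maps_def)

lemma continuous_sec:
  assumes "i \<in> I"
  shows "continuous_map N (subtopology Q (V i b)) (j \<circ> r i b)"
proof -
  have "continuous_map N (subtopology Q MM) (j \<circ> r i b)"
    using r [OF assms] continuous_j by (rule continuous_map_compose)
  then show ?thesis
    using r_V [OF assms] by (auto simp: continuous_map_in_subtopology)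
qed

lemma sec_V: "i \<in> I \<Longrightarrow> singular_simplex q N \<tau> \<Longrightarrow> simp_in q (V i b) (sec q i b \<tau>)"
  unfolding sec_def using continuous_sec by (rule singular_simplex_simplex_map [rotated])

lemma simp_in_V:
  assumes "i \<in> I" "simp_in q (V i b) \<sigma>"
  shows "simp_in q (U i) \<sigma>" "simp_in q MM \<sigma>"
  using V_subset [OF assms(1)] assms(2) singular_simplex_mono by blast+

lemma proj_N: "i \<in> I \<Longrightarrow> simp_in q (U i) \<sigma> \<Longrightarrow> singular_simplex q N (proj q i \<sigma>)"
  unfolding proj_def using pr by (rule singular_simplex_simplex_map [rotated])

lemma proj_sec:
  assumes "i \<in> I" "singular_simplex q N \<tau>"
  shows "proj q i (sec q i b \<tau>) = \<tau>"
proof -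
  have "proj q i (sec q i b \<tau>) = simplex_map q (pr i \<circ> (j \<circ> r i b)) \<tau>"
    by (simp only: sec_def proj_def simplex_map_compose o_apply)
  also have "\<dots> = \<tau>"
    using assms(2) by (rule simplex_map_id_gen) (simp add: pr_r [OF assms(1)])
  finally show ?thesis .
qed

lemma simplex_map_j_r: "simplex_map q j (simplex_map q (r i b) \<tau>) = sec q i b \<tau>"
  by (simp only: sec_def simplex_map_compose o_apply)

lemma simplex_map_jv_sec:
  assumes "i \<in> I" "singular_simplex q N \<tau>"
  shows "simplex_map q jv (sec q i b \<tau>) = simplex_map q (r i b) \<tau>"
proof -
  have "singular_simplex q M (simplex_map q (r i b) \<tau>)"
    using assms(2) r [OF assms(1)] by (rule singular_simplex_simplex_map)
  moreover have "simplex_map q jv (sec q i b \<tau>) = simplex_map q (jv \<circ> j) (simplex_map q (r i b) \<tau>)"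
    by (simp only: simplex_map_compose o_apply simplex_map_j_r)
  ultimately show ?thesis
    using j by (simp add: simplex_map_id_gen homeomorphic_maps_def)
qed

lemma simplex_map_jv_j: "singular_simplex q M \<tau> \<Longrightarrow> simplex_map q jv (simplex_map q j \<tau>) = \<tau>"
  using j simplex_map_id_gen [of q M \<tau> "jv \<circ> j"]
  by (simp add: simplex_map_compose homeomorphic_maps_def)

lemma simplex_map_j_jv: "simp_in q MM \<sigma> \<Longrightarrow> simplex_map q j (simplex_map q jv \<sigma>) = \<sigma>"
  using j simplex_map_id_gen [of q "subtopology Q MM" \<sigma> "j \<circ> jv"]
  by (simp add: simplex_map_compose homeomorphic_maps_def)

lemma cocycle_sec: "i \<in> I \<Longrightarrow> cocycle q (subtopology Q (V i b)) u \<Longrightarrow> cocycle q N (\<lambda>\<tau>. u (sec q i b \<tau>))"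
  unfolding sec_def by (rule cocycle_pullback [OF continuous_sec])

lemma cobounds_sec: "i \<in> I \<Longrightarrow> cobounds q (subtopology Q (V i b)) u \<Longrightarrow> cobounds q N (\<lambda>\<tau>. u (sec q i b \<tau>))"
  unfolding sec_def by (rule cobounds_pullback [OF continuous_sec])

lemma cocycle_proj: "i \<in> I \<Longrightarrow> cocycle q N u \<Longrightarrow> cocycle q (subtopology Q (U i)) (\<lambda>\<sigma>. u (proj q i \<sigma>))"
  unfolding proj_def by (rule cocycle_pullback [OF pr])

lemma cobounds_proj: "i \<in> I \<Longrightarrow> cobounds q N u \<Longrightarrow> cobounds q (subtopology Q (U i)) (\<lambda>\<sigma>. u (proj q i \<sigma>))"
  unfolding proj_def by (rule cobounds_pullback [OF pr])

lemma cocycle_j: "cocycle q (subtopology Q MM) u \<Longrightarrow> cocycle q M (\<lambda>\<tau>. u (simplex_map q j \<tau>))"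
  by (rule cocycle_pullback [OF continuous_j])

lemma cocycle_jv: "cocycle q M u \<Longrightarrow> cocycle q (subtopology Q MM) (\<lambda>\<tau>. u (simplex_map q jv \<tau>))"
  by (rule cocycle_pullback [OF continuous_jv])

lemma simplex_map_sec_proj: "simplex_map q (j \<circ> r i b \<circ> pr i) \<sigma> = sec q i b (proj q i \<sigma>)"
  by (simp only: sec_def proj_def simplex_map_compose o_apply)

text \<open>Across the whole collar one may slide to either side, so \<open>b\<close> is free here.
  In \<open>cobounds_collar_V\<close> the section must belong to the given side.\<close>

lemma cobounds_collar_U:
  assumes "i \<in> I" "cocycle q (subtopology Q (U i)) u"
  shows "cobounds q (subtopology Q (U i)) (\<lambda>\<sigma>. u \<sigma> - u (sec q i b (proj q i \<sigma>)))"
  using homotopic_cocycles [OF homotopic_U [OF assms(1)] assms(2), of b]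
  by (rule cobounds_eqI) (simp add: simplex_map_id_gen simplex_map_sec_proj del: simplex_map_id)

lemma cobounds_collar_V:
  assumes "i \<in> I" "cocycle q (subtopology Q (V i b)) u"
  shows "cobounds q (subtopology Q (V i b)) (\<lambda>\<sigma>. u \<sigma> - u (sec q i b (proj q i \<sigma>)))"
  using homotopic_cocycles [OF homotopic_V [OF assms(1)] assms(2)]
  by (rule cobounds_eqI) (simp add: simplex_map_id_gen simplex_map_sec_proj del: simplex_map_id)

text \<open>A class defined across the whole collar does not jump: there it is cohomologous to its
  pullback through the section \<open>True\<close>, and the section \<open>False\<close> pulls this
  relation back to \<open>N\<close>.\<close>

lemma cobounds_sec_diff:
  assumes i: "i \<in> I" and g: "cocycle q (subtopology Q (U i)) g"
  shows "cobounds q N (\<lambda>\<tau>. g (sec q i True \<tau>) - g (sec q i False \<tau>))"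
proof -
  have "cobounds q (subtopology Q (V i False)) (\<lambda>\<sigma>. g \<sigma> - g (sec q i True (proj q i \<sigma>)))"
    using cobounds_collar_U [OF i g, of True] V_subset(1) [OF i] by (rule cobounds_subset)
  from cobounds_sec [OF i this]
  have "cobounds q N (\<lambda>\<tau>. g (sec q i False \<tau>) - g (sec q i True \<tau>))"
    by (rule cobounds_eqI) (simp add: proj_sec i)
  then show ?thesis
    by (subst cobounds_commute)
qed

text \<open>The image of a simplex is connected, and the two sides are disjoint open sets that cover
  the overlap.\<close>

lemma simp_in_V_cases:
  assumes i: "i \<in> I" and \<sigma>: "simp_in q (U i) \<sigma>" "simp_in q MM \<sigma>"
  obtains b where "simp_in q (V i b) \<sigma>"
proof -
  have sub: "\<sigma> ` standard_simplex q \<subseteq> V i True \<union> V i False"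
    using \<sigma> V_union [OF i] by (auto simp: singular_simplex_subtopology)
  have Q: "singular_simplex q Q \<sigma>"
    using \<sigma> by (auto simp: singular_simplex_subtopology)
  have "connectedin Q (\<sigma> ` standard_simplex q)"
    using Q connectedin_standard_simplex [of q]
    unfolding singular_simplex_def
    by (metis connectedin_continuous_map_image connectedin_subtopology order_refl)
  then have "V i True \<inter> \<sigma> ` standard_simplex q = {} \<or> V i False \<inter> \<sigma> ` standard_simplex q = {}"
    using sub open_V [OF i] disjoint_V [OF i] unfolding connectedin by (metis inf_bot_left)
  then have "\<sigma> ` standard_simplex q \<subseteq> V i False \<or> \<sigma> ` standard_simplex q \<subseteq> V i True"
    using sub by blast
  then show thesis
    using that Q by (auto simp: singular_simplex_subtopology)
qed

lemma patch_U: "\<exists>v :: 'a cochain. \<forall>i\<in>I. \<forall>\<sigma>. simp_in q (U i) \<sigma> \<longrightarrow> v \<sigma> = a i \<sigma>"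
proof -
  obtain v :: "'a cochain" where "\<And>i \<sigma>. i \<in> I \<Longrightarrow> simp_in q (U i) \<sigma> \<Longrightarrow> v \<sigma> = a i \<sigma>"
    using patch_cochains [of I U q Q a] disjoint_U by metis
  then show ?thesis
    by blast
qed

lemma patch_V:
  "\<exists>v :: 'a cochain. \<forall>i\<in>I. \<forall>b \<sigma>. simp_in q (V i b) \<sigma> \<longrightarrow> v \<sigma> = a i b \<sigma>"
proof -
  define A where "A = (\<lambda>(i, b). V i b)"
  have disj: "A k \<inter> A l = {}" if kl: "k \<in> I \<times> UNIV" "l \<in> I \<times> UNIV" "k \<noteq> l" for k l
  proof (cases "fst k = fst l")
    case True
    obtain i b where k: "k = (i, b)"
      by (cases k)
    with True kl have l: "l = (i, \<not> b)"
      by (cases l) auto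
    have "i \<in> I"
      using kl k by simp
    then show ?thesis
      using disjoint_V [of i] unfolding A_def k l by (cases b) auto
  next
    case False
    then have "U (fst k) \<inter> U (fst l) = {}"
      using kl by (intro disjoint_U) auto
    moreover have "A m \<subseteq> U (fst m)" if "m \<in> I \<times> UNIV" for m
      using that V_subset(1) by (cases m) (simp add: A_def)
    ultimately show ?thesis
      using kl by blast
  qed
  obtain v :: "'a cochain" where v: "\<And>k \<sigma>. k \<in> I \<times> UNIV \<Longrightarrow> simp_in q (A k) \<sigma> \<Longrightarrow> v \<sigma> = a (fst k) (snd k) \<sigma>"
    using patch_cochains [of "I \<times> UNIV" A q Q "\<lambda>k. a (fst k) (snd k)"] disj by metis
  have "v \<sigma> = a i b \<sigma>" if "i \<in> I" "simp_in q (V i b) \<sigma>" for i b \<sigma>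
    using v [of "(i, b)" \<sigma>] that by (simp add: A_def)
  then show ?thesis
    by blast
qed

text \<open>By connectedness, a simplex in the overlap lies in one side, so agreement on the sides
  is agreement on the whole overlap. One function \<open>g\<close> serves all collars because they
  can be patched beforehand.\<close>

lemma glue:
  assumes "\<And>i b \<sigma>. i \<in> I \<Longrightarrow> simp_in q (V i b) \<sigma> \<Longrightarrow> v \<sigma> = g \<sigma>"
  obtains a :: "'a cochain" where "\<And>\<sigma>. simp_in q MM \<sigma> \<Longrightarrow> a \<sigma> = v \<sigma>"
    "\<And>i \<sigma>. i \<in> I \<Longrightarrow> simp_in q (U i) \<sigma> \<Longrightarrow> a \<sigma> = g \<sigma>"
proof
  let ?a = "\<lambda>\<sigma>. if simp_in q MM \<sigma> then v \<sigma> else g \<sigma>"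
  show "?a \<sigma> = v \<sigma>" if "simp_in q MM \<sigma>" for \<sigma>
    using that by simp
  show "?a \<sigma> = g \<sigma>" if "i \<in> I" "simp_in q (U i) \<sigma>" for i \<sigma>
    using simp_in_V_cases [OF that] assms [OF that(1)] by metis
qed

text \<open>In degree 0 a coboundary is zero, so \<open>z = 0\<close> will do.\<close>

lemma patch_cobounds:
  assumes a: "\<And>i b. i \<in> I \<Longrightarrow> cobounds q (subtopology Q (V i b)) (a i b)"
  obtains z where "\<And>\<sigma>. singular_simplex (Suc q) Q \<sigma> \<Longrightarrow> cob q z \<sigma> = 0"
    "\<And>i b \<sigma>. i \<in> I \<Longrightarrow> simp_in q (V i b) \<sigma> \<Longrightarrow> z \<sigma> = a i b \<sigma>"
proof (cases q)
  case 0
  then show ?thesis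
    using a that [of "\<lambda>_. 0"] by (simp add: cobounds_0)
next
  case (Suc p)
  have "\<forall>i\<in>I. \<forall>b. \<exists>v. \<forall>\<sigma>. simp_in q (V i b) \<sigma> \<longrightarrow> a i b \<sigma> = cob p v \<sigma>"
    using a by (simp add: Suc cobounds_Suc)
  then obtain v where v: "\<And>i b \<sigma>. i \<in> I \<Longrightarrow> simp_in q (V i b) \<sigma> \<Longrightarrow> a i b \<sigma> = cob p (v i b) \<sigma>"
    by metis
  obtain t where t: "\<And>i b \<sigma>. i \<in> I \<Longrightarrow> simp_in p (V i b) \<sigma> \<Longrightarrow> t \<sigma> = v i b \<sigma>"
    using patch_V [of p v] by blast
  show ?thesis
  proof
    show "cob q (cob p t) \<sigma> = 0" if "singular_simplex (Suc q) Q \<sigma>" for \<sigma>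
      using that Suc cob_cob by blast
    show "cob p t \<sigma> = a i b \<sigma>" if "i \<in> I" "simp_in q (V i b) \<sigma>" for i b \<sigma>
      using v [OF that] that cob_cong [of p "subtopology Q (V i b)" \<sigma> t "v i b"] t
      by (simp add: Suc)
  qed
qed

lemma open_cover: "open_cover Q (insert MM (U ` I))"
  by unfold_locales (use open_MM open_U covers in auto)

lemma extend_cocycle:
  assumes "cocycle q (subtopology Q MM) w" "\<And>i. i \<in> I \<Longrightarrow> cocycle q (subtopology Q (U i)) w"
  obtains w' where "cocycle q Q w'" "\<And>\<sigma>. simp_in q MM \<sigma> \<Longrightarrow> w' \<sigma> = w \<sigma>"
    "\<And>i \<sigma>. i \<in> I \<Longrightarrow> simp_in q (U i) \<sigma> \<Longrightarrow> w' \<sigma> = w \<sigma>"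
proof -
  have "cocycle q (subtopology Q A) w" if "A \<in> insert MM (U ` I)" for A
    using that assms by auto
  then obtain w' where w': "cocycle q Q w'"
    "\<And>A \<sigma>. A \<in> insert MM (U ` I) \<Longrightarrow> simp_in q A \<sigma> \<Longrightarrow> w' \<sigma> = w \<sigma>"
    by (rule open_cover.extend_small_cocycle [OF open_cover]) blast+
  show thesis
    using w'(1) w'(2) [of MM] w'(2) [of "U _"] by (intro that [of w']) auto
qed

lemma cobounds_Suc_Q:
  assumes "cocycle (Suc q) Q w" "\<And>\<sigma>. simp_in (Suc q) MM \<sigma> \<Longrightarrow> w \<sigma> = cob q v \<sigma>"
    "\<And>i \<sigma>. i \<in> I \<Longrightarrow> simp_in (Suc q) (U i) \<sigma> \<Longrightarrow> w \<sigma> = cob q v \<sigma>"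
  shows "cobounds (Suc q) Q w"
  using open_cover.cobounds_if_small_coboundary [OF open_cover, of q w v] assms by blast

text \<open>\<open>connects q u c\<close>: the Mayer-Vietoris connecting homomorphism for the cover by \<open>MM\<close> and the
  collars sends the class that is \<open>u i\<close> on \<open>V i True\<close> and \<open>0\<close> on \<open>V i False\<close> to the class of \<open>c\<close>.\<close>

definition connects :: "nat \<Rightarrow> ('i \<Rightarrow> 'c cochain) \<Rightarrow> 'a cochain \<Rightarrow> bool" where
  "connects q u c \<longleftrightarrow> cocycle (Suc q) Q c \<and> (\<exists>v g.
     (\<forall>\<sigma>. simp_in (Suc q) MM \<sigma> \<longrightarrow> c \<sigma> = cob q v \<sigma>) \<and>
     (\<forall>i\<in>I. \<forall>\<sigma>. simp_in (Suc q) (U i) \<sigma> \<longrightarrow> c \<sigma> = cob q g \<sigma>) \<and>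
     (\<forall>i\<in>I. \<forall>b \<sigma>. simp_in q (V i b) \<sigma> \<longrightarrow> g \<sigma> - v \<sigma> = (if b then u i (proj q i \<sigma>) else 0)))"

lemma connects_cocycle: "connects q u c \<Longrightarrow> cocycle (Suc q) Q c"
  by (simp add: connects_def)

lemma connectsE:
  assumes "connects q u c"
  obtains v g where
    "\<And>\<sigma>. simp_in (Suc q) MM \<sigma> \<Longrightarrow> c \<sigma> = cob q v \<sigma>"
    "\<And>i \<sigma>. i \<in> I \<Longrightarrow> simp_in (Suc q) (U i) \<sigma> \<Longrightarrow> c \<sigma> = cob q g \<sigma>"
    "\<And>i b \<sigma>. i \<in> I \<Longrightarrow> simp_in q (V i b) \<sigma> \<Longrightarrow> g \<sigma> - v \<sigma> = (if b then u i (proj q i \<sigma>) else 0)"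
  using assms unfolding connects_def by blast

lemma connectsI:
  assumes "cocycle (Suc q) Q c"
    "\<And>\<sigma>. simp_in (Suc q) MM \<sigma> \<Longrightarrow> c \<sigma> = cob q v \<sigma>"
    "\<And>i \<sigma>. i \<in> I \<Longrightarrow> simp_in (Suc q) (U i) \<sigma> \<Longrightarrow> c \<sigma> = cob q g \<sigma>"
    "\<And>i b \<sigma>. i \<in> I \<Longrightarrow> simp_in q (V i b) \<sigma> \<Longrightarrow> g \<sigma> - v \<sigma> = (if b then u i (proj q i \<sigma>) else 0)"
  shows "connects q u c"
  using assms unfolding connects_def by blast

lemma connects_add:
  assumes "connects q u c" "connects q u' c'"
  shows "connects q (\<lambda>i \<tau>. u i \<tau> + u' i \<tau>) (\<lambda>\<sigma>. c \<sigma> + c' \<sigma>)"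
proof -
  obtain v g where 1: "\<And>\<sigma>. simp_in (Suc q) MM \<sigma> \<Longrightarrow> c \<sigma> = cob q v \<sigma>"
    "\<And>i \<sigma>. i \<in> I \<Longrightarrow> simp_in (Suc q) (U i) \<sigma> \<Longrightarrow> c \<sigma> = cob q g \<sigma>"
    "\<And>i b \<sigma>. i \<in> I \<Longrightarrow> simp_in q (V i b) \<sigma> \<Longrightarrow> g \<sigma> - v \<sigma> = (if b then u i (proj q i \<sigma>) else 0)"
    using assms(1) by (rule connectsE) blast
  obtain v' g' where 2: "\<And>\<sigma>. simp_in (Suc q) MM \<sigma> \<Longrightarrow> c' \<sigma> = cob q v' \<sigma>"
    "\<And>i \<sigma>. i \<in> I \<Longrightarrow> simp_in (Suc q) (U i) \<sigma> \<Longrightarrow> c' \<sigma> = cob q g' \<sigma>"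
    "\<And>i b \<sigma>. i \<in> I \<Longrightarrow> simp_in q (V i b) \<sigma> \<Longrightarrow> g' \<sigma> - v' \<sigma> = (if b then u' i (proj q i \<sigma>) else 0)"
    using assms(2) by (rule connectsE) blast
  show ?thesis
  proof (rule connectsI)
    show "cocycle (Suc q) Q (\<lambda>\<sigma>. c \<sigma> + c' \<sigma>)"
      using assms by (intro cocycle_add connects_cocycle)
    show "c \<sigma> + c' \<sigma> = cob q (\<lambda>\<sigma>. v \<sigma> + v' \<sigma>) \<sigma>" if "simp_in (Suc q) MM \<sigma>" for \<sigma>
      using that 1 2 by (simp add: cob_add)
    show "c \<sigma> + c' \<sigma> = cob q (\<lambda>\<sigma>. g \<sigma> + g' \<sigma>) \<sigma>" if "i \<in> I" "simp_in (Suc q) (U i) \<sigma>" for i \<sigma>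
      using that 1 2 by (simp add: cob_add)
    show "(g \<sigma> + g' \<sigma>) - (v \<sigma> + v' \<sigma>) = (if b then u i (proj q i \<sigma>) + u' i (proj q i \<sigma>) else 0)"
      if "i \<in> I" "simp_in q (V i b) \<sigma>" for i b \<sigma>
      using 1(3) [OF that] 2(3) [OF that] by (auto split: if_splits)
  qed
qed

lemma connects_minus:
  assumes "connects q u c"
  shows "connects q (\<lambda>i \<tau>. - u i \<tau>) (\<lambda>\<sigma>. - c \<sigma>)"
proof -
  obtain v g where 1: "\<And>\<sigma>. simp_in (Suc q) MM \<sigma> \<Longrightarrow> c \<sigma> = cob q v \<sigma>"
    "\<And>i \<sigma>. i \<in> I \<Longrightarrow> simp_in (Suc q) (U i) \<sigma> \<Longrightarrow> c \<sigma> = cob q g \<sigma>"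
    "\<And>i b \<sigma>. i \<in> I \<Longrightarrow> simp_in q (V i b) \<sigma> \<Longrightarrow> g \<sigma> - v \<sigma> = (if b then u i (proj q i \<sigma>) else 0)"
    using assms(1) by (rule connectsE) blast
  show ?thesis
  proof (rule connectsI)
    show "cocycle (Suc q) Q (\<lambda>\<sigma>. - c \<sigma>)"
      using assms by (intro cocycle_minus connects_cocycle)
    show "- c \<sigma> = cob q (\<lambda>\<sigma>. - v \<sigma>) \<sigma>" if "simp_in (Suc q) MM \<sigma>" for \<sigma>
      using that 1 by (simp add: cob_minus)
    show "- c \<sigma> = cob q (\<lambda>\<sigma>. - g \<sigma>) \<sigma>" if "i \<in> I" "simp_in (Suc q) (U i) \<sigma>" for i \<sigma>
      using that 1 by (simp add: cob_minus)
    show "- g \<sigma> - - v \<sigma> = (if b then - u i (proj q i \<sigma>) else 0)"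
      if "i \<in> I" "simp_in q (V i b) \<sigma>" for i b \<sigma>
      using 1(3) [OF that] by (auto split: if_splits)
  qed
qed

text \<open>Primitives of the \<open>u i\<close> give a closed \<open>z\<close> with the same values
  on the sides as \<open>g - v\<close>. Then \<open>v\<close> and \<open>g - z\<close> agree there
  and glue to a primitive of \<open>c\<close> on every small simplex. This is what makes the
  connecting map well defined.\<close>

lemma connects_cobounds:
  assumes c: "connects q u c" and u: "\<And>i. i \<in> I \<Longrightarrow> cobounds q N (u i)"
  shows "cobounds (Suc q) Q c"
proof -
  obtain v g where v: "\<And>\<sigma>. simp_in (Suc q) MM \<sigma> \<Longrightarrow> c \<sigma> = cob q v \<sigma>"
    and g: "\<And>i \<sigma>. i \<in> I \<Longrightarrow> simp_in (Suc q) (U i) \<sigma> \<Longrightarrow> c \<sigma> = cob q g \<sigma>"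
    and gv: "\<And>i b \<sigma>. i \<in> I \<Longrightarrow> simp_in q (V i b) \<sigma> \<Longrightarrow> g \<sigma> - v \<sigma> = (if b then u i (proj q i \<sigma>) else 0)"
    using c by (rule connectsE) blast
  have "cobounds q (subtopology Q (V i b)) (\<lambda>\<sigma>. if b then u i (proj q i \<sigma>) else 0)" if "i \<in> I" for i b
    using cobounds_subset [OF cobounds_proj [OF that u [OF that]] V_subset(1) [OF that]] by (cases b) simp_all
  then obtain z where z: "\<And>\<sigma>. singular_simplex (Suc q) Q \<sigma> \<Longrightarrow> cob q z \<sigma> = 0"
    "\<And>i b \<sigma>. i \<in> I \<Longrightarrow> simp_in q (V i b) \<sigma> \<Longrightarrow> z \<sigma> = (if b then u i (proj q i \<sigma>) else 0)"
    using patch_cobounds [of q "\<lambda>i b \<sigma>. if b then u i (proj q i \<sigma>) else 0"] by blast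
  have "v \<sigma> = g \<sigma> - z \<sigma>" if "i \<in> I" "simp_in q (V i b) \<sigma>" for i b \<sigma>
    using gv [OF that] z(2) [OF that] by simp
  then obtain a where a: "\<And>\<sigma>. simp_in q MM \<sigma> \<Longrightarrow> a \<sigma> = v \<sigma>"
    "\<And>i \<sigma>. i \<in> I \<Longrightarrow> simp_in q (U i) \<sigma> \<Longrightarrow> a \<sigma> = g \<sigma> - z \<sigma>"
    using glue [of q v "\<lambda>\<sigma>. g \<sigma> - z \<sigma>"] by metis
  show ?thesis
  proof (rule cobounds_Suc_Q [OF connects_cocycle [OF c]])
    show "c \<sigma> = cob q a \<sigma>" if "simp_in (Suc q) MM \<sigma>" for \<sigma>
      using v [OF that] cob_cong [OF that a(1)] by simp
    show "c \<sigma> = cob q a \<sigma>" if "i \<in> I" "simp_in (Suc q) (U i) \<sigma>" for i \<sigma>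
      using g [OF that] cob_cong [OF that(2) a(2) [OF that(1)]] z(1) [of \<sigma>] that(2)
      by (simp add: cob_diff singular_simplex_subtopology)
  qed
qed

text \<open>Take \<open>v = 0\<close> and let \<open>g\<close> have the prescribed values on the
  sides. As the \<open>u i\<close> are cocycles, the coboundary of \<open>g\<close> vanishes over
  the sides, so it glues with 0 on \<open>MM\<close> and then extends to simplices that lie in
  neither piece.\<close>

lemma connects_ex:
  assumes u: "\<And>i. i \<in> I \<Longrightarrow> cocycle q N (u i)"
  obtains c where "connects q u c"
proof -
  obtain g where g: "\<And>i b \<sigma>. i \<in> I \<Longrightarrow> simp_in q (V i b) \<sigma> \<Longrightarrow> g \<sigma> = (if b then u i (proj q i \<sigma>) else 0)"
    using patch_V [of q "\<lambda>i b \<sigma>. if b then u i (proj q i \<sigma>) else 0"] by blast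
  have "cocycle q (subtopology Q (V i b)) (\<lambda>\<sigma>. if b then u i (proj q i \<sigma>) else 0)" if "i \<in> I" for i b
    using cocycle_subset [OF cocycle_proj [OF that u [OF that]] V_subset(1) [OF that]] by (cases b) simp_all
  then have "cocycle q (subtopology Q (V i b)) g" if "i \<in> I" for i b
    by (rule cocycle_eqI [OF _ g]) (use that in auto)
  then have "0 = cob q g \<sigma>" if "i \<in> I" "simp_in (Suc q) (V i b) \<sigma>" for i b \<sigma>
    using that by (simp add: cocycle_def)
  then obtain a where a: "\<And>\<sigma>. simp_in (Suc q) MM \<sigma> \<Longrightarrow> a \<sigma> = 0"
    "\<And>i \<sigma>. i \<in> I \<Longrightarrow> simp_in (Suc q) (U i) \<sigma> \<Longrightarrow> a \<sigma> = cob q g \<sigma>"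
    using glue [of "Suc q" "\<lambda>_. 0" "cob q g"] by metis
  have "cocycle (Suc q) (subtopology Q MM) a"
    by (rule cocycle_eqI [OF cocycle_zero a(1)])
  moreover have "cocycle (Suc q) (subtopology Q (U i)) a" if "i \<in> I" for i
    by (rule cocycle_eqI [OF _ a(2) [OF that]]) (simp add: cocycle_def cob_cob)
  ultimately obtain c where c: "cocycle (Suc q) Q c" "\<And>\<sigma>. simp_in (Suc q) MM \<sigma> \<Longrightarrow> c \<sigma> = a \<sigma>"
    "\<And>i \<sigma>. i \<in> I \<Longrightarrow> simp_in (Suc q) (U i) \<sigma> \<Longrightarrow> c \<sigma> = a \<sigma>"
    using extend_cocycle by blast
  have "connects q u c"
    by (rule connectsI [where v = "\<lambda>_. 0" and g = g]) (use a c g in auto)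
  then show thesis
    by (rule that)
qed

section \<open>Exactness at the level of cochains\<close>

definition jump :: "nat \<Rightarrow> 'b cochain \<Rightarrow> 'i \<Rightarrow> 'c cochain" where
  "jump q \<alpha> i = (\<lambda>\<tau>. \<alpha> (simplex_map q (r i True) \<tau>) - \<alpha> (simplex_map q (r i False) \<tau>))"

lemma restrict_connects:
  assumes "connects q u c"
  shows "cobounds (Suc q) M (\<lambda>\<tau>. c (simplex_map (Suc q) j \<tau>))"
proof -
  obtain v where "\<And>\<sigma>. simp_in (Suc q) MM \<sigma> \<Longrightarrow> c \<sigma> = cob q v \<sigma>"
    using assms by (rule connectsE) blast
  then have "cobounds (Suc q) (subtopology Q MM) c"
    unfolding cobounds_Suc by blast
  then show ?thesis
    by (rule cobounds_pullback [OF continuous_j])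
qed

text \<open>After subtraction of a primitive on \<open>MM\<close>, the class is concentrated in the
  collars, where it has a primitive \<open>g\<close>. On the sides \<open>g\<close> is closed, and
  the difference of its classes on the two sides is the wanted \<open>u\<close>.\<close>

lemma connects_if_restrict_cobounds:
  assumes c: "cocycle (Suc q) Q c" and cobounds: "cobounds (Suc q) M (\<lambda>\<tau>. c (simplex_map (Suc q) j \<tau>))"
  obtains u where "\<And>i. i \<in> I \<Longrightarrow> cocycle q N (u i)" "connects q u c"
proof -
  obtain \<alpha> where \<alpha>: "\<And>\<tau>. singular_simplex (Suc q) M \<tau> \<Longrightarrow> c (simplex_map (Suc q) j \<tau>) = cob q \<alpha> \<tau>"
    using cobounds by (auto simp: cobounds_Suc)
  define v where "v = (\<lambda>\<sigma>. \<alpha> (simplex_map q jv \<sigma>))"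
  have v: "c \<sigma> = cob q v \<sigma>" if "simp_in (Suc q) MM \<sigma>" for \<sigma>
    using \<alpha> [OF singular_simplex_simplex_map [OF that continuous_jv]]
    by (simp add: v_def simplex_map_j_jv that cob_simplex_map [OF that])
  \<comment> \<open>\<open>v\<close> is meaningful only on \<open>MM\<close>, but as a total
    function it has a coboundary on all of \<open>Q\<close>. So \<open>c0\<close> is still a
    cocycle, and it vanishes on \<open>MM\<close>.\<close>
  define c0 where "c0 = (\<lambda>\<sigma>. c \<sigma> - cob q v \<sigma>)"
  have c0: "cocycle (Suc q) Q c0"
    unfolding c0_def by (rule cocycle_diff [OF c]) (simp add: cocycle_def cob_cob)
  \<comment> \<open>On the collar \<open>c0\<close> is cohomologous to its pullback through a side,
    and that pullback is 0 because sides lie in \<open>MM\<close>.\<close>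
  have "cobounds (Suc q) (subtopology Q (U i)) c0" if i: "i \<in> I" for i
  proof -
    have "c0 (sec (Suc q) i False (proj (Suc q) i \<sigma>)) = 0" if "simp_in (Suc q) (U i) \<sigma>" for \<sigma>
      using v simp_in_V(2) [OF i sec_V [OF i proj_N [OF i that]]] by (simp add: c0_def)
    then show ?thesis
      by (intro cobounds_eqI [OF cobounds_collar_U [OF i cocycle_subtopology [OF c0], of False]]) simp
  qed
  then have "\<forall>i\<in>I. \<exists>g. \<forall>\<sigma>. simp_in (Suc q) (U i) \<sigma> \<longrightarrow> c0 \<sigma> = cob q g \<sigma>"
    by (simp add: cobounds_Suc)
  then obtain gs where gs: "\<And>i \<sigma>. i \<in> I \<Longrightarrow> simp_in (Suc q) (U i) \<sigma> \<Longrightarrow> c0 \<sigma> = cob q (gs i) \<sigma>"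
    by metis
  obtain g where "\<And>i \<sigma>. i \<in> I \<Longrightarrow> simp_in q (U i) \<sigma> \<Longrightarrow> g \<sigma> = gs i \<sigma>"
    using patch_U [of q gs] by blast
  then have g: "c0 \<sigma> = cob q g \<sigma>" if "i \<in> I" "simp_in (Suc q) (U i) \<sigma>" for i \<sigma>
    using gs [OF that] cob_cong [OF that(2)] that(1) by metis
  have cocg: "cocycle q (subtopology Q (V i b)) g" if i: "i \<in> I" for i b
    unfolding cocycle_def
  proof (intro allI impI)
    fix \<sigma> assume \<sigma>: "simp_in (Suc q) (V i b) \<sigma>"
    then show "cob q g \<sigma> = 0"
      using g [OF i simp_in_V(1) [OF i \<sigma>]] v [OF simp_in_V(2) [OF i \<sigma>]] by (simp add: c0_def)
  qed
  define u where "u = (\<lambda>i \<tau>. g (sec q i True \<tau>) - g (sec q i False \<tau>))"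
  have u: "cocycle q N (u i)" if "i \<in> I" for i
    unfolding u_def using cocycle_sec [OF that cocg [OF that]] by (intro cocycle_diff)
  \<comment> \<open>Normalisation to 0 on the side \<open>False\<close>: \<open>bs i\<close> is
    closed on the whole collar, so subtracting it does not disturb the coboundary of
    \<open>g\<close>. It cancels \<open>g\<close> on that side only up to a coboundary, which
    \<open>z\<close> below removes exactly.\<close>
  define bs where "bs = (\<lambda>i \<sigma>. g (sec q i False (proj q i \<sigma>)))"
  have cocb: "cocycle q (subtopology Q (U i)) (bs i)" if "i \<in> I" for i
    unfolding bs_def using cocycle_proj [OF that cocycle_sec [OF that cocg [OF that]]] .
  obtain B where B: "\<And>i \<sigma>. i \<in> I \<Longrightarrow> simp_in q (U i) \<sigma> \<Longrightarrow> B \<sigma> = bs i \<sigma>"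
    using patch_U [of q bs] by blast
  have cocB: "cocycle q (subtopology Q (U i)) B" if "i \<in> I" for i
    by (rule cocycle_eqI [OF cocb [OF that] B [OF that]])
  have "cobounds q (subtopology Q (V i b)) (\<lambda>\<sigma>. g \<sigma> - g (sec q i b (proj q i \<sigma>)))" if "i \<in> I" for i b
    using cobounds_collar_V [OF that cocg [OF that]] .
  then obtain z where z: "\<And>\<sigma>. singular_simplex (Suc q) Q \<sigma> \<Longrightarrow> cob q z \<sigma> = 0"
    "\<And>i b \<sigma>. i \<in> I \<Longrightarrow> simp_in q (V i b) \<sigma> \<Longrightarrow> z \<sigma> = g \<sigma> - g (sec q i b (proj q i \<sigma>))"
    using patch_cobounds [of q "\<lambda>i b \<sigma>. g \<sigma> - g (sec q i b (proj q i \<sigma>))"] by blast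
  have "connects q u c"
  proof (rule connectsI [where v = v and g = "\<lambda>\<sigma>. v \<sigma> + (g \<sigma> - B \<sigma> - z \<sigma>)", OF c v])
    show "c \<sigma> = cob q (\<lambda>\<sigma>. v \<sigma> + (g \<sigma> - B \<sigma> - z \<sigma>)) \<sigma>" if "i \<in> I" "simp_in (Suc q) (U i) \<sigma>" for i \<sigma>
      using g [OF that] cocB [OF that(1)] z(1) [of \<sigma>] that(2)
      by (simp add: cob_add cob_diff cocycle_def c0_def singular_simplex_subtopology)
    show "v \<sigma> + (g \<sigma> - B \<sigma> - z \<sigma>) - v \<sigma> = (if b then u i (proj q i \<sigma>) else 0)"
      if "i \<in> I" "simp_in q (V i b) \<sigma>" for i b \<sigma>
      using z(2) [OF that] B [OF that(1) simp_in_V(1) [OF that]] by (simp add: u_def bs_def)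
  qed
  then show thesis
    using that u by blast
qed

text \<open>Pull \<alpha> back to a cocycle \<open>a\<close> on \<open>MM\<close> and let
  \<open>B\<close> continue its \<open>False\<close> values over each collar. Up to the closed
  correction \<open>z\<close>, \<open>a - B\<close> is 0 on one side and the jump on the other.
  \<open>connects\<close> uses collar minus \<open>MM\<close>, hence the signs of \<open>v\<close>
  and \<open>g\<close>.\<close>

lemma jump_connects:
  assumes \<alpha>: "cocycle q M \<alpha>"
  shows "connects q (jump q \<alpha>) (\<lambda>_. 0)"
proof -
  define a where "a = (\<lambda>\<sigma>. \<alpha> (simplex_map q jv \<sigma>))"
  have coca: "cocycle q (subtopology Q MM) a"
    unfolding a_def by (rule cocycle_jv [OF \<alpha>])
  have cocaV: "cocycle q (subtopology Q (V i b)) a" if "i \<in> I" for i b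
    using cocycle_subset [OF coca V_subset(2) [OF that]] .
  obtain B where B: "\<And>i \<sigma>. i \<in> I \<Longrightarrow> simp_in q (U i) \<sigma> \<Longrightarrow> B \<sigma> = a (sec q i False (proj q i \<sigma>))"
    using patch_U [of q "\<lambda>i \<sigma>. a (sec q i False (proj q i \<sigma>))"] by blast
  have cocB: "cocycle q (subtopology Q (U i)) B" if "i \<in> I" for i
    by (rule cocycle_eqI [OF cocycle_proj [OF that cocycle_sec [OF that cocaV [OF that]]] B [OF that]])
  have "cobounds q (subtopology Q (V i b)) (\<lambda>\<sigma>. a \<sigma> - a (sec q i b (proj q i \<sigma>)))" if "i \<in> I" for i b
    using cobounds_collar_V [OF that cocaV [OF that]] .
  then obtain z where z: "\<And>\<sigma>. singular_simplex (Suc q) Q \<sigma> \<Longrightarrow> cob q z \<sigma> = 0"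
    "\<And>i b \<sigma>. i \<in> I \<Longrightarrow> simp_in q (V i b) \<sigma> \<Longrightarrow> z \<sigma> = a \<sigma> - a (sec q i b (proj q i \<sigma>))"
    using patch_cobounds [of q "\<lambda>i b \<sigma>. a \<sigma> - a (sec q i b (proj q i \<sigma>))"] by blast
  show ?thesis
  proof (rule connectsI [where v = "\<lambda>\<sigma>. - a \<sigma>" and g = "\<lambda>\<sigma>. - (B \<sigma> + z \<sigma>)"])
    show "0 = cob q (\<lambda>\<sigma>. - a \<sigma>) \<sigma>" if "simp_in (Suc q) MM \<sigma>" for \<sigma>
      using coca that by (simp add: cob_minus cocycle_def)
    show "0 = cob q (\<lambda>\<sigma>. - (B \<sigma> + z \<sigma>)) \<sigma>" if "i \<in> I" "simp_in (Suc q) (U i) \<sigma>" for i \<sigma>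
      using cocB [OF that(1)] z(1) [of \<sigma>] that(2)
      by (simp only: cob_minus cob_add) (simp add: cocycle_def singular_simplex_subtopology)
    show "- (B \<sigma> + z \<sigma>) - - a \<sigma> = (if b then jump q \<alpha> i (proj q i \<sigma>) else 0)"
      if "i \<in> I" "simp_in q (V i b) \<sigma>" for i b \<sigma>
    proof -
      have "singular_simplex q N (proj q i \<sigma>)"
        using that simp_in_V(1) proj_N by blast
      then show ?thesis
        using z(2) [OF that] B [OF that(1) simp_in_V(1) [OF that]] that(1)
        by (simp add: jump_def a_def simplex_map_jv_sec)
    qed
  qed simp
qed

text \<open>Subtracting a global primitive \<open>t\<close> of \<open>c\<close> turns
  \<open>v\<close> and \<open>g\<close> into cocycles with the same difference \<open>u\<close>. The
  one on the collars has no jump in cohomology, so minus the one on \<open>MM\<close> jumps by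
  \<open>u\<close>.\<close>

lemma jump_if_connects_cobounds:
  assumes u: "\<And>i. i \<in> I \<Longrightarrow> cocycle q N (u i)" and c: "connects q u c" "cobounds (Suc q) Q c"
  obtains \<alpha> where "cocycle q M \<alpha>" "\<And>i. i \<in> I \<Longrightarrow> cobounds q N (\<lambda>\<tau>. jump q \<alpha> i \<tau> - u i \<tau>)"
proof -
  obtain v g where v: "\<And>\<sigma>. simp_in (Suc q) MM \<sigma> \<Longrightarrow> c \<sigma> = cob q v \<sigma>"
    and g: "\<And>i \<sigma>. i \<in> I \<Longrightarrow> simp_in (Suc q) (U i) \<sigma> \<Longrightarrow> c \<sigma> = cob q g \<sigma>"
    and gv: "\<And>i b \<sigma>. i \<in> I \<Longrightarrow> simp_in q (V i b) \<sigma> \<Longrightarrow> g \<sigma> - v \<sigma> = (if b then u i (proj q i \<sigma>) else 0)"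
    using c(1) by (rule connectsE) blast
  obtain t where t: "\<And>\<sigma>. singular_simplex (Suc q) Q \<sigma> \<Longrightarrow> c \<sigma> = cob q t \<sigma>"
    using c(2) by (auto simp: cobounds_Suc)
  define v1 where "v1 = (\<lambda>\<sigma>. v \<sigma> - t \<sigma>)"
  define g1 where "g1 = (\<lambda>\<sigma>. g \<sigma> - t \<sigma>)"
  have v1: "cocycle q (subtopology Q MM) v1"
    using v t by (simp add: cocycle_def v1_def cob_diff singular_simplex_subtopology)
  have g1: "cocycle q (subtopology Q (U i)) g1" if "i \<in> I" for i
    using g [OF that] t by (simp add: cocycle_def g1_def cob_diff singular_simplex_subtopology)
  define \<alpha> where "\<alpha> = (\<lambda>\<tau>. - v1 (simplex_map q j \<tau>))"
  show thesis
  proof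
    show "cocycle q M \<alpha>"
      unfolding \<alpha>_def by (intro cocycle_minus cocycle_j v1)
    show "cobounds q N (\<lambda>\<tau>. jump q \<alpha> i \<tau> - u i \<tau>)" if i: "i \<in> I" for i
    proof -
      have "jump q \<alpha> i \<tau> - u i \<tau> = - (g1 (sec q i True \<tau>) - g1 (sec q i False \<tau>))"
        if \<tau>: "singular_simplex q N \<tau>" for \<tau>
        using gv [OF i sec_V [OF i \<tau>], of True] gv [OF i sec_V [OF i \<tau>], of False]
        by (simp add: jump_def \<alpha>_def simplex_map_j_r v1_def g1_def proj_sec [OF i \<tau>])
      then show ?thesis
        by (rule cobounds_eqI [OF cobounds_minus [OF cobounds_sec_diff [OF i g1 [OF i]]]])
    qed
  qed
qed

lemma jump_restrict:
  assumes "cocycle q Q c" "i \<in> I"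
  shows "cobounds q N (jump q (\<lambda>\<tau>. c (simplex_map q j \<tau>)) i)"
  unfolding jump_def simplex_map_j_r
  by (rule cobounds_sec_diff [OF assms(2) cocycle_subtopology [OF assms(1)]])

text \<open>If the jump is trivial, the cocycle on \<open>MM\<close> is cohomologous on both sides
  of a collar to the single cocycle \<open>B\<close> defined across it. The correction
  \<open>z\<close> is placed in the collar, so the glued cocycle restricts to \<alpha> itself and
  not merely to its class.\<close>

lemma restrict_if_jump_cobounds:
  assumes \<alpha>: "cocycle q M \<alpha>" and cobounds: "\<And>i. i \<in> I \<Longrightarrow> cobounds q N (jump q \<alpha> i)"
  obtains c where "cocycle q Q c" "\<And>\<tau>. singular_simplex q M \<tau> \<Longrightarrow> c (simplex_map q j \<tau>) = \<alpha> \<tau>"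
proof -
  define a where "a = (\<lambda>\<sigma>. \<alpha> (simplex_map q jv \<sigma>))"
  have coca: "cocycle q (subtopology Q MM) a"
    unfolding a_def by (rule cocycle_jv [OF \<alpha>])
  have cocaV: "cocycle q (subtopology Q (V i b)) a" if "i \<in> I" for i b
    using cocycle_subset [OF coca V_subset(2) [OF that]] .
  obtain B where B: "\<And>i \<sigma>. i \<in> I \<Longrightarrow> simp_in q (U i) \<sigma> \<Longrightarrow> B \<sigma> = a (sec q i False (proj q i \<sigma>))"
    using patch_U [of q "\<lambda>i \<sigma>. a (sec q i False (proj q i \<sigma>))"] by blast
  have cocB: "cocycle q (subtopology Q (U i)) B" if "i \<in> I" for i
    by (rule cocycle_eqI [OF cocycle_proj [OF that cocycle_sec [OF that cocaV [OF that]]] B [OF that]])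
  have "cobounds q (subtopology Q (V i b)) (\<lambda>\<sigma>. a \<sigma> - B \<sigma>)" if i: "i \<in> I" for i b
  proof -
    have "cobounds q (subtopology Q (V i b)) (\<lambda>\<sigma>. if b then jump q \<alpha> i (proj q i \<sigma>) else 0)"
      using cobounds_subset [OF cobounds_proj [OF i cobounds [OF i]] V_subset(1) [OF i]] by (cases b) simp_all
    from cobounds_add [OF cobounds_collar_V [OF i cocaV [OF i]] this]
    have nl: "cobounds q (subtopology Q (V i b)) (\<lambda>\<sigma>. (a \<sigma> - a (sec q i b (proj q i \<sigma>)))
        + (if b then jump q \<alpha> i (proj q i \<sigma>) else 0))" .
    have eq: "a \<sigma> - a (sec q i b (proj q i \<sigma>)) + (if b then jump q \<alpha> i (proj q i \<sigma>) else 0) = a \<sigma> - B \<sigma>"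
      if "simp_in q (V i b) \<sigma>" for \<sigma>
    proof -
      have N: "singular_simplex q N (proj q i \<sigma>)"
        using i that simp_in_V(1) proj_N by blast
      have a_sec: "a (sec q i c (proj q i \<sigma>)) = \<alpha> (simplex_map q (r i c) (proj q i \<sigma>))" for c
        unfolding a_def simplex_map_jv_sec [OF i N] ..
      have "B \<sigma> = \<alpha> (simplex_map q (r i False) (proj q i \<sigma>))"
        using B [OF i simp_in_V(1) [OF i that]] a_sec by simp
      then show ?thesis
        unfolding a_sec jump_def by (cases b) simp_all
    qed
    show ?thesis
      by (rule cobounds_eqI [OF nl eq [symmetric]])
  qed
  then obtain z where z: "\<And>\<sigma>. singular_simplex (Suc q) Q \<sigma> \<Longrightarrow> cob q z \<sigma> = 0"
    "\<And>i b \<sigma>. i \<in> I \<Longrightarrow> simp_in q (V i b) \<sigma> \<Longrightarrow> z \<sigma> = a \<sigma> - B \<sigma>"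
    using patch_cobounds [of q "\<lambda>i b \<sigma>. a \<sigma> - B \<sigma>"] by blast
  have "a \<sigma> = B \<sigma> + z \<sigma>" if "i \<in> I" "simp_in q (V i b) \<sigma>" for i b \<sigma>
    using z(2) [OF that] by simp
  then obtain w where w: "\<And>\<sigma>. simp_in q MM \<sigma> \<Longrightarrow> w \<sigma> = a \<sigma>"
    "\<And>i \<sigma>. i \<in> I \<Longrightarrow> simp_in q (U i) \<sigma> \<Longrightarrow> w \<sigma> = B \<sigma> + z \<sigma>"
    using glue [of q a "\<lambda>\<sigma>. B \<sigma> + z \<sigma>"] by metis
  have "cocycle q (subtopology Q MM) w"
    by (rule cocycle_eqI [OF coca w(1)])
  moreover have "cocycle q (subtopology Q (U i)) w" if "i \<in> I" for i
  proof -
    have "cocycle q (subtopology Q (U i)) (\<lambda>\<sigma>. B \<sigma> + z \<sigma>)"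
      using z(1) by (intro cocycle_add cocB that) (simp add: cocycle_def singular_simplex_subtopology)
    then show ?thesis
      by (rule cocycle_eqI [OF _ w(2) [OF that]])
  qed
  ultimately obtain c where c: "cocycle q Q c" "\<And>\<sigma>. simp_in q MM \<sigma> \<Longrightarrow> c \<sigma> = w \<sigma>"
      "\<And>i \<sigma>. i \<in> I \<Longrightarrow> simp_in q (U i) \<sigma> \<Longrightarrow> c \<sigma> = w \<sigma>"
    using extend_cocycle by blast
  show thesis
  proof
    show "c (simplex_map q j \<tau>) = \<alpha> \<tau>" if "singular_simplex q M \<tau>" for \<tau>
    proof -
      have "simp_in q MM (simplex_map q j \<tau>)"
        using that continuous_j by (rule singular_simplex_simplex_map)
      then show ?thesis
        using that by (simp add: c w a_def simplex_map_jv_j)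
    qed
  qed (fact c)
qed

text \<open>On a collar, a 0-cocycle takes equal values at a point and at its displacement into a
  side; the latter lies in \<open>MM\<close>, where the cocycle is 0.\<close>

lemma restrict_injective_0:
  assumes c: "cocycle 0 Q c" and cobounds: "cobounds 0 M (\<lambda>\<tau>. c (simplex_map 0 j \<tau>))"
  shows "cobounds 0 Q c"
proof -
  have MM: "c \<sigma> = 0" if "simp_in 0 MM \<sigma>" for \<sigma>
    using cobounds singular_simplex_simplex_map [OF that continuous_jv] simplex_map_j_jv [OF that]
    by (fastforce simp: cobounds_0)
  have "c \<sigma> = 0" if "i \<in> I" "simp_in 0 (U i) \<sigma>" for i \<sigma>
  proof -
    have "c \<sigma> = c (sec 0 i False (proj 0 i \<sigma>))"
      using cobounds_collar_U [OF that(1) cocycle_subtopology [OF c], of False] that by (simp add: cobounds_0)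
    also have "\<dots> = 0"
      using MM simp_in_V(2) [OF that(1) sec_V [OF that(1) proj_N [OF that]]] by blast
    finally show ?thesis .
  qed
  then show ?thesis
    using MM by (intro open_cover.cobounds_0_if_small [OF open_cover]) (auto simp: cobounds_0)
qed

end

section \<open>Cohomology classes\<close>

definition cochain_hom :: "nat \<Rightarrow> 'a topology \<Rightarrow> 'a cochain \<Rightarrow> 'a chain \<Rightarrow> int" where
  "cochain_hom p X u = restrict (cochain_eval u) (singular_chain_set p X)"

lemma cochain_hom_carrier: "cochain_hom p X u \<in> carrier (cochain_group p X)"
  by (auto simp: cochain_hom_def hom_def singular_chain_add cochain_eval_add)

text \<open>The chain group is free on the simplices, so a homomorphism is determined by its values
  on generators.\<close>

lemma cochain_hom_surj:
  assumes "\<phi> \<in> carrier (cochain_group p X)"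
  shows "\<phi> = cochain_hom p X (\<lambda>\<sigma>. \<phi> (frag_of \<sigma>))"
proof
  fix c
  have add: "\<phi> (a + b) = \<phi> a + \<phi> b" if "singular_chain p X a" "singular_chain p X b" for a b
    using assms that by (simp add: hom_def)
  show "\<phi> c = cochain_hom p X (\<lambda>\<sigma>. \<phi> (frag_of \<sigma>)) c"
  proof (cases "singular_chain p X c")
    case True
    \<comment> \<open>Membership in the chain group is carried through the induction because \<phi>
      is additive only there.\<close>
    have "singular_chain p X c \<and> \<phi> c = cochain_eval (\<lambda>\<sigma>. \<phi> (frag_of \<sigma>)) c"
      using True unfolding singular_chain_def
    proof (induction c rule: frag_induction)
      case zero
      show ?case
        using add [of 0 0] by simp
    next
      case (diff a b)
      then have "singular_chain p X a" "singular_chain p X b"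
        by (auto simp: singular_chain_def)
      then have "singular_chain p X (a - b)" "\<phi> a = \<phi> (a - b) + \<phi> b"
        using singular_chain_diff add [of "a - b" b] by auto
      then show ?case
        using diff by (simp add: cochain_eval_diff singular_chain_def)
    qed auto
    then show ?thesis
      by (simp add: cochain_hom_def)
  next
    case False
    then show ?thesis
      using assms by (simp add: cochain_hom_def extensional_def)
  qed
qed

lemma cochain_hom_eq_iff:
  "cochain_hom p X u = cochain_hom p X v \<longleftrightarrow> (\<forall>\<sigma>. singular_simplex p X \<sigma> \<longrightarrow> u \<sigma> = v \<sigma>)"
proof
  assume eq: "cochain_hom p X u = cochain_hom p X v"
  show "\<forall>\<sigma>. singular_simplex p X \<sigma> \<longrightarrow> u \<sigma> = v \<sigma>"
  proof (intro allI impI)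
    fix \<sigma> assume "singular_simplex p X \<sigma>"
    then show "u \<sigma> = v \<sigma>"
      using fun_cong [OF eq, of "frag_of \<sigma>"] by (simp add: cochain_hom_def singular_chain_of)
  qed
next
  assume "\<forall>\<sigma>. singular_simplex p X \<sigma> \<longrightarrow> u \<sigma> = v \<sigma>"
  then show "cochain_hom p X u = cochain_hom p X v"
    using cochain_eval_cong [of p X _ u v] by (auto simp: cochain_hom_def fun_eq_iff)
qed

lemma cochain_hom_add:
  "cochain_hom p X u \<otimes>\<^bsub>cochain_group p X\<^esub> cochain_hom p X v = cochain_hom p X (\<lambda>\<sigma>. u \<sigma> + v \<sigma>)"
  by (auto simp: cochain_hom_def fun_eq_iff cochain_eval_plus_left)

lemma cochain_hom_zero: "cochain_hom p X (\<lambda>\<sigma>. 0) = \<one>\<^bsub>cochain_group p X\<^esub>"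
  by (auto simp: cochain_hom_def fun_eq_iff)

lemma coboundary_cochain_hom: "coboundary p X (cochain_hom p X u) = cochain_hom (Suc p) X (cob p u)"
  by (auto simp: coboundary_def cochain_hom_def fun_eq_iff cochain_eval_cob singular_chain_boundary_alt)

lemma cochain_map_cochain_hom:
  assumes "continuous_map X Y f"
  shows "cochain_map p X f (cochain_hom p Y u) = cochain_hom p X (\<lambda>\<tau>. u (simplex_map p f \<tau>))"
  using assms
  by (auto simp: cochain_map_def cochain_hom_def fun_eq_iff cochain_eval_chain_map
      singular_chain_chain_map)

lemma cochain_hom_cocycle_iff: "cochain_hom p X u \<in> cocycle_set p X \<longleftrightarrow> cocycle p X u"
  using cochain_hom_carrier [of p X u]
  unfolding cocycle_set_def kernel_def mem_Collect_eq coboundary_cochain_hom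
    cochain_hom_zero [symmetric] cochain_hom_eq_iff cocycle_def by blast

lemma cochain_hom_coboundary_iff: "cochain_hom p X u \<in> coboundary_set p X \<longleftrightarrow> cobounds p X u"
proof (cases p)
  case 0
  show ?thesis
    unfolding 0 coboundary_set_def nat.case singleton_iff cochain_hom_zero [symmetric]
      cochain_hom_eq_iff cobounds_0 ..
next
  case (Suc q)
  have "cochain_hom p X u \<in> coboundary_set p X \<longleftrightarrow>
      (\<exists>\<psi>\<in>carrier (cochain_group q X). cochain_hom p X u = coboundary q X \<psi>)"
    by (auto simp: coboundary_set_def Suc)
  also have "\<dots> \<longleftrightarrow> (\<exists>v. cochain_hom p X u = coboundary q X (cochain_hom q X v))"
    using cochain_hom_surj cochain_hom_carrier by metis
  also have "\<dots> \<longleftrightarrow> cobounds p X u"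
    unfolding coboundary_cochain_hom Suc cochain_hom_eq_iff cobounds_Suc ..
  finally show ?thesis .
qed

definition cohom_class :: "nat \<Rightarrow> 'a topology \<Rightarrow> 'a cochain \<Rightarrow> ('a chain \<Rightarrow> int) set" where
  "cohom_class p X u = coboundary_set p X #>\<^bsub>cochain_group p X\<^esub> cochain_hom p X u"

lemma carrier_cohomology_group_iff:
  "A \<in> carrier (cohomology_group (int p) X) \<longleftrightarrow> (\<exists>u. cocycle p X u \<and> A = cohom_class p X u)"
proof -
  have "A \<in> carrier (cohomology_group (int p) X) \<longleftrightarrow>
      (\<exists>\<phi>\<in>cocycle_set p X. A = coboundary_set p X #>\<^bsub>cochain_group p X\<^esub> \<phi>)"
    unfolding cohomology_group_def by (simp add: FactGroup_def RCOSETS_def r_coset_def)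
  also have "\<dots> \<longleftrightarrow> (\<exists>u. cocycle p X u \<and> A = cohom_class p X u)"
  proof
    assume "\<exists>\<phi>\<in>cocycle_set p X. A = coboundary_set p X #>\<^bsub>cochain_group p X\<^esub> \<phi>"
    then obtain \<phi> where \<phi>: "\<phi> \<in> cocycle_set p X" "A = coboundary_set p X #>\<^bsub>cochain_group p X\<^esub> \<phi>"
      by blast
    then have "\<phi> = cochain_hom p X (\<lambda>\<sigma>. \<phi> (frag_of \<sigma>))"
      by (intro cochain_hom_surj subgroup.mem_carrier [OF subgroup_cocycle_set])
    then show "\<exists>u. cocycle p X u \<and> A = cohom_class p X u"
      using \<phi> cochain_hom_cocycle_iff unfolding cohom_class_def by metis
  next
    assume "\<exists>u. cocycle p X u \<and> A = cohom_class p X u"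
    then show "\<exists>\<phi>\<in>cocycle_set p X. A = coboundary_set p X #>\<^bsub>cochain_group p X\<^esub> \<phi>"
      using cochain_hom_cocycle_iff unfolding cohom_class_def by blast
  qed
  finally show ?thesis .
qed

lemma cohom_class_carrier: "cocycle p X u \<Longrightarrow> cohom_class p X u \<in> carrier (cohomology_group (int p) X)"
  using carrier_cohomology_group_iff by blast

lemma cohom_class_add:
  assumes "cocycle p X u" "cocycle p X v"
  shows "cohom_class p X u \<otimes>\<^bsub>cohomology_group (int p) X\<^esub> cohom_class p X v =
    cohom_class p X (\<lambda>\<sigma>. u \<sigma> + v \<sigma>)"
proof -
  have n: "coboundary_set p X \<lhd> (cochain_group p X)\<lparr>carrier := cocycle_set p X\<rparr>"
    by (intro comm_group.subgroup_imp_normal comm_group_cocycle subgroup_coboundary_cocycle)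
  have r: "r_coset (cochain_group p X\<lparr>carrier := cocycle_set p X\<rparr>) = r_coset (cochain_group p X)"
    by (simp add: r_coset_def fun_eq_iff)
  show ?thesis
    using normal.rcos_sum [OF n, of "cochain_hom p X u" "cochain_hom p X v"] assms
    unfolding cohomology_group_def cohom_class_def cochain_hom_add [symmetric]
    by (simp add: FactGroup_def r cochain_hom_cocycle_iff del: cochain_group_simps)
qed

text \<open>The class is idempotent, and the only idempotent of a group is its unit.\<close>

lemma cohom_class_zero: "cohom_class p X (\<lambda>_. 0) = \<one>\<^bsub>cohomology_group (int p) X\<^esub>"
proof -
  interpret group "cohomology_group (int p) X"
    by simp
  have "cohom_class p X (\<lambda>_. 0) \<otimes>\<^bsub>cohomology_group (int p) X\<^esub> cohom_class p X (\<lambda>_. 0) =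
      cohom_class p X (\<lambda>_. 0)"
    by (simp add: cohom_class_add)
  then show ?thesis
    using cohom_class_carrier [of p X "\<lambda>_. 0"] by simp
qed

lemma cohom_class_minus:
  assumes "cocycle p X u"
  shows "inv\<^bsub>cohomology_group (int p) X\<^esub> cohom_class p X u = cohom_class p X (\<lambda>\<sigma>. - u \<sigma>)"
proof -
  interpret group "cohomology_group (int p) X"
    by simp
  show ?thesis
    using assms by (intro inv_equality)
      (simp_all add: cohom_class_add cocycle_minus cohom_class_carrier cohom_class_zero)
qed

lemma cohom_class_eq_one_iff:
  "cohom_class p X u = \<one>\<^bsub>cohomology_group (int p) X\<^esub> \<longleftrightarrow> cobounds p X u"
proof -
  interpret group "cochain_group p X"
    by (rule comm_group.axioms(2) [OF comm_group_cochain_group])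
  have "cohom_class p X u = \<one>\<^bsub>cohomology_group (int p) X\<^esub> \<longleftrightarrow>
      coboundary_set p X #>\<^bsub>cochain_group p X\<^esub> cochain_hom p X u = coboundary_set p X"
    unfolding cohomology_group_def cohom_class_def by (simp add: FactGroup_def)
  also have "\<dots> \<longleftrightarrow> cochain_hom p X u \<in> coboundary_set p X"
    using coset_join1 [of "coboundary_set p X" "cochain_hom p X u"]
      coset_join2 [of "cochain_hom p X u" "coboundary_set p X"]
      subgroup_coboundary_set [of p X] subgroup.subset [OF subgroup_coboundary_set [of p X]]
      cochain_hom_carrier [of p X u] by blast
  finally show ?thesis
    by (simp only: cochain_hom_coboundary_iff)
qed

lemma cohom_class_eq_iff:
  assumes u: "cocycle p X u" and v: "cocycle p X v"
  shows "cohom_class p X u = cohom_class p X v \<longleftrightarrow> cobounds p X (\<lambda>\<sigma>. u \<sigma> - v \<sigma>)"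
proof -
  interpret group "cohomology_group (int p) X"
    by simp
  have "cohom_class p X (\<lambda>\<sigma>. u \<sigma> - v \<sigma>) =
      cohom_class p X u \<otimes>\<^bsub>cohomology_group (int p) X\<^esub> inv\<^bsub>cohomology_group (int p) X\<^esub> cohom_class p X v"
    using cohom_class_add [OF u cocycle_minus [OF v]] by (simp add: cohom_class_minus v)
  moreover have "\<one>\<^bsub>cohomology_group (int p) X\<^esub> =
      cohom_class p X u \<otimes>\<^bsub>cohomology_group (int p) X\<^esub> inv\<^bsub>cohomology_group (int p) X\<^esub> cohom_class p X v
      \<longleftrightarrow> cohom_class p X u = cohom_class p X v"
    using inv_solve_right [OF one_closed cohom_class_carrier [OF u] cohom_class_carrier [OF v]]
    by (simp add: cohom_class_carrier v)
  ultimately show ?thesis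
    using cohom_class_eq_one_iff [of p X "\<lambda>\<sigma>. u \<sigma> - v \<sigma>"] by auto
qed

lemma cohom_induced_class:
  assumes f: "continuous_map X Y f" and u: "cocycle p Y u"
  shows "cohom_induced (int p) X f (cohom_class p Y u) =
    cohom_class p X (\<lambda>\<tau>. u (simplex_map p f \<tau>))"
  using cohom_induced_coset [OF f, of "cochain_hom p Y u" p] u
  by (simp only: cohom_class_def cochain_hom_cocycle_iff cochain_map_cochain_hom [OF f])

lemma group_hom_cohom_induced:
  assumes "continuous_map X Y f"
  shows "group_hom (cohomology_group k Y) (cohomology_group k X) (cohom_induced k X f)"
  using cohom_induced_hom [OF assms] by (simp add: group_hom_def group_hom_axioms_def)

lemma carrier_cohomology_group_neg: "k < 0 \<Longrightarrow> carrier (cohomology_group k X) = {\<one>\<^bsub>cohomology_group k X\<^esub>}"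
  by (simp add: cohomology_group_def singleton_group_def)

text \<open>Settles the negative degrees, where the middle group is trivial.\<close>

lemma exact_at_trivial:
  assumes f: "group_hom G H f" and g: "group_hom H K g" and H: "carrier H = {\<one>\<^bsub>H\<^esub>}"
  shows "exact_at G f H g K"
proof -
  have "kernel H K g = {\<one>\<^bsub>H\<^esub>}"
    using group_hom.hom_one [OF g] H by (auto simp: kernel_def)
  moreover have "f ` carrier G = {\<one>\<^bsub>H\<^esub>}"
    using group_hom.hom_closed [OF f] group_hom.hom_one [OF f] H
      monoid.one_closed [OF group.is_monoid [OF group_hom.axioms(1) [OF f]]] by force
  ultimately show ?thesis
    using f g by (simp add: exact_at_def)
qed

section \<open>The exact sequence of two-sided collars\<close>

context two_sided_collars
begin

definition coeff_group :: "int \<Rightarrow> ('i \<Rightarrow> ('c chain \<Rightarrow> int) set) monoid" where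
  "coeff_group k = product_group I (\<lambda>_. cohomology_group k N)"

definition cut_map :: "int \<Rightarrow> ('b chain \<Rightarrow> int) set \<Rightarrow> 'i \<Rightarrow> ('c chain \<Rightarrow> int) set" where
  "cut_map k A = (\<lambda>i\<in>I. cohom_induced k N (r i True) A
     \<otimes>\<^bsub>cohomology_group k N\<^esub> inv\<^bsub>cohomology_group k N\<^esub> cohom_induced k N (r i False) A)"

text \<open>The index \<open>k\<close> is the degree of the target, so the source has degree
  \<open>k - 1\<close>; for \<open>k = 0\<close> the source is therefore trivial and a constant map
  is the right one. The choice of \<open>c\<close> ranges over all representatives \<open>u\<close>
  of \<open>a\<close>; \<open>connecting_map_class\<close> shows that it does not matter.\<close>

definition connecting_map :: "int \<Rightarrow> ('i \<Rightarrow> ('c chain \<Rightarrow> int) set) \<Rightarrow> ('a chain \<Rightarrow> int) set" where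
  "connecting_map k a =
    (if k \<le> 0 then \<one>\<^bsub>cohomology_group k Q\<^esub>
     else cohom_class (nat k) Q (SOME c. \<exists>u. (\<forall>i\<in>I. cocycle (nat (k - 1)) N (u i) \<and>
       a i = cohom_class (nat (k - 1)) N (u i)) \<and> connects (nat (k - 1)) u c))"

lemma group_coeff_group [simp]: "group (coeff_group k)"
  by (simp add: coeff_group_def)

lemma cut_map_hom: "group_hom (cohomology_group k M) (coeff_group k) (cut_map k)"
proof (intro group_hom.intro group_hom_axioms.intro homI)
  let ?H = "cohomology_group k N"
  interpret N: comm_group ?H
    by (rule comm_group_cohomology_group)
  have hom: "cohom_induced k N (r i b) \<in> hom (cohomology_group k M) ?H" if "i \<in> I" for i b
    using r [OF that] by (rule cohom_induced_hom)
  fix A B assume A: "A \<in> carrier (cohomology_group k M)"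
  have carr: "cohom_induced k N (r i b) A \<in> carrier ?H" if "i \<in> I" for i b
    using hom [OF that] A by (rule hom_in_carrier)
  then show "cut_map k A \<in> carrier (coeff_group k)"
    by (auto simp: coeff_group_def cut_map_def)
  assume B: "B \<in> carrier (cohomology_group k M)"
  have carrB: "cohom_induced k N (r i b) B \<in> carrier ?H" if "i \<in> I" for i b
    using hom [OF that] B by (rule hom_in_carrier)
  have mult: "cohom_induced k N (r i b) (A \<otimes>\<^bsub>cohomology_group k M\<^esub> B) =
      cohom_induced k N (r i b) A \<otimes>\<^bsub>?H\<^esub> cohom_induced k N (r i b) B" if "i \<in> I" for i b
    using hom [OF that] A B by (rule hom_mult)
  have "a \<otimes>\<^bsub>?H\<^esub> b \<otimes>\<^bsub>?H\<^esub> inv\<^bsub>?H\<^esub> (c \<otimes>\<^bsub>?H\<^esub> d) = (a \<otimes>\<^bsub>?H\<^esub> inv\<^bsub>?H\<^esub> c) \<otimes>\<^bsub>?H\<^esub> (b \<otimes>\<^bsub>?H\<^esub> inv\<^bsub>?H\<^esub> d)"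
    if "a \<in> carrier ?H" "b \<in> carrier ?H" "c \<in> carrier ?H" "d \<in> carrier ?H" for a b c d
    using that by (simp add: N.inv_mult N.m_ac)
  then show "cut_map k (A \<otimes>\<^bsub>cohomology_group k M\<^esub> B) = cut_map k A \<otimes>\<^bsub>coeff_group k\<^esub> cut_map k B"
    using carr carrB by (auto simp: cut_map_def coeff_group_def mult fun_eq_iff)
qed simp_all

lemma cocycle_jump: "cocycle q M \<alpha> \<Longrightarrow> i \<in> I \<Longrightarrow> cocycle q N (jump q \<alpha> i)"
  unfolding jump_def by (intro cocycle_diff cocycle_pullback [OF r])

lemma cut_map_class:
  assumes \<alpha>: "cocycle q M \<alpha>"
  shows "cut_map (int q) (cohom_class q M \<alpha>) = (\<lambda>i\<in>I. cohom_class q N (jump q \<alpha> i))"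
  unfolding cut_map_def
proof (rule restrict_ext)
  fix i assume i: "i \<in> I"
  have c: "cocycle q N (\<lambda>\<tau>. \<alpha> (simplex_map q (r i b) \<tau>))" for b
    using r [OF i] \<alpha> by (rule cocycle_pullback)
  show "cohom_induced (int q) N (r i True) (cohom_class q M \<alpha>) \<otimes>\<^bsub>cohomology_group (int q) N\<^esub>
      inv\<^bsub>cohomology_group (int q) N\<^esub> cohom_induced (int q) N (r i False) (cohom_class q M \<alpha>) =
      cohom_class q N (jump q \<alpha> i)"
    using cohom_class_add [OF c cocycle_minus [OF c]]
    by (simp add: cohom_induced_class [OF r [OF i] \<alpha>] cohom_class_minus c jump_def)
qed

lemma carrier_coeff_group_iff:
  "a \<in> carrier (coeff_group (int q)) \<longleftrightarrow>
    (\<exists>u. (\<forall>i\<in>I. cocycle q N (u i)) \<and> a = (\<lambda>i\<in>I. cohom_class q N (u i)))"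
proof
  assume a: "a \<in> carrier (coeff_group (int q))"
  then have "\<forall>i\<in>I. \<exists>u. cocycle q N u \<and> a i = cohom_class q N u"
    by (auto simp: coeff_group_def PiE_iff carrier_cohomology_group_iff)
  then obtain u where u: "\<And>i. i \<in> I \<Longrightarrow> cocycle q N (u i) \<and> a i = cohom_class q N (u i)"
    by metis
  then have "a = (\<lambda>i\<in>I. cohom_class q N (u i))"
    using a by (auto simp: coeff_group_def PiE_iff extensional_def fun_eq_iff)
  then show "\<exists>u. (\<forall>i\<in>I. cocycle q N (u i)) \<and> a = (\<lambda>i\<in>I. cohom_class q N (u i))"
    using u by blast
qed (auto simp: coeff_group_def cohom_class_carrier)

lemma connects_diff:
  assumes "connects q u c" "connects q u' c'"
  shows "connects q (\<lambda>i \<tau>. u i \<tau> - u' i \<tau>) (\<lambda>\<sigma>. c \<sigma> - c' \<sigma>)"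
  using connects_add [OF assms(1) connects_minus [OF assms(2)]] by simp

text \<open>Two choices differ by a cochain connected to the difference of cohomologous families,
  which is a coboundary by \<open>connects_cobounds\<close>.\<close>

lemma connecting_map_class:
  assumes u: "\<And>i. i \<in> I \<Longrightarrow> cocycle q N (u i)" and c: "connects q u c"
  shows "connecting_map (int (Suc q)) (\<lambda>i\<in>I. cohom_class q N (u i)) = cohom_class (Suc q) Q c"
proof -
  let ?P = "\<lambda>c. \<exists>u'. (\<forall>i\<in>I. cocycle q N (u' i) \<and> cohom_class q N (u i) = cohom_class q N (u' i)) \<and>
    connects q u' c"
  have "?P c"
    using u c by blast
  then have "?P (Eps ?P)"
    by (rule someI [of ?P])
  then obtain u' where u': "\<And>i. i \<in> I \<Longrightarrow> cocycle q N (u' i)"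
    "\<And>i. i \<in> I \<Longrightarrow> cohom_class q N (u i) = cohom_class q N (u' i)" "connects q u' (Eps ?P)"
    by blast
  have "cobounds q N (\<lambda>\<tau>. u' i \<tau> - u i \<tau>)" if "i \<in> I" for i
    using cohom_class_eq_iff [OF u' (1) u, OF that that] u'(2) [OF that] by simp
  then have "cobounds (Suc q) Q (\<lambda>\<sigma>. Eps ?P \<sigma> - c \<sigma>)"
    by (rule connects_cobounds [OF connects_diff [OF u'(3) c]])
  then have "cohom_class (Suc q) Q (Eps ?P) = cohom_class (Suc q) Q c"
    by (simp add: cohom_class_eq_iff connects_cocycle [OF c] connects_cocycle [OF u'(3)])
  moreover have "connecting_map (int (Suc q)) (\<lambda>i\<in>I. cohom_class q N (u i)) =
      cohom_class (Suc q) Q (Eps ?P)"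
    by (simp add: connecting_map_def nat_add_distrib cong: conj_cong)
  ultimately show ?thesis
    by simp
qed

lemma connecting_map_hom: "group_hom (coeff_group (k - 1)) (cohomology_group k Q) (connecting_map k)"
proof (cases "k \<le> 0")
  case True
  interpret group "cohomology_group k Q"
    by simp
  show ?thesis
    using True by (intro group_hom.intro group_hom_axioms.intro homI) (simp_all add: connecting_map_def)
next
  case False
  define q where "q = nat (k - 1)"
  have k: "k = int (Suc q)" "k - 1 = int q"
    using False by (auto simp: q_def)
  show ?thesis
    unfolding k(2)
    unfolding k(1)
  proof (intro group_hom.intro group_hom_axioms.intro homI)
    fix a b assume "a \<in> carrier (coeff_group (int q))"
    then obtain u where u: "\<And>i. i \<in> I \<Longrightarrow> cocycle q N (u i)" and a: "a = (\<lambda>i\<in>I. cohom_class q N (u i))"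
      by (auto simp: carrier_coeff_group_iff)
    obtain c where c: "connects q u c"
      using connects_ex u by blast
    have ca: "connecting_map (int (Suc q)) a = cohom_class (Suc q) Q c"
      unfolding a by (rule connecting_map_class [OF u c])
    show "connecting_map (int (Suc q)) a \<in> carrier (cohomology_group (int (Suc q)) Q)"
      unfolding ca by (rule cohom_class_carrier [OF connects_cocycle [OF c]])
    assume "b \<in> carrier (coeff_group (int q))"
    then obtain v where v: "\<And>i. i \<in> I \<Longrightarrow> cocycle q N (v i)" and b: "b = (\<lambda>i\<in>I. cohom_class q N (v i))"
      by (auto simp: carrier_coeff_group_iff)
    obtain d where d: "connects q v d"
      using connects_ex v by blast
    have ab: "a \<otimes>\<^bsub>coeff_group (int q)\<^esub> b = (\<lambda>i\<in>I. cohom_class q N (\<lambda>\<tau>. u i \<tau> + v i \<tau>))"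
      unfolding a b coeff_group_def using u v by (auto simp: cohom_class_add fun_eq_iff)
    have cb: "connecting_map (int (Suc q)) b = cohom_class (Suc q) Q d"
      unfolding b by (rule connecting_map_class [OF v d])
    have cab: "connecting_map (int (Suc q)) (a \<otimes>\<^bsub>coeff_group (int q)\<^esub> b) =
        cohom_class (Suc q) Q (\<lambda>\<sigma>. c \<sigma> + d \<sigma>)"
      unfolding ab by (rule connecting_map_class [OF cocycle_add [OF u v] connects_add [OF c d]])
    show "connecting_map (int (Suc q)) (a \<otimes>\<^bsub>coeff_group (int q)\<^esub> b) =
        connecting_map (int (Suc q)) a \<otimes>\<^bsub>cohomology_group (int (Suc q)) Q\<^esub> connecting_map (int (Suc q)) b"
      unfolding ca cb cab
      by (rule cohom_class_add [OF connects_cocycle [OF c] connects_cocycle [OF d], symmetric])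
  qed simp_all
qed

lemma carrier_coeff_group_neg:
  assumes "k < 0"
  shows "carrier (coeff_group k) = {\<one>\<^bsub>coeff_group k\<^esub>}"
  by (simp add: coeff_group_def carrier_cohomology_group_neg [OF assms])

lemma continuous_inclusion: "continuous_map M Q j"
  using continuous_j by (rule continuous_map_into_fulltopology)

lemma restrict_hom: "group_hom (cohomology_group k Q) (cohomology_group k M) (cohom_induced k M j)"
  by (rule group_hom_cohom_induced [OF continuous_inclusion])

section \<open>Exactness of the sequence of cohomology groups\<close>

lemma exact_at_Q:
  "exact_at (coeff_group (k - 1)) (connecting_map k) (cohomology_group k Q)
     (cohom_induced k M j) (cohomology_group k M)"
proof -
  let ?i = "cohom_induced k M j" and ?Q = "cohomology_group k Q" and ?M = "cohomology_group k M"
  consider "k < 0" | "k = 0" | "k > 0"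
    by linarith
  then show ?thesis
  proof cases
    case 1
    then show ?thesis
      by (intro exact_at_trivial connecting_map_hom restrict_hom carrier_cohomology_group_neg)
  next
    \<comment> \<open>In degree 0 the incoming map is trivial, so exactness says that restriction is
      injective.\<close>
    case 2
    have "kernel ?Q ?M ?i = {\<one>\<^bsub>?Q\<^esub>}"
    proof
      show "{\<one>\<^bsub>?Q\<^esub>} \<subseteq> kernel ?Q ?M ?i"
        using group_hom.hom_one [OF restrict_hom]
          monoid.one_closed [OF group.is_monoid [OF group_cohomology_group]]
        by (simp add: kernel_def)
      show "kernel ?Q ?M ?i \<subseteq> {\<one>\<^bsub>?Q\<^esub>}"
      proof
        fix A assume "A \<in> kernel ?Q ?M ?i"
        then have A: "A \<in> carrier (cohomology_group (int 0) Q)"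
          "cohom_induced (int 0) M j A = \<one>\<^bsub>cohomology_group (int 0) M\<^esub>"
          by (auto simp: kernel_def 2)
        then obtain c where c: "cocycle 0 Q c" "A = cohom_class 0 Q c"
          by (auto simp only: carrier_cohomology_group_iff)
        then have "cobounds 0 Q c"
          using A(2) unfolding c(2) cohom_induced_class [OF continuous_inclusion c(1)]
            cohom_class_eq_one_iff by (intro restrict_injective_0)
        then show "A \<in> {\<one>\<^bsub>?Q\<^esub>}"
          unfolding c(2) 2 using cohom_class_eq_one_iff [of 0 Q c] by simp
      qed
    qed
    moreover have "connecting_map k ` carrier (coeff_group (k - 1)) = {\<one>\<^bsub>?Q\<^esub>}"
      using group.is_monoid [OF group_coeff_group [of "k - 1"]] monoid.one_closed
      by (force simp: connecting_map_def 2)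
    ultimately show ?thesis
      using connecting_map_hom restrict_hom by (simp add: exact_at_def)
  next
    case pos: 3
    define q where "q = nat (k - 1)"
    have 3: "k = int (Suc q)" "k - 1 = int q"
      using pos by (auto simp: q_def)
    have "kernel ?Q ?M ?i = connecting_map k ` carrier (coeff_group (k - 1))"
    proof
      show "kernel ?Q ?M ?i \<subseteq> connecting_map k ` carrier (coeff_group (k - 1))"
      proof
        fix A assume "A \<in> kernel ?Q ?M ?i"
        then have A: "A \<in> carrier (cohomology_group (int (Suc q)) Q)"
          "cohom_induced (int (Suc q)) M j A = \<one>\<^bsub>cohomology_group (int (Suc q)) M\<^esub>"
          by (auto simp: kernel_def 3(1))
        then obtain c where c: "cocycle (Suc q) Q c" "A = cohom_class (Suc q) Q c"
          by (auto simp only: carrier_cohomology_group_iff)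
        then have "cobounds (Suc q) M (\<lambda>\<tau>. c (simplex_map (Suc q) j \<tau>))"
          using A(2) unfolding c(2) cohom_induced_class [OF continuous_inclusion c(1)]
            cohom_class_eq_one_iff by simp
        then obtain u where u: "\<And>i. i \<in> I \<Longrightarrow> cocycle q N (u i)" "connects q u c"
          using connects_if_restrict_cobounds [OF c(1)] by blast
        have "A = connecting_map k (\<lambda>i\<in>I. cohom_class q N (u i))"
          unfolding c(2) 3(1) by (rule connecting_map_class [OF u, symmetric])
        moreover have "(\<lambda>i\<in>I. cohom_class q N (u i)) \<in> carrier (coeff_group (k - 1))"
          unfolding 3(2) carrier_coeff_group_iff using u by blast
        ultimately show "A \<in> connecting_map k ` carrier (coeff_group (k - 1))"
          by blast
      qed
      show "connecting_map k ` carrier (coeff_group (k - 1)) \<subseteq> kernel ?Q ?M ?i"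
      proof clarify
        fix a assume "a \<in> carrier (coeff_group (k - 1))"
        then obtain u where u: "\<And>i. i \<in> I \<Longrightarrow> cocycle q N (u i)" and a: "a = (\<lambda>i\<in>I. cohom_class q N (u i))"
          by (auto simp: carrier_coeff_group_iff 3(2))
        obtain c where c: "connects q u c"
          using connects_ex u by blast
        have A: "connecting_map k a = cohom_class (Suc q) Q c"
          unfolding a 3(1) by (rule connecting_map_class [OF u c])
        show "connecting_map k a \<in> kernel ?Q ?M ?i"
          unfolding kernel_def mem_Collect_eq A
          unfolding 3(1) cohom_induced_class [OF continuous_inclusion connects_cocycle [OF c]] cohom_class_eq_one_iff
          using cohom_class_carrier [OF connects_cocycle [OF c]] restrict_connects [OF c] by blast
      qed
    qed
    then show ?thesis
      using connecting_map_hom restrict_hom by (simp add: exact_at_def)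
  qed
qed

lemma exact_at_M:
  "exact_at (cohomology_group k Q) (cohom_induced k M j) (cohomology_group k M)
     (cut_map k) (coeff_group k)"
proof (cases "k < 0")
  case True
  then show ?thesis
    by (intro exact_at_trivial cut_map_hom restrict_hom carrier_cohomology_group_neg)
next
  case False
  then obtain q where k: "k = int q"
    using nonneg_int_cases by (metis linorder_not_less)
  have one: "cut_map k (cohom_class q M \<alpha>) = \<one>\<^bsub>coeff_group k\<^esub> \<longleftrightarrow> (\<forall>i\<in>I. cobounds q N (jump q \<alpha> i))"
    if "cocycle q M \<alpha>" for \<alpha>
    unfolding k cut_map_class [OF that] coeff_group_def one_product_group
      cohom_class_eq_one_iff [symmetric] by (auto simp: fun_eq_iff)
  have "kernel (cohomology_group k M) (coeff_group k) (cut_map k) =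
      cohom_induced k M j ` carrier (cohomology_group k Q)"
  proof
    show "kernel (cohomology_group k M) (coeff_group k) (cut_map k) \<subseteq>
        cohom_induced k M j ` carrier (cohomology_group k Q)"
    proof
      fix A assume "A \<in> kernel (cohomology_group k M) (coeff_group k) (cut_map k)"
      then obtain \<alpha> where \<alpha>: "cocycle q M \<alpha>" "A = cohom_class q M \<alpha>"
        and "cut_map k A = \<one>\<^bsub>coeff_group k\<^esub>"
        by (auto simp: kernel_def k carrier_cohomology_group_iff)
      then have "cobounds q N (jump q \<alpha> i)" if "i \<in> I" for i
        using one that by blast
      then obtain c where c: "cocycle q Q c" "\<And>\<tau>. singular_simplex q M \<tau> \<Longrightarrow> c (simplex_map q j \<tau>) = \<alpha> \<tau>"
        using restrict_if_jump_cobounds [OF \<alpha>(1)] by blast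
      have "cohom_induced k M j (cohom_class q Q c) = cohom_class q M (\<lambda>\<tau>. c (simplex_map q j \<tau>))"
        unfolding k by (rule cohom_induced_class [OF continuous_inclusion c(1)])
      moreover have "cochain_hom q M (\<lambda>\<tau>. c (simplex_map q j \<tau>)) = cochain_hom q M \<alpha>"
        unfolding cochain_hom_eq_iff using c(2) by blast
      then have "cohom_class q M (\<lambda>\<tau>. c (simplex_map q j \<tau>)) = A"
        by (simp only: cohom_class_def \<alpha>(2))
      ultimately have "cohom_induced k M j (cohom_class q Q c) = A"
        by simp
      then show "A \<in> cohom_induced k M j ` carrier (cohomology_group k Q)"
        using cohom_class_carrier [OF c(1)] unfolding k by blast
    qed
    show "cohom_induced k M j ` carrier (cohomology_group k Q) \<subseteq>
        kernel (cohomology_group k M) (coeff_group k) (cut_map k)"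
    proof clarify
      fix A assume "A \<in> carrier (cohomology_group k Q)"
      then obtain c where c: "cocycle q Q c" "A = cohom_class q Q c"
        by (auto simp: k carrier_cohomology_group_iff)
      have A: "cohom_induced k M j A = cohom_class q M (\<lambda>\<tau>. c (simplex_map q j \<tau>))"
        unfolding k c(2) by (rule cohom_induced_class [OF continuous_inclusion c(1)])
      have j: "cocycle q M (\<lambda>\<tau>. c (simplex_map q j \<tau>))"
        using continuous_inclusion c(1) by (rule cocycle_pullback)
      show "cohom_induced k M j A \<in> kernel (cohomology_group k M) (coeff_group k) (cut_map k)"
        unfolding A kernel_def mem_Collect_eq one [OF j]
        using cohom_class_carrier [OF j] jump_restrict [OF c(1)] by (simp add: k)
    qed
  qed
  then show ?thesis
    using cut_map_hom restrict_hom by (simp add: exact_at_def)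
qed

lemma exact_at_coeff_group:
  "exact_at (cohomology_group k M) (cut_map k) (coeff_group k)
     (connecting_map (k + 1)) (cohomology_group (k + 1) Q)"
proof -
  have hom: "group_hom (coeff_group k) (cohomology_group (k + 1) Q) (connecting_map (k + 1))"
    using connecting_map_hom [of "k + 1"] by simp
  show ?thesis
  proof (cases "k < 0")
    case True
    then show ?thesis
      by (intro exact_at_trivial cut_map_hom hom carrier_coeff_group_neg)
  next
    case False
    then obtain q where k: "k = int q"
      using nonneg_int_cases by (metis linorder_not_less)
    have k1: "k + 1 = int (Suc q)"
      by (simp add: k)
    have "kernel (coeff_group k) (cohomology_group (k + 1) Q) (connecting_map (k + 1)) =
        cut_map k ` carrier (cohomology_group k M)"
    proof
      show "kernel (coeff_group k) (cohomology_group (k + 1) Q) (connecting_map (k + 1)) \<subseteq>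
          cut_map k ` carrier (cohomology_group k M)"
      proof
        fix a assume a: "a \<in> kernel (coeff_group k) (cohomology_group (k + 1) Q) (connecting_map (k + 1))"
        then obtain u where u: "\<And>i. i \<in> I \<Longrightarrow> cocycle q N (u i)" and a_u: "a = (\<lambda>i\<in>I. cohom_class q N (u i))"
          by (auto simp: kernel_def k carrier_coeff_group_iff)
        obtain c where c: "connects q u c"
          using connects_ex u by blast
        have "connecting_map (k + 1) a = cohom_class (Suc q) Q c"
          unfolding a_u k1 by (rule connecting_map_class [OF u c])
        then have "cobounds (Suc q) Q c"
          using a unfolding kernel_def k1 cohom_class_eq_one_iff [symmetric] by simp
        then obtain \<alpha> where \<alpha>: "cocycle q M \<alpha>" "\<And>i. i \<in> I \<Longrightarrow> cobounds q N (\<lambda>\<tau>. jump q \<alpha> i \<tau> - u i \<tau>)"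
          using jump_if_connects_cobounds [OF u c] by blast
        have "a = cut_map k (cohom_class q M \<alpha>)"
          unfolding k cut_map_class [OF \<alpha>(1)] a_u
          using cohom_class_eq_iff [OF cocycle_jump [OF \<alpha>(1)] u] \<alpha>(2) by (auto simp: fun_eq_iff)
        then show "a \<in> cut_map k ` carrier (cohomology_group k M)"
          using cohom_class_carrier [OF \<alpha>(1)] unfolding k by blast
      qed
      show "cut_map k ` carrier (cohomology_group k M) \<subseteq>
          kernel (coeff_group k) (cohomology_group (k + 1) Q) (connecting_map (k + 1))"
      proof clarify
        fix A assume A: "A \<in> carrier (cohomology_group k M)"
        then obtain \<alpha> where \<alpha>: "cocycle q M \<alpha>" "A = cohom_class q M \<alpha>"
          by (auto simp: k carrier_cohomology_group_iff)
        have "connecting_map (k + 1) (cut_map k A) = cohom_class (Suc q) Q (\<lambda>_. 0)"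
          unfolding k1 unfolding k \<alpha>(2) cut_map_class [OF \<alpha>(1)]
          by (rule connecting_map_class [OF cocycle_jump [OF \<alpha>(1)] jump_connects [OF \<alpha>(1)]])
        moreover have "cut_map k A \<in> carrier (coeff_group k)"
          using group_hom.hom_closed [OF cut_map_hom A] .
        ultimately show "cut_map k A \<in> kernel (coeff_group k) (cohomology_group (k + 1) Q) (connecting_map (k + 1))"
          unfolding kernel_def k1 by (simp only: mem_Collect_eq cohom_class_zero)
      qed
    qed
    then show ?thesis
      using cut_map_hom hom by (simp add: exact_at_def)
  qed
qed

end

section \<open>The circle as a one-point compactification\<close>

locale punctured_circle =
  fixes w :: complex and h :: "real \<Rightarrow> complex"
  assumes w: "w \<in> circle"
    and h: "homeomorphic_map euclideanreal (top_of_set (circle - {w})) h"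
begin

definition coord :: "complex \<Rightarrow> real" where
  "coord = inv_into UNIV h"

text \<open>\<open>wrap\<close> maps \<open>[-1,1]\<close> onto the circle, taking \<open>0\<close> to the point at infinity \<open>w\<close> and
  identifying both end points with \<open>h 0\<close>; \<open>arc\<close> is its inverse, and \<open>gap\<close> measures the distance to \<open>w\<close>.\<close>

definition wrap :: "real \<Rightarrow> complex" where
  "wrap y = (if y = 0 then w else h (sgn y * (1 / \<bar>y\<bar> - 1)))"

definition gap :: "complex \<Rightarrow> real" where
  "gap z = (if z = w then 0 else 1 / (1 + \<bar>coord z\<bar>))"

definition arc :: "complex \<Rightarrow> real" where
  "arc z = (if z = w then 0 else (if coord z \<ge> 0 then gap z else - gap z))"

lemma inj_h: "inj h"
  using homeomorphic_imp_injective_map [OF h] by simp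

lemma range_h: "range h = circle - {w}"
  using homeomorphic_imp_surjective_map [OF h] by simp

lemma h_circle: "h t \<in> circle" and h_neq_w: "h t \<noteq> w"
  using range_h by blast+

lemma coord_h [simp]: "coord (h t) = t"
  using inj_h by (simp add: coord_def)

lemma h_coord: "z \<in> circle \<Longrightarrow> z \<noteq> w \<Longrightarrow> h (coord z) = z"
  using range_h f_inv_into_f [of z h UNIV] by (simp add: coord_def)

lemma homeomorphic_maps_h: "homeomorphic_maps euclideanreal (top_of_set (circle - {w})) h (coord)"
proof -
  obtain g where g: "homeomorphic_maps euclideanreal (top_of_set (circle - {w})) h g"
    using h homeomorphic_map_maps by blast
  then have "g z = coord z" if "z \<in> circle - {w}" for z
    using that h_coord [of z] unfolding homeomorphic_maps_def by (metis UNIV_I DiffD1 DiffD2 singletonI topspace_euclidean)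
  then show ?thesis
    using homeomorphic_maps_eq [OF g, of h coord] by auto
qed

lemma continuous_on_h: "continuous_on UNIV h"
  using homeomorphic_maps_h by (auto simp: homeomorphic_maps_def continuous_map_in_subtopology)

lemma continuous_on_coord: "continuous_on (circle - {w}) (coord)"
  using homeomorphic_maps_h by (auto simp: homeomorphic_maps_def)

lemma gap_h: "gap (h t) = 1 / (1 + \<bar>t\<bar>)"
  by (simp add: gap_def h_neq_w)

lemma arc_h: "arc (h t) = (if t \<ge> 0 then 1 else - 1) / (1 + \<bar>t\<bar>)"
  by (simp add: arc_def gap_h h_neq_w)

lemma gap_w [simp]: "gap w = 0" and arc_w [simp]: "arc w = 0" and wrap_0 [simp]: "wrap 0 = w"
  by (simp_all add: gap_def arc_def wrap_def)

lemma gap_nonneg: "0 \<le> gap z"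
  by (simp add: gap_def)

lemma gap_le_1: "gap z \<le> 1"
  by (simp add: gap_def)

lemma gap_pos: "z \<noteq> w \<Longrightarrow> 0 < gap z"
  by (simp add: gap_def add_pos_nonneg)

lemma abs_arc: "\<bar>arc z\<bar> = gap z"
  using gap_nonneg [of z] by (simp add: arc_def)

lemma arc_eq_0_iff: "arc z = 0 \<longleftrightarrow> z = w"
  using abs_arc [of z] gap_pos [of z] by fastforce

lemma wrap_eq_h: "y \<noteq> 0 \<Longrightarrow> wrap y = h (sgn y * (1 / \<bar>y\<bar> - 1))"
  by (simp add: wrap_def)

lemma wrap_circle: "wrap y \<in> circle"
  using w h_circle by (simp add: wrap_def)

lemma wrap_arc: "z \<in> circle \<Longrightarrow> wrap (arc z) = z"
proof (cases "z = w")
  case False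
  assume "z \<in> circle"
  then obtain t where z: "z = h t"
    using False range_h by (metis DiffI rangeE singletonD)
  have "0 < 1 + \<bar>t\<bar>"
    by simp
  then have "arc z \<noteq> 0" "sgn (arc z) = (if t \<ge> 0 then 1 else -1)" "\<bar>arc z\<bar> = 1 / (1 + \<bar>t\<bar>)"
    by (auto simp: z arc_h sgn_divide)
  then show ?thesis
    by (simp add: wrap_eq_h z)
qed simp

lemma gap_wrap: "\<bar>y\<bar> \<le> 1 \<Longrightarrow> gap (wrap y) = \<bar>y\<bar>"
proof (cases "y = 0")
  case False
  assume "\<bar>y\<bar> \<le> 1"
  then have "\<bar>sgn y * (1 / \<bar>y\<bar> - 1)\<bar> = 1 / \<bar>y\<bar> - 1"
    using False by (simp add: abs_mult abs_sgn_eq)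
  then show ?thesis
    using False by (simp add: wrap_eq_h gap_h)
qed simp

lemma arc_wrap: "\<bar>y\<bar> < 1 \<Longrightarrow> arc (wrap y) = y"
proof (cases "y = 0")
  case False
  assume y: "\<bar>y\<bar> < 1"
  then have pos: "1 / \<bar>y\<bar> - 1 > 0"
    using False by simp
  then have "sgn y * (1 / \<bar>y\<bar> - 1) \<ge> 0 \<longleftrightarrow> y > 0"
    using False by (auto simp: zero_le_mult_iff sgn_if)
  moreover have "gap (wrap y) = \<bar>y\<bar>"
    using y by (simp add: gap_wrap)
  moreover have "coord (wrap y) = sgn y * (1 / \<bar>y\<bar> - 1)" "wrap y \<noteq> w"
    using False by (simp_all add: wrap_eq_h h_neq_w)
  ultimately show ?thesis
    by (simp only: arc_def if_False) auto
qed simp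

lemma wrap_ends: "\<bar>y\<bar> = 1 \<Longrightarrow> wrap y = h 0"
  by (auto simp: wrap_def)

text \<open>Away from 0 the map is a composite of continuous ones. At 0, continuity is the statement
  that \<open>h\<close> tends to \<open>w\<close> at both ends of the line: off a neighbourhood of
  \<open>w\<close> the circle is compact, so the coordinate is bounded there.\<close>

lemma continuous_on_wrap: "continuous_on {-1..1} wrap"
  unfolding continuous_on_eq_continuous_within
proof
  fix y :: real assume "y \<in> {-1..1}"
  have "isCont wrap y"
  proof (cases "y = 0")
    case False
    have ch: "isCont h t" for t
      using continuous_on_h by (auto simp: continuous_on_eq_continuous_at)
    have cs: "isCont (\<lambda>y. sgn y * (1 / \<bar>y\<bar> - 1)) y"
      unfolding isCont_def using False
      by (intro tendsto_mult tendsto_sgn tendsto_diff tendsto_divide tendsto_const tendsto_rabs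
          tendsto_ident_at) simp_all
    have "isCont (\<lambda>y. h (sgn y * (1 / \<bar>y\<bar> - 1))) y"
      by (rule isCont_o2 [OF cs ch])
    moreover have "eventually (\<lambda>y. wrap y = h (sgn y * (1 / \<bar>y\<bar> - 1))) (nhds y)"
      by (rule eventually_mono [OF eventually_nhds_in_open [of "- {0}"]])
        (use False in \<open>auto simp: wrap_eq_h\<close>)
    ultimately show ?thesis
      using isCont_cong [of wrap "\<lambda>y. h (sgn y * (1 / \<bar>y\<bar> - 1))" y] by blast
  next
    case True
    have "(wrap \<longlongrightarrow> w) (at 0)"
    proof (rule topological_tendstoI)
      fix V assume V: "open V" "w \<in> V"
      have "compact (circle - V)"
        using V by (intro compact_diff) auto
      moreover have "continuous_on (circle - V) coord"
        by (rule continuous_on_subset [OF continuous_on_coord]) (use V in auto)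
      ultimately have "bounded (coord ` (circle - V))"
        by (intro compact_imp_bounded compact_continuous_image)
      then obtain B where B: "\<And>z. z \<in> circle - V \<Longrightarrow> \<bar>coord z\<bar> \<le> B" "B > 0"
        unfolding bounded_pos by fastforce
      \<comment> \<open>The coordinate of \<open>wrap x\<close> has absolute value
        \<open>1 / \<bar>x\<bar> - 1\<close>, which exceeds \<open>B\<close> as soon as
        \<open>\<bar>x\<bar> < 1 / (B + 1)\<close>.\<close>
      have "wrap x \<in> V" if x: "x \<noteq> 0" "dist x 0 < 1 / (B + 1)" for x
      proof (rule ccontr)
        assume "wrap x \<notin> V"
        then have "\<bar>sgn x * (1 / \<bar>x\<bar> - 1)\<bar> \<le> B"
          using B(1) [of "wrap x"] wrap_circle [of x] x(1) by (simp add: wrap_eq_h)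
        then have "1 / \<bar>x\<bar> \<le> B + 1"
          using x by (simp add: abs_mult abs_sgn_eq)
        then show False
          using x B(2) by (simp add: field_simps)
      qed
      then show "\<forall>\<^sub>F x in at 0. wrap x \<in> V"
        using B(2) unfolding eventually_at by (intro exI [of _ "1 / (B + 1)"]) auto
    qed
    then show ?thesis
      by (simp add: True isCont_def)
  qed
  then show "continuous (at y within {-1..1}) wrap"
    by (rule continuous_at_imp_continuous_within)
qed

text \<open>Continuity of the inverses comes from compactness: \<open>wrap\<close> takes closed sets to closed sets.\<close>

lemma closed_wrap_image:
  assumes "closed C"
  shows "closed (wrap ` ({-1..1} \<inter> C))"
proof -
  have "continuous_on ({-1..1} \<inter> C) wrap"
    by (rule continuous_on_subset [OF continuous_on_wrap]) simp
  moreover have "compact ({-1..1} \<inter> C)"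
    using assms by (intro compact_Int_closed) simp_all
  ultimately show ?thesis
    by (intro compact_imp_closed compact_continuous_image)
qed

text \<open>This includes the point \<open>h 0\<close>, where \<open>arc\<close> jumps:
  \<open>gap\<close> is the absolute value of \<open>arc\<close>, and both ends 1 and -1 give
  1.\<close>

lemma continuous_on_gap: "continuous_on circle gap"
  unfolding continuous_on_closed_vimage [OF closed_sphere]
proof (intro allI impI)
  fix B :: "real set" assume "closed B"
  then have "closed (abs -` B :: real set)"
    by (intro closed_vimage continuous_intros)
  moreover have "gap -` B \<inter> circle = wrap ` ({-1..1} \<inter> abs -` B)"
  proof
    show "gap -` B \<inter> circle \<subseteq> wrap ` ({-1..1} \<inter> abs -` B)"
    proof
      fix z assume z: "z \<in> gap -` B \<inter> circle"
      then have "z = wrap (arc z)" "arc z \<in> {-1..1} \<inter> abs -` B"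
        using wrap_arc abs_arc [of z] gap_le_1 [of z] by auto
      then show "z \<in> wrap ` ({-1..1} \<inter> abs -` B)"
        by blast
    qed
    have "gap (wrap y) \<in> B" if "y \<in> {-1..1}" "\<bar>y\<bar> \<in> B" for y
      using gap_wrap [of y] that by auto
    then show "wrap ` ({-1..1} \<inter> abs -` B) \<subseteq> gap -` B \<inter> circle"
      using wrap_circle by auto
  qed
  ultimately show "closed (gap -` B \<inter> circle)"
    using closed_wrap_image by simp
qed

text \<open>The point \<open>h 0\<close> is excluded because it is the common image of both ends of
  the interval: its own value is 1, while nearby points of negative coordinate have values near
  -1.\<close>

lemma continuous_on_arc: "continuous_on (circle - {h 0}) arc"
  unfolding continuous_on_closed_invariant
proof (intro allI impI)
  fix B :: "real set" assume B: "closed B"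
  have "wrap ` ({-1..1} \<inter> B) \<inter> (circle - {h 0}) = arc -` B \<inter> (circle - {h 0})"
  proof
    show "wrap ` ({-1..1} \<inter> B) \<inter> (circle - {h 0}) \<subseteq> arc -` B \<inter> (circle - {h 0})"
    proof
      fix z assume z: "z \<in> wrap ` ({-1..1} \<inter> B) \<inter> (circle - {h 0})"
      then obtain y where y: "z = wrap y" "y \<in> {-1..1}" "y \<in> B"
        by blast
      then have "\<bar>y\<bar> \<noteq> 1" "\<bar>y\<bar> \<le> 1"
        using z wrap_ends [of y] by auto
      then have "arc z = y"
        using y arc_wrap [of y] by simp
      then show "z \<in> arc -` B \<inter> (circle - {h 0})"
        using y z by simp
    qed
    show "arc -` B \<inter> (circle - {h 0}) \<subseteq> wrap ` ({-1..1} \<inter> B) \<inter> (circle - {h 0})"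
    proof
      fix z assume z: "z \<in> arc -` B \<inter> (circle - {h 0})"
      then have "z = wrap (arc z)" "arc z \<in> {-1..1} \<inter> B"
        using wrap_arc abs_arc [of z] gap_le_1 [of z] by auto
      then show "z \<in> wrap ` ({-1..1} \<inter> B) \<inter> (circle - {h 0})"
        using z by blast
    qed
  qed
  then show "\<exists>A. closed A \<and> A \<inter> (circle - {h 0}) = arc -` B \<inter> (circle - {h 0})"
    using closed_wrap_image [OF B] by blast
qed

end

section \<open>Configuration spaces\<close>

definition no_triple :: "'i set \<Rightarrow> ('i \<Rightarrow> 'v) \<Rightarrow> bool" where
  "no_triple A x \<longleftrightarrow> (\<forall>i\<in>A. \<forall>j\<in>A. \<forall>k\<in>A. i \<noteq> j \<and> j \<noteq> k \<and> i \<noteq> k \<longrightarrow> \<not> (x i = x j \<and> x j = x k))"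

lemma no_tripleD:
  "no_triple A x \<Longrightarrow> i \<in> A \<Longrightarrow> j \<in> A \<Longrightarrow> k \<in> A \<Longrightarrow> i \<noteq> j \<Longrightarrow> j \<noteq> k \<Longrightarrow> i \<noteq> k \<Longrightarrow> x i = x j \<Longrightarrow> x j = x k \<Longrightarrow> False"
  unfolding no_triple_def by blast

lemma no_triple_ordered_iff:
  "no_triple {1..m} x \<longleftrightarrow>
    (\<forall>i j k. 1 \<le> i \<and> i < j \<and> j < k \<and> k \<le> (m::nat) \<longrightarrow> \<not> (x i = x j \<and> x j = x k))"
proof
  assume *: "\<forall>i j k. 1 \<le> i \<and> i < j \<and> j < k \<and> k \<le> m \<longrightarrow> \<not> (x i = x j \<and> x j = x k)"
  have ord: False if "1 \<le> i" "i < j" "j < k" "k \<le> m" "x i = x j" "x j = x k" for i j k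
    using * that by blast
  show "no_triple {1..m} x"
    unfolding no_triple_def
  proof (intro ballI impI notI)
    fix i j k
    assume A: "i \<in> {1..m}" "j \<in> {1..m}" "k \<in> {1..m}"
      and ne: "i \<noteq> j \<and> j \<noteq> k \<and> i \<noteq> k" and eq: "x i = x j \<and> x j = x k"
    consider "i < j \<and> j < k" | "i < k \<and> k < j" | "j < i \<and> i < k" | "j < k \<and> k < i"
      | "k < i \<and> i < j" | "k < j \<and> j < i"
      using ne by linarith
    then show False
    proof cases
      case 1
      with A eq show ?thesis
        by (intro ord [of i j k]) simp_all
    next
      case 2
      with A eq show ?thesis
        by (intro ord [of i k j]) simp_all
    next
      case 3
      with A eq show ?thesis
        by (intro ord [of j i k]) simp_all
    next
      case 4
      with A eq show ?thesis
        by (intro ord [of j k i]) simp_all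
    next
      case 5
      with A eq show ?thesis
        by (intro ord [of k i j]) simp_all
    next
      case 6
      with A eq show ?thesis
        by (intro ord [of k j i]) simp_all
    qed
  qed
next
  assume x: "no_triple {1..m} x"
  show "\<forall>i j k. 1 \<le> i \<and> i < j \<and> j < k \<and> k \<le> m \<longrightarrow> \<not> (x i = x j \<and> x j = x k)"
  proof (intro allI impI notI)
    fix i j k
    assume "1 \<le> i \<and> i < j \<and> j < k \<and> k \<le> m" "x i = x j \<and> x j = x k"
    then show False
      by (intro no_tripleD [OF x, of i j k]) simp_all
  qed
qed

lemma no_triple_subset: "no_triple A x \<Longrightarrow> B \<subseteq> A \<Longrightarrow> no_triple B x"
  unfolding no_triple_def by blast

lemma no_triple_cong: "(\<And>i. i \<in> A \<Longrightarrow> x i = y i) \<Longrightarrow> no_triple A x \<longleftrightarrow> no_triple A y"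
  unfolding no_triple_def by (intro ball_cong refl) simp

text \<open>A triple coincidence in \<open>y\<close> is carried by the injection \<open>s\<close> to
  one in \<open>x\<close>. This single form covers passing to coordinates, forgetting a point and
  renumbering.\<close>

lemma no_triple_reindex:
  assumes x: "no_triple A x" and s: "inj_on s B" "s ` B \<subseteq> A"
    and eq: "\<And>b c. b \<in> B \<Longrightarrow> c \<in> B \<Longrightarrow> y b = y c \<Longrightarrow> x (s b) = x (s c)"
  shows "no_triple B y"
  unfolding no_triple_def
proof (intro ballI impI notI)
  fix i j k
  assume B: "i \<in> B" "j \<in> B" "k \<in> B" and ne: "i \<noteq> j \<and> j \<noteq> k \<and> i \<noteq> k" and y: "y i = y j \<and> y j = y k"
  have "s b = s c \<longleftrightarrow> b = c" if "b \<in> B" "c \<in> B" for b c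
    using s(1) that by (rule inj_on_eq_iff)
  moreover have "x (s i) = x (s j)" "x (s j) = x (s k)"
    using eq [of i j] eq [of j k] B y by blast+
  moreover have "s i \<in> A" "s j \<in> A" "s k \<in> A"
    using s(2) B by blast+
  ultimately show False
    using no_tripleD [OF x, of "s i" "s j" "s k"] B ne by blast
qed

text \<open>Two added points may coincide with each other; a forbidden triple would need a third
  point, which comes from \<open>B\<close> and differs from both. The indices \<open>a\<close> and
  \<open>b\<close> may also be equal, for a single added point.\<close>

lemma no_triple_insert2:
  assumes B: "no_triple B z" and ne: "\<And>j. j \<in> B \<Longrightarrow> z j \<noteq> z a \<and> z j \<noteq> z b"
  shows "no_triple (insert a (insert b B)) z"
  unfolding no_triple_def
proof (intro ballI impI notI)
  fix i j k
  assume mem: "i \<in> insert a (insert b B)" "j \<in> insert a (insert b B)" "k \<in> insert a (insert b B)"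
    and dist: "i \<noteq> j \<and> j \<noteq> k \<and> i \<noteq> k" and eq: "z i = z j \<and> z j = z k"
  have "i \<in> B \<or> j \<in> B \<or> k \<in> B"
    using mem dist by auto
  then have "z i \<noteq> z a \<and> z i \<noteq> z b"
    using ne eq by auto
  then have "i \<in> B" "j \<in> B" "k \<in> B"
    using mem eq by auto
  then show False
    using no_tripleD [OF B] dist eq by blast
qed

lemma topspace_no_three_config:
  "topspace (no_three_config m) = {x \<in> extensional {1..m}. no_triple {1..m} x}"
  unfolding no_three_config_def no_triple_ordered_iff
  by (auto simp: PiE_def)

lemma continuous_map_into_no_three_config:
  assumes f: "continuous_map X (powertop_real {1..m}) f"
    and top: "\<And>x. x \<in> topspace X \<Longrightarrow> f x \<in> topspace (no_three_config m)"
  shows "continuous_map X (no_three_config m) f"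
proof -
  let ?S = "{x. \<forall>i j k. 1 \<le> i \<and> i < j \<and> j < k \<and> k \<le> m \<longrightarrow> \<not> (x i = x j \<and> x j = x k)}"
  have "f x \<in> ?S" if "x \<in> topspace X" for x
    using top [OF that] unfolding no_three_config_def topspace_subtopology by (rule IntD2)
  then have "f \<in> topspace X \<rightarrow> ?S"
    by (rule funcsetI)
  with f show ?thesis
    unfolding no_three_config_def continuous_map_in_subtopology by (rule conjI)
qed

lemma topspace_Q_space:
  "topspace (Q_space n w) = {x \<in> {1..n - 1} \<rightarrow>\<^sub>E circle. no_triple {1..n} (x(n := w))}"
proof -
  have top: "topspace (torus (n - 1)) = ({1..n - 1} \<rightarrow>\<^sub>E circle)"
    by (simp add: torus_def)
  show ?thesis
    unfolding Q_space_def no_triple_ordered_iff triple_diagonal_def top topspace_subtopology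
    by blast
qed

text \<open>Convexity of the open interval from \<open>- g\<close> to \<open>g\<close>.\<close>

lemma abs_convex_less:
  fixes a t g s :: real
  assumes "\<bar>a\<bar> < g" "\<bar>t\<bar> < g" "0 \<le> s" "s \<le> 1"
  shows "\<bar>(1 - s) * a + s * t\<bar> < g"
proof -
  let ?m = "max \<bar>a\<bar> \<bar>t\<bar>"
  have "\<bar>(1 - s) * a + s * t\<bar> \<le> (1 - s) * \<bar>a\<bar> + s * \<bar>t\<bar>"
    using abs_triangle_ineq [of "(1 - s) * a" "s * t"] assms by (simp add: abs_mult)
  also have "\<dots> \<le> (1 - s) * ?m + s * ?m"
    using assms by (intro add_mono mult_left_mono) auto
  also have "\<dots> = ?m"
    by (simp add: algebra_simps)
  also have "\<dots> < g"
    using assms by simp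
  finally show ?thesis .
qed

text \<open>The increasing injection that misses \<open>i\<close>, as in the coface maps of
  simplicial sets.\<close>

definition skip :: "nat \<Rightarrow> nat \<Rightarrow> nat" where
  "skip i j = (if j < i then j else Suc j)"

definition unskip :: "nat \<Rightarrow> nat \<Rightarrow> nat" where
  "unskip i j = (if j < i then j else j - 1)"

lemma unskip_skip [simp]: "unskip i (skip i j) = j"
  by (simp add: skip_def unskip_def)

lemma skip_unskip: "j \<noteq> i \<Longrightarrow> skip i (unskip i j) = j"
  by (auto simp: skip_def unskip_def)

lemma skip_neq [simp]: "skip i j \<noteq> i"
  by (simp add: skip_def)

lemma skip_range: "j \<in> {1..n - 2} \<Longrightarrow> skip i j \<in> {1..n - 1}"
  by (auto simp: skip_def)

lemma unskip_range: "i \<in> {1..n - 1} \<Longrightarrow> j \<in> {1..n - 1} \<Longrightarrow> j \<noteq> i \<Longrightarrow> unskip i j \<in> {1..n - 2}"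
  by (auto simp: unskip_def)

lemma inj_on_skip: "inj_on (skip i) A"
  by (rule inj_on_inverseI [of _ "unskip i"]) simp

lemma inj_on_unskip: "i \<notin> A \<Longrightarrow> inj_on (unskip i) A"
  by (rule inj_on_inverseI [of _ "skip i"]) (metis skip_unskip)

locale config_space = punctured_circle +
  fixes n :: nat
  assumes n: "n > 2"
begin

section \<open>Collars of the sets at infinity\<close>

abbreviation Q :: "(nat \<Rightarrow> complex) topology" where
  "Q \<equiv> Q_space n w"

definition collar :: "nat \<Rightarrow> (nat \<Rightarrow> complex) set" where
  "collar i = {x \<in> topspace Q. \<forall>j\<in>{1..n - 1} - {i}. gap (x i) < gap (x j)}"

definition side :: "nat \<Rightarrow> bool \<Rightarrow> (nat \<Rightarrow> complex) set" where
  "side i b = {x \<in> collar i. if b then arc (x i) > 0 else arc (x i) < 0}"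

definition finite_part :: "(nat \<Rightarrow> complex) set" where
  "finite_part = {x \<in> topspace Q. \<forall>j\<in>{1..n - 1}. x j \<noteq> w}"

definition forget :: "nat \<Rightarrow> (nat \<Rightarrow> complex) \<Rightarrow> nat \<Rightarrow> real" where
  "forget i x = (\<lambda>j\<in>{1..n - 2}. coord (x (skip i j)))"

text \<open>The sum bounds every \<open>\<bar>y k\<bar>\<close> and depends continuously on
  \<open>y\<close>; the summand 1 makes the bound strict. The sign selects the end of the line, that
  is, the side of the collar.\<close>

definition far :: "bool \<Rightarrow> (nat \<Rightarrow> real) \<Rightarrow> real" where
  "far b y = (if b then 1 else - 1) * (1 + (\<Sum>k\<in>{1..n - 2}. \<bar>y k\<bar>))"

definition add_far :: "nat \<Rightarrow> bool \<Rightarrow> (nat \<Rightarrow> real) \<Rightarrow> nat \<Rightarrow> real" where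
  "add_far i b y = (\<lambda>j\<in>{1..n - 1}. if j = i then far b y else y (unskip i j))"

definition coords :: "(nat \<Rightarrow> complex) \<Rightarrow> nat \<Rightarrow> real" where
  "coords x = (\<lambda>j\<in>{1..n - 1}. coord (x j))"

lemma topspace_Q_circle: "x \<in> topspace Q \<Longrightarrow> j \<in> {1..n - 1} \<Longrightarrow> x j \<in> circle"
  by (auto simp: topspace_Q_space PiE_iff simp del: mem_sphere_0)

lemma continuous_map_Q_component:
  assumes j: "j \<in> {1..n - 1}" and f: "continuous_on T f"
    and T: "\<And>x. x \<in> topspace Q \<Longrightarrow> x \<in> S \<Longrightarrow> x j \<in> T"
  shows "continuous_map (subtopology Q S) euclidean (\<lambda>x. f (x j))"
proof -
  have "continuous_map (torus (n - 1)) (top_of_set circle) (\<lambda>x. x j)"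
    unfolding torus_def using j by (rule continuous_map_product_projection)
  then have "continuous_map (torus (n - 1)) euclidean (\<lambda>x. x j)"
    by (rule continuous_map_into_fulltopology)
  then have "continuous_map (subtopology Q S) euclidean (\<lambda>x. x j)"
    unfolding Q_space_def by (intro continuous_map_from_subtopology)
  then have "continuous_map (subtopology Q S) (top_of_set T) (\<lambda>x. x j)"
    using T by (auto simp: continuous_map_in_subtopology)
  moreover have "continuous_map (top_of_set T) euclidean f"
    using f by simp
  ultimately show ?thesis
    using continuous_map_compose [of "subtopology Q S" "top_of_set T" "\<lambda>x. x j" euclidean f]
    by (simp add: o_def)
qed

text \<open>If no other point meets \<open>x i\<close> or \<open>w\<close>, a forbidden triple can
  occur only among the others. So \<open>x i\<close> may be moved freely, even through
  \<open>w\<close>, as long as it avoids them.\<close>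

lemma topspace_Q_iff:
  assumes x: "x \<in> {1..n - 1} \<rightarrow>\<^sub>E circle" and i: "i \<in> {1..n - 1}"
    and ne: "\<And>j. j \<in> {1..n - 1} - {i} \<Longrightarrow> x j \<noteq> x i \<and> x j \<noteq> w"
  shows "x \<in> topspace Q \<longleftrightarrow> no_triple ({1..n - 1} - {i}) x"
proof
  have eq: "no_triple ({1..n - 1} - {i}) (x(n := w)) \<longleftrightarrow> no_triple ({1..n - 1} - {i}) x"
    using n by (intro no_triple_cong) auto
  {
    assume "x \<in> topspace Q"
    then have "no_triple {1..n} (x(n := w))"
      by (simp add: topspace_Q_space)
    then have "no_triple ({1..n - 1} - {i}) (x(n := w))"
      by (rule no_triple_subset) auto
    then show "no_triple ({1..n - 1} - {i}) x"
      by (simp only: eq)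
  next
    assume "no_triple ({1..n - 1} - {i}) x"
    then have "no_triple ({1..n - 1} - {i}) (x(n := w))"
      by (simp only: eq)
    \<comment> \<open>The two added points are \<open>x i\<close> and the fixed point at infinity,
      which may coincide.\<close>
    then have "no_triple (insert i (insert n ({1..n - 1} - {i}))) (x(n := w))"
      by (rule no_triple_insert2) (use ne i n in auto)
    moreover have "insert i (insert n ({1..n - 1} - {i})) = {1..n}"
      using i n by auto
    ultimately show "x \<in> topspace Q"
      using x by (simp add: topspace_Q_space)
  }
qed

lemma collar_topspace: "x \<in> collar i \<Longrightarrow> x \<in> topspace Q"
  by (simp add: collar_def)

lemma collar_gap: "x \<in> collar i \<Longrightarrow> j \<in> {1..n - 1} \<Longrightarrow> j \<noteq> i \<Longrightarrow> gap (x i) < gap (x j)"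
  by (simp add: collar_def)

lemma collar_neq_w:
  assumes "x \<in> collar i" "j \<in> {1..n - 1}" "j \<noteq> i"
  shows "x j \<noteq> w"
proof
  assume "x j = w"
  then have "gap (x j) = 0"
    by (simp only: gap_w)
  then show False
    using collar_gap [OF assms] gap_nonneg [of "x i"] by linarith
qed

text \<open>Since n > 2 there is another point. Its gap is at most 1 and exceeds that of
  \<open>x i\<close>, whereas \<open>h 0\<close> has gap exactly 1. Hence \<open>arc (x i)\<close>
  is continuous on the collar.\<close>

lemma collar_neq_h0:
  assumes "x \<in> collar i" "i \<in> {1..n - 1}"
  shows "x i \<noteq> h 0"
proof -
  define j where "j = (if i = 1 then 2 else 1 :: nat)"
  have "j \<in> {1..n - 1}" "j \<noteq> i"
    using n by (auto simp: j_def)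
  then have "gap (x i) < 1"
    using collar_gap [OF assms(1)] gap_le_1 [of "x j"] by fastforce
  then show ?thesis
    using gap_h [of 0] by auto
qed

lemma collar_no_triple:
  assumes x: "x \<in> collar i" and i: "i \<in> {1..n - 1}"
  shows "no_triple ({1..n - 1} - {i}) x"
proof -
  have "x j \<noteq> x i \<and> x j \<noteq> w" if "j \<in> {1..n - 1} - {i}" for j
    using collar_gap [OF x, of j] collar_neq_w [OF x, of j] that by auto
  moreover have "x \<in> {1..n - 1} \<rightarrow>\<^sub>E circle"
    using collar_topspace [OF x] by (simp add: topspace_Q_space)
  ultimately show ?thesis
    using topspace_Q_iff [OF _ i] collar_topspace [OF x] by blast
qed

lemma continuous_map_gap:
  assumes "j \<in> {1..n - 1}"
  shows "continuous_map Q euclideanreal (\<lambda>x. gap (x j))"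
proof -
  have "continuous_map (subtopology Q UNIV) euclideanreal (\<lambda>x. gap (x j))"
    by (rule continuous_map_Q_component [OF assms continuous_on_gap])
      (rule topspace_Q_circle [OF _ assms])
  then show ?thesis
    by simp
qed

lemma openin_finite_part: "openin Q finite_part"
proof -
  have "openin Q ((\<Inter>j\<in>{1..n - 1}. {x \<in> topspace Q. gap (x j) \<in> {0<..}}) \<inter> topspace Q)"
    by (intro openin_INT openin_continuous_map_preimage [OF continuous_map_gap]) simp_all
  moreover have "(\<Inter>j\<in>{1..n - 1}. {x \<in> topspace Q. gap (x j) \<in> {0<..}}) \<inter> topspace Q = finite_part"
  proof -
    have "gap z > 0 \<longleftrightarrow> z \<noteq> w" for z
      using gap_pos [of z] gap_w by fastforce
    then show ?thesis
      by (auto simp: finite_part_def)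
  qed
  ultimately show ?thesis
    by simp
qed

lemma openin_collar:
  assumes i: "i \<in> {1..n - 1}"
  shows "openin Q (collar i)"
proof -
  have "continuous_map Q euclideanreal (\<lambda>x. gap (x j) - gap (x i))" if "j \<in> {1..n - 1} - {i}" for j
    using that i by (intro continuous_map_diff continuous_map_gap) auto
  then have "openin Q ((\<Inter>j\<in>{1..n - 1} - {i}. {x \<in> topspace Q. gap (x j) - gap (x i) \<in> {0<..}}) \<inter> topspace Q)"
    by (intro openin_INT openin_continuous_map_preimage [where Y = euclideanreal]) simp_all
  moreover have "(\<Inter>j\<in>{1..n - 1} - {i}. {x \<in> topspace Q. gap (x j) - gap (x i) \<in> {0<..}}) \<inter> topspace Q = collar i"
    by (auto simp: collar_def)
  ultimately show ?thesis
    by simp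
qed

lemma continuous_map_arc:
  assumes "i \<in> {1..n - 1}" "S \<subseteq> collar i"
  shows "continuous_map (subtopology Q S) euclideanreal (\<lambda>x. arc (x i))"
  using assms collar_neq_h0 topspace_Q_circle
  by (intro continuous_map_Q_component [OF _ continuous_on_arc]) blast+

lemma openin_side:
  assumes i: "i \<in> {1..n - 1}"
  shows "openin Q (side i b)"
proof -
  let ?T = "if b then {0<..} else {..<0} :: real set"
  have "openin (subtopology Q (collar i)) {x \<in> topspace (subtopology Q (collar i)). arc (x i) \<in> ?T}"
    using continuous_map_arc [OF i order_refl] by (rule openin_continuous_map_preimage) simp
  moreover have "{x \<in> topspace (subtopology Q (collar i)). arc (x i) \<in> ?T} = side i b"
    using collar_topspace by (auto simp: side_def)
  ultimately show ?thesis
    using openin_collar [OF i] by (simp add: openin_trans_full)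
qed

lemma collar_disjoint: "i \<in> {1..n - 1} \<Longrightarrow> k \<in> {1..n - 1} \<Longrightarrow> i \<noteq> k \<Longrightarrow> collar i \<inter> collar k = {}"
  by (auto simp: collar_def dest!: bspec)

lemma finite_part_collars: "topspace Q \<subseteq> finite_part \<union> (\<Union>i\<in>{1..n - 1}. collar i)"
proof
  fix x assume x: "x \<in> topspace Q"
  show "x \<in> finite_part \<union> (\<Union>i\<in>{1..n - 1}. collar i)"
  proof (cases "x \<in> finite_part")
    case False
    then obtain i where i: "i \<in> {1..n - 1}" "x i = w"
      using x by (auto simp: finite_part_def)
    have "x j \<noteq> w" if j: "j \<in> {1..n - 1}" "j \<noteq> i" for j
    proof
      assume xj: "x j = w"
      have "no_triple {1..n} (x(n := w))"
        using x by (simp add: topspace_Q_space)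
      moreover have mem: "i \<in> {1..n}" "j \<in> {1..n}" "n \<in> {1..n}" "i \<noteq> j" "j \<noteq> n" "i \<noteq> n"
        using i j n by auto
      ultimately show False
        by (rule no_tripleD) (use mem xj i in simp_all)
    qed
    then have "x \<in> collar i"
      using x i gap_pos by (simp add: collar_def)
    then show ?thesis
      using i by blast
  qed simp
qed

text \<open>In a collar all points but \<open>x i\<close> are finite, so membership in
  \<open>finite_part\<close> depends only on whether \<open>arc (x i)\<close> is nonzero, and its
  sign names the side.\<close>

lemma collar_finite_part:
  assumes "i \<in> {1..n - 1}"
  shows "collar i \<inter> finite_part = side i True \<union> side i False"
proof -
  have "x \<in> finite_part \<longleftrightarrow> arc (x i) > 0 \<or> arc (x i) < 0" if "x \<in> collar i" for x
  proof -
    have "(\<forall>j\<in>{1..n - 1}. x j \<noteq> w) \<longleftrightarrow> x i \<noteq> w"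
      using collar_neq_w [OF that] assms by metis
    then have "x \<in> finite_part \<longleftrightarrow> x i \<noteq> w"
      using collar_topspace [OF that] by (simp add: finite_part_def)
    then show ?thesis
      using arc_eq_0_iff [of "x i"] by auto
  qed
  then show ?thesis
    by (auto simp: side_def)
qed

lemma side_disjoint: "side i True \<inter> side i False = {}"
  by (auto simp: side_def)

lemma homeomorphic_maps_config:
  "homeomorphic_maps (no_three_config (n - 1)) (subtopology Q finite_part) (config_inclusion n h) coords"
  unfolding homeomorphic_maps_def
proof (intro conjI ballI)
  have "continuous_map (no_three_config (n - 1)) Q (config_inclusion n h)"
    by (rule continuous_map_config_inclusion [OF h])
  moreover have "config_inclusion n h ` topspace (no_three_config (n - 1)) = finite_part"
    unfolding finite_part_def by (rule config_inclusion_image [OF h])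
  ultimately show "continuous_map (no_three_config (n - 1)) (subtopology Q finite_part) (config_inclusion n h)"
    by (auto simp: continuous_map_in_subtopology)
  have "continuous_map (subtopology Q finite_part) euclideanreal (\<lambda>x. coord (x j))" if "j \<in> {1..n - 1}" for j
    using that topspace_Q_circle
    by (intro continuous_map_Q_component [OF _ continuous_on_coord]) (auto simp: finite_part_def)
  then have "continuous_map (subtopology Q finite_part) (powertop_real {1..n - 1}) coords"
    unfolding continuous_map_componentwise coords_def by auto
  moreover have "coords x \<in> topspace (no_three_config (n - 1))" if x: "x \<in> finite_part" for x
  proof -
    have xQ: "x \<in> topspace Q" and xw: "\<And>j. j \<in> {1..n - 1} \<Longrightarrow> x j \<noteq> w"
      using x by (auto simp: finite_part_def)
    have "no_triple {1..n} (x(n := w))"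
      using xQ by (simp add: topspace_Q_space)
    then have "no_triple {1..n - 1} (coords x)"
    proof (rule no_triple_reindex [where s = "\<lambda>j. j"])
      fix b c assume bc: "b \<in> {1..n - 1}" "c \<in> {1..n - 1}" "coords x b = coords x c"
      then have "h (coord (x b)) = h (coord (x c))"
        by (simp add: coords_def)
      moreover have "h (coord (x j)) = x j" if "j \<in> {1..n - 1}" for j
        using topspace_Q_circle [OF xQ that] xw [OF that] by (rule h_coord)
      ultimately have "x b = x c"
        using bc(1,2) by simp
      then show "(x(n := w)) b = (x(n := w)) c"
        using bc n by auto
    qed auto
    then show ?thesis
      by (simp add: topspace_no_three_config coords_def)
  qed
  ultimately show "continuous_map (subtopology Q finite_part) (no_three_config (n - 1)) coords"
    by (intro continuous_map_into_no_three_config) auto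
next
  fix x assume "x \<in> topspace (no_three_config (n - 1))"
  then show "coords (config_inclusion n h x) = x"
    by (auto simp: coords_def config_inclusion_def topspace_no_three_config extensional_def)
next
  fix y assume "y \<in> topspace (subtopology Q finite_part)"
  then have y: "y \<in> topspace Q" "\<And>j. j \<in> {1..n - 1} \<Longrightarrow> y j \<noteq> w"
    by (auto simp: finite_part_def)
  have "h (coord (y j)) = y j" if "j \<in> {1..n - 1}" for j
    using topspace_Q_circle [OF y(1) that] y(2) [OF that] by (rule h_coord)
  moreover have "y j = undefined" if "j \<notin> {1..n - 1}" for j
    using y(1) that by (auto simp: topspace_Q_space PiE_iff extensional_def)
  ultimately show "config_inclusion n h (coords y) = y"
    by (auto simp: config_inclusion_def coords_def fun_eq_iff)
qed

section \<open>Forgetting a point and reinserting it near infinity\<close>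

lemma continuous_map_coord_skip:
  assumes i: "i \<in> {1..n - 1}" and k: "k \<in> {1..n - 2}" and S: "S \<subseteq> collar i"
  shows "continuous_map (subtopology Q S) euclideanreal (\<lambda>x. coord (x (skip i k)))"
proof (rule continuous_map_Q_component [OF skip_range [OF k] continuous_on_coord])
  fix x assume x: "x \<in> topspace Q" "x \<in> S"
  have "x (skip i k) \<noteq> w"
    using subsetD [OF S x(2)] skip_range [OF k] skip_neq by (rule collar_neq_w)
  then show "x (skip i k) \<in> circle - {w}"
    using topspace_Q_circle [OF x(1) skip_range [OF k]] by (simp only: Diff_iff singleton_iff simp_thms)
qed

lemma continuous_map_forget:
  assumes i: "i \<in> {1..n - 1}"
  shows "continuous_map (subtopology Q (collar i)) (no_three_config (n - 2)) (forget i)"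
proof -
  have "continuous_map (subtopology Q (collar i)) (powertop_real {1..n - 2}) (forget i)"
    unfolding continuous_map_componentwise forget_def
    using continuous_map_coord_skip [OF i] by auto
  moreover have "forget i x \<in> topspace (no_three_config (n - 2))" if x: "x \<in> collar i" for x
  proof -
    have "no_triple {1..n - 2} (forget i x)"
    proof (rule no_triple_reindex [OF collar_no_triple [OF x i] inj_on_skip])
      show "skip i ` {1..n - 2} \<subseteq> {1..n - 1} - {i}"
        using skip_range by auto
      fix b c assume bc: "b \<in> {1..n - 2}" "c \<in> {1..n - 2}" "forget i x b = forget i x c"
      then have "h (coord (x (skip i b))) = h (coord (x (skip i c)))"
        by (simp add: forget_def)
      moreover have "h (coord (x (skip i j))) = x (skip i j)" if "j \<in> {1..n - 2}" for j
        using topspace_Q_circle [OF collar_topspace [OF x] skip_range [OF that]]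
          collar_neq_w [OF x skip_range [OF that] skip_neq] by (rule h_coord)
      ultimately show "x (skip i b) = x (skip i c)"
        using bc(1,2) by simp
    qed
    then show ?thesis
      by (simp add: topspace_no_three_config forget_def)
  qed
  ultimately show ?thesis
    by (intro continuous_map_into_no_three_config) auto
qed

lemma sum_abs_nonneg: "0 \<le> (\<Sum>k\<in>A. \<bar>y k :: real\<bar>)"
  by (simp add: sum_nonneg)

lemma abs_far: "\<bar>far b y\<bar> = 1 + (\<Sum>k\<in>{1..n - 2}. \<bar>y k\<bar>)"
  using sum_abs_nonneg [of y "{1..n - 2}"] by (simp add: far_def abs_mult)

lemma abs_less_far:
  assumes "k \<in> {1..n - 2}"
  shows "\<bar>y k\<bar> < \<bar>far b y\<bar>"
  using member_le_sum [OF assms, of "\<lambda>k. \<bar>y k\<bar>"] by (simp add: abs_far)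

lemma far_sign: "if b then far b y > 0 else far b y < 0"
proof -
  define t where "t = (\<Sum>k\<in>{1..n - 2}. \<bar>y k\<bar>)"
  have "0 \<le> t"
    unfolding t_def by (rule sum_abs_nonneg)
  then show ?thesis
    unfolding far_def t_def [symmetric] by auto
qed

lemma arc_far_sign: "if b then arc (h (far b y)) > 0 else arc (h (far b y)) < 0"
proof -
  have "arc (h t) > 0" if "t > 0" for t
    using that by (simp add: arc_h)
  moreover have "arc (h t) < 0" if "t < 0" for t
    using that by (simp add: arc_h divide_neg_pos)
  ultimately show ?thesis
    using far_sign [of b y] by (cases b) simp_all
qed

lemma continuous_map_add_far:
  assumes i: "i \<in> {1..n - 1}"
  shows "continuous_map (no_three_config (n - 2)) (no_three_config (n - 1)) (add_far i b)"
proof -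
  have comp: "continuous_map (no_three_config (n - 2)) euclideanreal (\<lambda>y. y k)" if "k \<in> {1..n - 2}" for k
    unfolding no_three_config_def using that
    by (intro continuous_map_from_subtopology continuous_map_product_projection)
  have "continuous_map (no_three_config (n - 2)) euclideanreal (far b)"
    unfolding far_def
    by (intro continuous_map_real_mult_left continuous_map_add continuous_map_sum
        continuous_map_real_abs comp) simp_all
  then have "continuous_map (no_three_config (n - 2)) euclideanreal (\<lambda>y. add_far i b y j)"
    if "j \<in> {1..n - 1}" for j
    using that comp unskip_range [OF i that] by (auto simp: add_far_def)
  then have "continuous_map (no_three_config (n - 2)) (powertop_real {1..n - 1}) (add_far i b)"
    unfolding continuous_map_componentwise by (auto simp: add_far_def)
  moreover have "add_far i b y \<in> topspace (no_three_config (n - 1))"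
    if "y \<in> topspace (no_three_config (n - 2))" for y
  proof -
    have y: "no_triple {1..n - 2} y"
      using that by (simp add: topspace_no_three_config)
    have "no_triple ({1..n - 1} - {i}) (add_far i b y)"
    proof (rule no_triple_reindex [OF y inj_on_unskip])
      show "unskip i ` ({1..n - 1} - {i}) \<subseteq> {1..n - 2}"
        using unskip_range [OF i] by blast
    qed (auto simp: add_far_def)
    \<comment> \<open>The index is doubled in order to use \<open>no_triple_insert2\<close> for one
      added point.\<close>
    then have "no_triple (insert i (insert i ({1..n - 1} - {i}))) (add_far i b y)"
    proof (rule no_triple_insert2)
      fix j assume j: "j \<in> {1..n - 1} - {i}"
      then have "\<bar>y (unskip i j)\<bar> < \<bar>far b y\<bar>"
        using unskip_range [OF i] by (intro abs_less_far) auto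
      then show "add_far i b y j \<noteq> add_far i b y i \<and> add_far i b y j \<noteq> add_far i b y i"
        using j i by (auto simp: add_far_def)
    qed
    moreover have "insert i (insert i ({1..n - 1} - {i})) = {1..n - 1}"
      using i by auto
    ultimately show ?thesis
      by (simp add: topspace_no_three_config add_far_def)
  qed
  ultimately show ?thesis
    by (intro continuous_map_into_no_three_config) auto
qed

text \<open>\<open>gap (h t)\<close> decreases in \<open>\<bar>t\<bar>\<close>: far out on the line
  is close to infinity on the circle.\<close>

lemma gap_far_less:
  assumes "k \<in> {1..n - 2}"
  shows "gap (h (far b y)) < gap (h (y k))"
  using abs_less_far [OF assms, of y b] by (simp add: gap_h frac_less2)

lemma inclusion_add_far:
  assumes i: "i \<in> {1..n - 1}" and y: "y \<in> topspace (no_three_config (n - 2))"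
  shows "config_inclusion n h (add_far i b y) \<in> side i b"
    and "forget i (config_inclusion n h (add_far i b y)) = y"
proof -
  let ?x = "config_inclusion n h (add_far i b y)"
  have xi: "?x i = h (far b y)"
    using i by (simp add: config_inclusion_def add_far_def)
  have xj: "?x j = h (y (unskip i j))" if "j \<in> {1..n - 1}" "j \<noteq> i" for j
    using that by (simp add: config_inclusion_def add_far_def)
  have "continuous_map (no_three_config (n - 2)) Q (config_inclusion n h \<circ> add_far i b)"
    using continuous_map_add_far [OF i] continuous_map_config_inclusion [OF h]
    by (rule continuous_map_compose)
  then have "?x \<in> topspace Q"
    using y by (auto simp: continuous_map_def)
  moreover have "gap (?x i) < gap (?x j)" if "j \<in> {1..n - 1} - {i}" for j
    using that xi xj [of j] gap_far_less [OF unskip_range [OF i, of j]] by simp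
  moreover have "if b then arc (?x i) > 0 else arc (?x i) < 0"
    unfolding xi by (rule arc_far_sign)
  ultimately show "?x \<in> side i b"
    by (simp add: side_def collar_def)
  have "coord (?x (skip i k)) = y k" if "k \<in> {1..n - 2}" for k
    using xj [OF skip_range [OF that, of i]] by simp
  then show "forget i ?x = y"
    using y by (auto simp: forget_def topspace_no_three_config extensional_def)
qed

text \<open>Only \<open>x i\<close> moves, linearly in the coordinate \<open>arc\<close>, to the
  position where \<open>add_far\<close> would put it. If that position is on the other side of the
  collar, the path crosses 0, which is the point at infinity.\<close>

definition push :: "nat \<Rightarrow> bool \<Rightarrow> real \<times> (nat \<Rightarrow> complex) \<Rightarrow> nat \<Rightarrow> complex" where
  "push i b = (\<lambda>(s, x). x(i := wrap ((1 - s) * arc (x i) + s * arc (h (far b (forget i x))))))"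

text \<open>Both ends of the path lie in the interval of radius \<open>gap (x j)\<close>: the start
  by the definition of the collar, the end because \<open>far\<close> exceeds every coordinate kept
  by \<open>forget\<close>.\<close>

lemma push_bound:
  assumes i: "i \<in> {1..n - 1}" and x: "x \<in> collar i" and s: "0 \<le> s" "s \<le> 1"
    and j: "j \<in> {1..n - 1}" "j \<noteq> i"
  shows "\<bar>(1 - s) * arc (x i) + s * arc (h (far b (forget i x)))\<bar> < gap (x j)"
proof (rule abs_convex_less [OF _ _ s])
  show "\<bar>arc (x i)\<bar> < gap (x j)"
    unfolding abs_arc by (rule collar_gap [OF x j])
  have "h (forget i x (unskip i j)) = x j"
    using unskip_range [OF i j] j collar_neq_w [OF x j] topspace_Q_circle [OF collar_topspace [OF x] j(1)]
    by (simp add: forget_def skip_unskip h_coord del: mem_sphere_0)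
  then show "\<bar>arc (h (far b (forget i x)))\<bar> < gap (x j)"
    using gap_far_less [OF unskip_range [OF i j], of b "forget i x"] by (simp add: abs_arc)
qed

text \<open>The moving point stays closer to infinity than the others, so it cannot meet them, and
  the others do not move; \<open>topspace_Q_iff\<close> then excludes new triples.\<close>

lemma push_collar:
  assumes i: "i \<in> {1..n - 1}" and x: "x \<in> collar i" and s: "0 \<le> s" "s \<le> 1"
  shows "push i b (s, x) \<in> collar i"
    and "arc (push i b (s, x) i) = (1 - s) * arc (x i) + s * arc (h (far b (forget i x)))"
proof -
  let ?a = "(1 - s) * arc (x i) + s * arc (h (far b (forget i x)))"
  let ?z = "push i b (s, x)"
  have zi: "?z i = wrap ?a" and zj: "\<And>j. j \<noteq> i \<Longrightarrow> ?z j = x j"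
    by (auto simp: push_def)
  \<comment> \<open>Any index other than \<open>i\<close>, available since n > 2. It bounds the
    argument of \<open>wrap\<close> strictly below 1, so that \<open>arc\<close> recovers
    it.\<close>
  define j0 where "j0 = (if i = 1 then 2 else 1 :: nat)"
  have "j0 \<in> {1..n - 1}" "j0 \<noteq> i"
    using n by (auto simp: j0_def)
  then have a1: "\<bar>?a\<bar> < 1"
    using push_bound [OF i x s, of j0 b] gap_le_1 [of "x j0"] by fastforce
  then have gap_z: "gap (?z i) = \<bar>?a\<bar>"
    by (simp add: zi gap_wrap)
  have less: "gap (?z i) < gap (?z j)" if "j \<in> {1..n - 1} - {i}" for j
    using push_bound [OF i x s, of j b] that by (simp add: gap_z zj)
  have "?z \<in> {1..n - 1} \<rightarrow>\<^sub>E circle"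
    using collar_topspace [OF x] i wrap_circle
    by (auto simp: push_def topspace_Q_space PiE_iff extensional_def simp del: mem_sphere_0)
  moreover have "?z j \<noteq> ?z i \<and> ?z j \<noteq> w" if "j \<in> {1..n - 1} - {i}" for j
    using less [OF that] collar_neq_w [OF x, of j] that by (auto simp: zj)
  moreover have "no_triple ({1..n - 1} - {i}) ?z"
    using collar_no_triple [OF x i] by (subst no_triple_cong [of _ ?z x]) (auto simp: zj)
  ultimately have "?z \<in> topspace Q"
    using topspace_Q_iff [OF _ i] by blast
  then show "?z \<in> collar i"
    using less by (simp add: collar_def)
  show "arc (?z i) = ?a"
    using a1 by (simp only: zi arc_wrap)
qed

text \<open>Start and end of the path have the same strict sign, and so has every convex combination
  of them; the path therefore never reaches infinity.\<close>

lemma push_side: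
  assumes i: "i \<in> {1..n - 1}" and x: "x \<in> side i b" and s: "0 \<le> s" "s \<le> 1"
  shows "push i b (s, x) \<in> side i b"
proof -
  have xc: "x \<in> collar i"
    using x by (simp add: side_def)
  have 1: "if b then arc (x i) > 0 else arc (x i) < 0"
    using x by (simp add: side_def)
  have 2: "if b then arc (h (far b (forget i x))) > 0 else arc (h (far b (forget i x))) < 0"
    by (rule arc_far_sign)
  have 3: "(1 - s) * a + s * t > 0" if "a > 0" "t > 0" for a t
    using that s by (cases "s = 0") (auto intro!: add_nonneg_pos mult_pos_pos)
  have 4: "(1 - s) * a + s * t < 0" if "a < 0" "t < 0" for a t
    using 3 [of "- a" "- t"] that by simp
  have "if b then arc (push i b (s, x) i) > 0 else arc (push i b (s, x) i) < 0"
    unfolding push_collar(2) [OF i xc s] using 1 2 3 4 by (cases b) auto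
  then show ?thesis
    using push_collar(1) [OF i xc s, of b] by (simp add: side_def)
qed

text \<open>Keeping \<open>S\<close> abstract treats the collar and its sides at once. At time 0 the
  motion is trivial because \<open>wrap\<close> undoes \<open>arc\<close>; at time 1 the moving
  point has reached its far position and the other points are as \<open>forget\<close> recorded
  them.\<close>

lemma homotopic_push:
  assumes i: "i \<in> {1..n - 1}" and S: "S \<subseteq> collar i"
    and inv: "\<And>s x. 0 \<le> s \<Longrightarrow> s \<le> 1 \<Longrightarrow> x \<in> S \<Longrightarrow> push i b (s, x) \<in> S"
  shows "homotopic_with (\<lambda>_. True) (subtopology Q S) (subtopology Q S) id
    (config_inclusion n h \<circ> add_far i b \<circ> forget i)"
proof (subst homotopic_with, simp, intro exI conjI ballI)
  let ?P = "prod_topology (top_of_set {0..1::real}) (subtopology Q S)"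
  have S_top: "topspace (subtopology Q S) = S"
    using S collar_topspace by auto
  have topspace_P: "z \<in> topspace ?P \<longleftrightarrow> 0 \<le> fst z \<and> fst z \<le> 1 \<and> snd z \<in> S" for z
    by (simp only: topspace_prod_topology mem_Times_iff S_top topspace_euclidean_subtopology
        atLeastAtMost_iff conj_assoc)
  have fst: "continuous_map ?P euclideanreal fst"
    using continuous_map_fst by (rule continuous_map_into_fulltopology)
  have snd: "continuous_map ?P euclidean (\<lambda>z. f (snd z))"
    if "continuous_map (subtopology Q S) euclidean f" for f :: "(nat \<Rightarrow> complex) \<Rightarrow> 'z::topological_space"
    using continuous_map_compose [OF continuous_map_snd that] by (simp add: o_def)
  have sum_pos: "1 + (1 + (\<Sum>k\<in>{1..n - 2}. \<bar>y k\<bar>)) > (0::real)" for y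
    using sum_abs_nonneg [of y "{1..n - 2}"] by linarith
  have forget_comp: "continuous_map (subtopology Q S) euclideanreal (\<lambda>x. forget i x k)" if "k \<in> {1..n - 2}" for k
    using continuous_map_coord_skip [OF i that S] that by (simp add: forget_def)
  \<comment> \<open>As \<open>arc\<close> is not continuous on the whole circle, continuity of the
    end point of the path is read off an explicit formula; the sign of \<open>far\<close> is
    constant, so no case distinction in \<open>y\<close> remains.\<close>
  have arc_far: "arc (h (far b y)) = (if b then 1 else - 1) / (1 + (1 + (\<Sum>k\<in>{1..n - 2}. \<bar>y k\<bar>)))" for y
    using far_sign [of b y] by (auto simp: arc_h abs_far split: if_splits)
  have "continuous_map (subtopology Q S) euclideanreal
      (\<lambda>x. 1 + (1 + (\<Sum>k\<in>{1..n - 2}. \<bar>forget i x k\<bar>)))"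
    by (intro continuous_map_add continuous_map_sum continuous_map_real_abs forget_comp) simp_all
  moreover have "1 + (1 + (\<Sum>k\<in>{1..n - 2}. \<bar>forget i x k\<bar>)) \<noteq> 0" for x
    using sum_pos [of "forget i x"] by linarith
  ultimately have tip: "continuous_map (subtopology Q S) euclideanreal (\<lambda>x. arc (h (far b (forget i x))))"
    unfolding arc_far by (intro continuous_map_real_divide continuous_map_canonical_const)
  have arg: "continuous_map ?P euclideanreal (\<lambda>z. (1 - fst z) * arc (snd z i) + fst z * arc (h (far b (forget i (snd z)))))"
    by (intro continuous_map_add continuous_map_real_mult continuous_map_diff fst snd [OF tip]
        snd [OF continuous_map_arc [OF i S]]) simp
  \<comment> \<open>Continuity of \<open>wrap\<close> is known on this interval only.\<close>
  have bound: "(1 - s) * arc (x i) + s * arc (h (far b (forget i x))) \<in> {-1..1}"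
    if "0 \<le> s" "s \<le> 1" "x \<in> S" for s x
  proof -
    have "\<bar>arc (push i b (s, x) i)\<bar> \<le> 1"
      unfolding abs_arc by (rule gap_le_1)
    then show ?thesis
      using push_collar(2) [OF i subsetD [OF S that(3)] that(1,2), of b] by auto
  qed
  have "continuous_map ?P (top_of_set {-1..1}) (\<lambda>z. (1 - fst z) * arc (snd z i) + fst z * arc (h (far b (forget i (snd z)))))"
    unfolding continuous_map_in_subtopology
  proof (intro conjI arg funcsetI)
    fix z assume "z \<in> topspace ?P"
    then show "(1 - fst z) * arc (snd z i) + fst z * arc (h (far b (forget i (snd z)))) \<in> {-1..1}"
      using bound topspace_P by blast
  qed
  moreover have "continuous_map (top_of_set {-1..1}) (top_of_set circle) wrap"
    using continuous_on_wrap wrap_circle by (auto simp: continuous_map_in_subtopology simp del: mem_sphere_0)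
  ultimately have wrap: "continuous_map ?P (top_of_set circle)
      (\<lambda>z. wrap ((1 - fst z) * arc (snd z i) + fst z * arc (h (far b (forget i (snd z))))))"
    by (rule continuous_map_compose [unfolded o_def])
  have component: "continuous_map ?P (top_of_set circle) (\<lambda>z. push i b z j)" if j: "j \<in> {1..n - 1}" for j
  proof (cases "j = i")
    case True
    then show ?thesis
      using wrap by (simp add: push_def case_prod_unfold)
  next
    case False
    have "continuous_map (subtopology Q S) euclidean (\<lambda>x. x j)"
      using continuous_map_Q_component [OF j continuous_on_id, of S UNIV] by simp
    from snd [OF this] have "continuous_map ?P (top_of_set circle) (\<lambda>z. snd z j)"
      unfolding continuous_map_in_subtopology
    proof (intro conjI funcsetI)
      fix z assume "z \<in> topspace ?P"
      then show "snd z j \<in> circle"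
        using topspace_Q_circle [OF collar_topspace j] topspace_P S by blast
    qed
    then show ?thesis
      using False by (simp add: push_def case_prod_unfold)
  qed
  have push_S: "push i b z \<in> S" if "z \<in> topspace ?P" for z
    using that inv [of "fst z" "snd z"] topspace_P [of z] by simp
  then have push_Q: "push i b z \<in> topspace Q" if "z \<in> topspace ?P" for z
    using that S collar_topspace by blast
  then have ext: "push i b ` topspace ?P \<subseteq> extensional {1..n - 1}"
    by (auto simp: topspace_Q_space PiE_iff)
  have torus: "continuous_map ?P (torus (n - 1)) (push i b)"
    unfolding torus_def continuous_map_componentwise using ext component by blast
  have "continuous_map ?P Q (push i b)"
    using torus push_Q unfolding Q_space_def by (auto simp: continuous_map_in_subtopology)
  then show "continuous_map ?P (subtopology Q S) (push i b)"
    using push_S by (auto simp: continuous_map_in_subtopology)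
  fix x assume "x \<in> topspace (subtopology Q S)"
  then have x: "x \<in> collar i"
    using S S_top by auto
  have circ: "x j \<in> circle" if "j \<in> {1..n - 1}" for j
    using topspace_Q_circle [OF collar_topspace [OF x] that] .
  show "push i b (0, x) = id x"
    using wrap_arc [OF circ [OF i]] by (simp add: push_def)
  show "push i b (1, x) = (config_inclusion n h \<circ> add_far i b \<circ> forget i) x"
  proof
    fix j
    consider "j \<notin> {1..n - 1}" | "j = i" | "j \<in> {1..n - 1}" "j \<noteq> i"
      by blast
    then show "push i b (1, x) j = (config_inclusion n h \<circ> add_far i b \<circ> forget i) x j"
    proof cases
      case 1
      then show ?thesis
        using i collar_topspace [OF x]
        by (auto simp: push_def config_inclusion_def topspace_Q_space PiE_iff extensional_def)
    next
      case 2
      then show ?thesis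
        using i by (simp add: push_def config_inclusion_def add_far_def wrap_arc [OF h_circle])
    next
      case 3
      then show ?thesis
        using unskip_range [OF i 3] h_coord [OF circ [OF 3(1)] collar_neq_w [OF x 3]]
        by (simp add: push_def config_inclusion_def add_far_def forget_def skip_unskip)
    qed
  qed
qed simp

sublocale two_sided_collars Q "no_three_config (n - 1)" "no_three_config (n - 2)" "{1..n - 1}"
  finite_part collar side "config_inclusion n h" coords forget add_far
proof
  fix i b x
  assume i: "i \<in> {1..n - 1}"
  show "openin Q (collar i)" "openin Q (side i b)" "collar i \<inter> finite_part = side i True \<union> side i False"
    "continuous_map (subtopology Q (collar i)) (no_three_config (n - 2)) (forget i)"
    "continuous_map (no_three_config (n - 2)) (no_three_config (n - 1)) (add_far i b)"
    using i by (rule openin_collar openin_side collar_finite_part continuous_map_forget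
        continuous_map_add_far)+
  show "side i True \<inter> side i False = {}"
    by (rule side_disjoint)
  show "homotopic_with (\<lambda>_. True) (subtopology Q (collar i)) (subtopology Q (collar i)) id
      (config_inclusion n h \<circ> add_far i b \<circ> forget i)"
    by (rule homotopic_push [OF i order_refl push_collar(1) [OF i]])
  show "homotopic_with (\<lambda>_. True) (subtopology Q (side i b)) (subtopology Q (side i b)) id
      (config_inclusion n h \<circ> add_far i b \<circ> forget i)"
    by (rule homotopic_push [OF i _ push_side [OF i]]) (simp add: side_def)
  assume "x \<in> topspace (no_three_config (n - 2))"
  with i show "config_inclusion n h (add_far i b x) \<in> side i b"
    "forget i (config_inclusion n h (add_far i b x)) = x"
    by (rule inclusion_add_far)+
next
  fix i k assume "i \<in> {1..n - 1}" "k \<in> {1..n - 1}" "i \<noteq> k"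
  then show "collar i \<inter> collar k = {}"
    by (rule collar_disjoint)
qed (rule openin_finite_part finite_part_collars homeomorphic_maps_config)+

end

theorem theorem6:
  fixes n :: nat and w :: complex and h :: "real \<Rightarrow> complex"
  assumes "n > 2"
    and "w \<in> circle"
    and "homeomorphic_map euclideanreal (top_of_set (circle - {w})) h"
  shows "\<exists>d \<delta>. \<forall>k::int.
    exact_at
      (product_group {1..n - 1} (\<lambda>_. cohomology_group (k - 1) (no_three_config (n - 2))))
      (\<delta> k)
      (cohomology_group k (Q_space n w))
      (cohom_induced k (no_three_config (n - 1)) (config_inclusion n h))
      (cohomology_group k (no_three_config (n - 1))) \<and>
    exact_at
      (cohomology_group k (Q_space n w))
      (cohom_induced k (no_three_config (n - 1)) (config_inclusion n h))
      (cohomology_group k (no_three_config (n - 1)))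
      (d k)
      (product_group {1..n - 1} (\<lambda>_. cohomology_group k (no_three_config (n - 2)))) \<and>
    exact_at
      (cohomology_group k (no_three_config (n - 1)))
      (d k)
      (product_group {1..n - 1} (\<lambda>_. cohomology_group k (no_three_config (n - 2))))
      (\<delta> (k + 1))
      (cohomology_group (k + 1) (Q_space n w))"
proof -
  interpret config_space w h n
    using assms by unfold_locales
  show ?thesis
    \<comment> \<open>The witness for \<open>d\<close> is the difference of the maps induced by the
      two far positions; the one for \<delta> is the connecting map, indexed by its target degree,
      whence \<open>k + 1\<close> in the last clause.\<close>
    by (intro exI [of _ cut_map] exI [of _ connecting_map] allI conjI)
      (rule exact_at_Q [unfolded coeff_group_def] exact_at_M [unfolded coeff_group_def]
        exact_at_coeff_group [unfolded coeff_group_def])+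
qed

end
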